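(* Let $B\#_\sigma H$ be a crossed product algebra, let $\Omega^\bullet(H)$ be the maximal prolongation of a bicovariant first order differential calculus on $H$, let $\Omega^\bullet(B)$ be a $\sigma$-twisted $H$-module differential calculus on $B$, and let $\Omega^\bullet(B\#_\sigma H)$ be the corresponding (complete) crossed product calculus. Then the base forms of $\Omega^\bullet(B\#_\sigma H)$ coincide with the differential calculus $\Omega^\bullet(B)$ on $B$ (identified with $\Omega^\bullet(B)\otimes\Bbbk 1_H$). Furthermore, the vertical forms are given by $\mathrm{ver}^\bullet=B\otimes\Omega^\bullet(H)$ (under the identification $(B\#_\sigma H)\otimes\Lambda^\bullet\cong B\otimes\Omega^\bullet(H)$ induced by $H\otimes\Lambda^\bullet\cong\Omega^\bullet(H)$, $h\otimes\vartheta\mapsto h\vartheta$), while the horizontal forms are $\mathrm{hor}^\bullet=\Omega^\bullet(B)\otimes H$.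
   Context: Conventions: $\Bbbk$ is a field; everything is $\Bbbk$-linear; algebras are associative and unital. $H$ is a Hopf algebra with invertible antipode, $\Delta(h)=h_1\otimes h_2$; left coactions are written $m_{-1}\otimes m_0$, iterated as $m_{-2}\otimes m_{-1}\otimes m_0$. Crossed products: $B$ is an algebra, $\cdot\colon H\otimes B\to B$ a measure, i.e. $h\cdot(bb')=(h_1\cdot b)(h_2\cdot b')$, $h\cdot1=\varepsilon(h)1$, and $\sigma\colon H\otimes H\to B$ a convolution invertible map such that $1_H\cdot b=b$, $h\cdot(h'\cdot b)=\sigma(h_1\otimes h'_1)(h_2h'_2\cdot b)\sigma^{-1}(h_3\otimes h'_3)$, $\sigma(h\otimes1)=\varepsilon(h)1=\sigma(1\otimes h)$ and $(h_1\cdot\sigma(h'_1\otimes h''_1))\sigma(h_2\otimes h'_2h''_2)=\sigma(h_1\otimes h'_1)\sigma(h_2h'_2\otimes h'')$. The crossed product algebra $B\#_\sigma H$ is $B\otimes H$ with $(b\otimes h)(b'\otimes h')=b(h_1\cdot b')\sigma(h_2\otimes h'_1)\otimes h_3h'_2$; it is a right $H$-comodule algebra via $b\otimes h\mapsto b\otimes h_1\otimes h_2$, with coinvariants $B\cong B\otimes\Bbbk1_H$. Calculi: a differential calculus (DC) on an algebra $A$ is a differential graded algebra (DGA) $(\Omega^\bullet,\wedge,\mathrm{d})$ with $\Omega^0=A$ and $\Omega^k=\mathrm{span}\{a^0\mathrm{d}a^1\wedge\ldots\wedge\mathrm{d}a^k\}$. A first order differential calculus (FODC) $(\Gamma,\mathrm{d})$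 on $H$ ($\Gamma$ an $H$-bimodule, $\mathrm{d}$ satisfying the Leibniz rule, $\Gamma=\mathrm{span}\{h\,\mathrm{d}g\}$) is bicovariant if $h\,\mathrm{d}g\mapsto h_1\mathrm{d}g_1\otimes h_2g_2$ and $h\,\mathrm{d}g\mapsto h_1g_1\otimes h_2\mathrm{d}g_2$ are well defined. Its maximal prolongation is the quotient of the tensor algebra $\bigoplus_k\Gamma^{\otimes_Hk}$ by the ideal generated by all $\sum_i\mathrm{d}h^i\otimes_H\mathrm{d}g^i$ with $\sum_ih^i\mathrm{d}g^i=0$; $\Delta$ extends to a DGA morphism $\Delta^\bullet\colon\Omega^\bullet(H)\to\Omega^\bullet(H)\otimes\Omega^\bullet(H)$ (tensor products of DGAs use Koszul signs), and $\Omega^\bullet(H)$ has a left $H$-coaction $h^0\mathrm{d}h^1\wedge\ldots\wedge\mathrm{d}h^k\mapsto h^0_1\cdots h^k_1\otimes h^0_2\mathrm{d}h^1_2\wedge\ldots\wedge\mathrm{d}h^k_2$, with left coinvariants $\Lambda^\bullet$. A DC $(\Omega^\bullet(B),\mathrm{d}_B)$ is a $\sigma$-twisted $H$-module DC if there are linear maps $\cdot\colon H\otimes\Omega^k(B)\to\Omega^k(B)$, $k\ge1$, with $h\cdot(b^0\mathrm{d}_Bb^1\wedge\ldots\wedge\mathrm{d}_Bb^k)=(h_1\cdot b^0)(h_2\cdot\mathrm{d}_Bb^1)\wedge\ldots\wedge(h_{k+1}\cdot\mathrm{d}_Bb^k)$, $h\cdot\mathrm{d}_Bb=\mathrm{d}_B(h\cdot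 b)$, and $\mathrm{d}_B\circ\sigma=0$. Crossed product calculus: $\Omega^n(B\#_\sigma H)=\bigoplus_{i=0}^n\Omega^{n-i}(B)\otimes\Omega^i(H)$ with, for $\omega\in\Omega^i(B)$, $\eta\in\Omega^j(H)$, $\omega'\in\Omega^k(B)$, $\eta'\in\Omega^\ell(H)$, $(\omega\otimes\eta)\wedge(\omega'\otimes\eta')=(-1)^{jk}\,\omega\wedge(\eta_{-2}\cdot\omega')\sigma(\eta_{-1}\otimes\eta'_{-1})\otimes\eta_0\wedge\eta'_0$ and $\mathrm{d}(\omega\otimes\eta)=\mathrm{d}_B\omega\otimes\eta+(-1)^i\omega\otimes\mathrm{d}_H\eta$. It is known that this is a DC on $B\#_\sigma H$ which is complete: the coaction of $B\#_\sigma H$ extends to the DGA morphism $\Delta^\bullet_{B\#_\sigma H}=\mathrm{id}\otimes\Delta^\bullet\colon\Omega^\bullet(B\#_\sigma H)\to\Omega^\bullet(B\#_\sigma H)\otimes\Omega^\bullet(H)$. Forms: writing $A=B\#_\sigma H$ and $\Delta_A^\bullet=\Delta^\bullet_{B\#_\sigma H}$, the base forms are $\{\omega\in\Omega^\bullet(A):\Delta_A^\bullet(\omega)=\omega\otimes1\}$, the horizontal forms are $\mathrm{hor}^\bullet=(\Delta_A^\bullet)^{-1}(\Omega^\bullet(A)\otimes H)$, and the vertical forms are $\mathrm{ver}^\bullet=A\otimes\Lambda^\bullet$. *)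

theory Defs
  imports Complex_Main "HOL-Library.Function_Algebras"
begin

text \<open>
  Conventions. A vector space is a subspace of a type carrying a
  \<^const>\<open>vector_space\<close> scaling over the field \<open>'k\<close>; the scaling is an explicit
  parameter \<open>s\<close>, \<open>t\<close>, \<open>u\<close>. Ambient algebras have sort \<open>{ring, monoid_mult}\<close> (rather than
  \<open>ring_1\<close>) so that the zero algebra is not excluded. A differential graded algebra lives on
  a whole type, and its homogeneous pieces are subspaces of that type; in particular the algebra
  on which a calculus is defined is literally its degree-zero piece.
  A linear map out of a tensor product such as an action or a cocycle is given as a bilinear map.
\<close>

section \<open>Linear maps and tensor products over a field\<close>

definition fscale :: "'k::times \<Rightarrow> ('x \<Rightarrow> 'k) \<Rightarrow> 'x \<Rightarrow> 'k" where
  "fscale c f = (\<lambda>x. c * f x)"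

definition linear_on ::
  "('k \<Rightarrow> 'v::ab_group_add \<Rightarrow> 'v) \<Rightarrow> ('k \<Rightarrow> 'u::ab_group_add \<Rightarrow> 'u) \<Rightarrow> 'v set \<Rightarrow> ('v \<Rightarrow> 'u) \<Rightarrow> bool"
  where
  "linear_on s u V f \<longleftrightarrow>
     (\<forall>x\<in>V. \<forall>y\<in>V. f (x + y) = f x + f y) \<and> (\<forall>c. \<forall>x\<in>V. f (s c x) = u c (f x))"

definition bilinear_on ::
  "('k \<Rightarrow> 'v::ab_group_add \<Rightarrow> 'v) \<Rightarrow> ('k \<Rightarrow> 'w::ab_group_add \<Rightarrow> 'w) \<Rightarrow> ('k \<Rightarrow> 'u::ab_group_add \<Rightarrow> 'u) \<Rightarrow>
   'v set \<Rightarrow> 'w set \<Rightarrow> ('v \<Rightarrow> 'w \<Rightarrow> 'u) \<Rightarrow> bool"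
  where
  "bilinear_on s t u V W f \<longleftrightarrow>
     (\<forall>w\<in>W. linear_on s u V (\<lambda>v. f v w)) \<and> (\<forall>v\<in>V. linear_on t u W (f v))"

text \<open>
  Over a field the bilinear forms on \<open>V \<times> W\<close> separate the points of the algebraic tensor product,
  so \<open>V \<otimes> W\<close> embeds into the dual of the space of bilinear forms, with \<open>v \<otimes> w\<close> acting by evaluation.
  The lemmas \<open>tensor_universal\<close> and \<open>tensor_unique\<close> below give the universal property.
  For subspaces \<open>V\<close>, \<open>W\<close> the space \<open>tspace s t V W\<close> is \<open>V \<otimes> W\<close> viewed inside the tensor product of the
  ambient spaces.
\<close>

type_synonym ('k, 'v, 'w) tensor = "('v \<Rightarrow> 'w \<Rightarrow> 'k) \<Rightarrow> 'k"

definition tensor ::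
  "('k::field \<Rightarrow> 'v::ab_group_add \<Rightarrow> 'v) \<Rightarrow> ('k \<Rightarrow> 'w::ab_group_add \<Rightarrow> 'w) \<Rightarrow> 'v \<Rightarrow> 'w \<Rightarrow> ('k, 'v, 'w) tensor"
  where
  "tensor s t v w = (\<lambda>\<beta>. if bilinear_on s t (*) UNIV UNIV \<beta> then \<beta> v w else 0)"

definition tspace ::
  "('k::field \<Rightarrow> 'v::ab_group_add \<Rightarrow> 'v) \<Rightarrow> ('k \<Rightarrow> 'w::ab_group_add \<Rightarrow> 'w) \<Rightarrow>
   'v set \<Rightarrow> 'w set \<Rightarrow> ('k, 'v, 'w) tensor set"
  where
  "tspace s t V W = module.span fscale {tensor s t v w |v w. v \<in> V \<and> w \<in> W}"

text \<open>
  The linear map on \<open>V \<otimes> W\<close> induced by a bilinear \<open>f\<close>; it is unique on \<open>tspace s t V W\<close>, and extended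
  linearly in an arbitrary way outside.
\<close>

definition tlift ::
  "('k::field \<Rightarrow> 'v::ab_group_add \<Rightarrow> 'v) \<Rightarrow> ('k \<Rightarrow> 'w::ab_group_add \<Rightarrow> 'w) \<Rightarrow> ('k \<Rightarrow> 'u::ab_group_add \<Rightarrow> 'u) \<Rightarrow>
   'v set \<Rightarrow> 'w set \<Rightarrow> ('v \<Rightarrow> 'w \<Rightarrow> 'u) \<Rightarrow> ('k, 'v, 'w) tensor \<Rightarrow> 'u"
  where
  "tlift s t u V W f =
     (SOME F. Vector_Spaces.linear fscale u F \<and> (\<forall>v\<in>V. \<forall>w\<in>W. F (tensor s t v w) = f v w))"

lemma vector_space_fscale: "vector_space (fscale :: 'k::field \<Rightarrow> ('x \<Rightarrow> 'k) \<Rightarrow> 'x \<Rightarrow> 'k)"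
  by standard (auto simp: fscale_def fun_eq_iff algebra_simps)

lemma sum_fun_apply: "(\<Sum>i\<in>I. f i) x = (\<Sum>i\<in>I. f i x)"
  for f :: "'i \<Rightarrow> 'x \<Rightarrow> 'k::comm_monoid_add"
  by (induction I rule: infinite_finite_induct) auto

lemma linear_extension_of_family:
  fixes s :: "'k::field \<Rightarrow> 'a::ab_group_add \<Rightarrow> 'a" and u :: "'k \<Rightarrow> 'b::ab_group_add \<Rightarrow> 'b"
    and g :: "'i \<Rightarrow> 'a" and y :: "'i \<Rightarrow> 'b"
  assumes s: "vector_space s" and u: "vector_space u"
    and rel: "\<And>I c. finite I \<Longrightarrow> (\<Sum>i\<in>I. s (c i) (g i)) = 0 \<Longrightarrow> (\<Sum>i\<in>I. u (c i) (y i)) = 0"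
  shows "\<exists>F. Vector_Spaces.linear s u F \<and> (\<forall>i. F (g i) = y i)"
proof -
  interpret s: vector_space s by fact
  interpret u: vector_space u by fact
  interpret p: vector_space_pair s u ..
  obtain B where B: "B \<subseteq> range g" "s.independent B" "range g \<subseteq> s.span B"
    using s.maximal_independent_subset by blast
  define idx where "idx b = (SOME i. g i = b)" for b
  have idx: "g (idx b) = b" if "b \<in> B" for b
    unfolding idx_def using B(1) that by (metis (mono_tags, lifting) imageE someI_ex subsetD)
  define F where "F = p.construct B (y \<circ> idx)"
  have lin: "Vector_Spaces.linear s u F"
    unfolding F_def by (rule p.linear_construct[OF B(2)])
  interpret F: Vector_Spaces.linear s u F by (rule lin)
  have "F (g i) = y i" for i
  proof -
    have "g i \<in> s.span B" using B(3) by blast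
    then obtain T c where T: "finite T" "T \<subseteq> B" and gi: "g i = (\<Sum>b\<in>T. s (c b) b)"
      unfolding s.span_explicit by blast
    have inj: "inj_on idx T" by (metis T(2) idx inj_onI subsetD)
    define e where "e j = (if j \<in> idx ` T then c (g j) else 0) - (if j = i then 1 else 0)" for j
    let ?I = "insert i (idx ` T)"
    have fin: "finite ?I" using T(1) by simp
    have split: "(\<Sum>j\<in>?I. sc (e j) (z j)) = (\<Sum>b\<in>T. sc (c b) (z (idx b))) - z i"
      if "vector_space sc" for sc :: "'k \<Rightarrow> 'c::ab_group_add \<Rightarrow> 'c" and z
    proof -
      interpret sc: vector_space sc by fact
      have "(\<Sum>j\<in>?I. sc (e j) (z j)) =
          (\<Sum>j\<in>?I. sc (if j \<in> idx ` T then c (g j) else 0) (z j)) - (\<Sum>j\<in>?I. sc (if j = i then 1 else 0) (z j))"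
        unfolding e_def by (simp only: sc.scale_left_diff_distrib sum_subtractf)
      also have "(\<Sum>j\<in>?I. sc (if j = i then 1 else 0) (z j)) = z i"
        using fin by (subst sum.remove[of _ i]) (auto intro!: sum.neutral)
      also have "(\<Sum>j\<in>?I. sc (if j \<in> idx ` T then c (g j) else 0) (z j)) = (\<Sum>j\<in>idx ` T. sc (c (g j)) (z j))"
        using fin by (intro sum.mono_neutral_cong_right) auto
      also have "\<dots> = (\<Sum>b\<in>T. sc (c b) (z (idx b)))"
        using T(2) idx by (subst sum.reindex[OF inj]) (auto intro!: sum.cong)
      finally show ?thesis .
    qed
    have "(\<Sum>b\<in>T. s (c b) (g (idx b))) = g i"
      unfolding gi using T(2) idx by (auto intro!: sum.cong)
    then have "(\<Sum>j\<in>?I. s (e j) (g j)) = 0" by (simp add: split[OF s])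
    then have "(\<Sum>j\<in>?I. u (e j) (y j)) = 0" by (rule rel[OF fin])
    then have "(\<Sum>b\<in>T. u (c b) (y (idx b))) = y i" by (simp add: split[OF u])
    moreover have "F (g i) = (\<Sum>b\<in>T. u (c b) (y (idx b)))"
      unfolding gi F.sum F.scale
      using T(2) by (intro sum.cong) (auto simp: F_def p.construct_basis[OF B(2)])
    ultimately show ?thesis by simp
  qed
  with lin show ?thesis by blast
qed

lemma separating_functional:
  fixes u :: "'k::field \<Rightarrow> 'u::ab_group_add \<Rightarrow> 'u"
  assumes u: "vector_space u" and z: "z \<noteq> 0"
  shows "\<exists>\<phi>. Vector_Spaces.linear u (*) \<phi> \<and> \<phi> z = 1"
proof -
  interpret u: vector_space u by fact
  interpret k: vector_space "(*) :: 'k \<Rightarrow> 'k \<Rightarrow> 'k" by standard (auto simp: algebra_simps)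
  interpret p: vector_space_pair u "(*) :: 'k \<Rightarrow> 'k \<Rightarrow> 'k" ..
  have "u.independent {z}" using z by simp
  from p.linear_construct[OF this] p.construct_basis[OF this, of z "\<lambda>_. 1"] show ?thesis by blast
qed

lemma tensor_universal:
  fixes s :: "'k::field \<Rightarrow> 'v::ab_group_add \<Rightarrow> 'v" and t :: "'k \<Rightarrow> 'w::ab_group_add \<Rightarrow> 'w"
    and u :: "'k \<Rightarrow> 'u::ab_group_add \<Rightarrow> 'u"
  assumes s: "vector_space s" and t: "vector_space t" and u: "vector_space u"
    and V: "module.subspace s V" and W: "module.subspace t W"
    and f: "bilinear_on s t u V W f"
  shows "\<exists>F. Vector_Spaces.linear fscale u F \<and> (\<forall>v\<in>V. \<forall>w\<in>W. F (tensor s t v w) = f v w)"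
proof -
  interpret s: vector_space s by fact
  interpret t: vector_space t by fact
  interpret u: vector_space u by fact
  interpret ss: vector_space_pair s s ..
  interpret tt: vector_space_pair t t ..
  have fs: "vector_space (fscale :: 'k \<Rightarrow> ('k, 'v, 'w) tensor \<Rightarrow> ('k, 'v, 'w) tensor)"
    by (rule vector_space_fscale)
  obtain p where p: "p ` UNIV \<subseteq> V" "Vector_Spaces.linear s s p" "\<forall>v\<in>V. p v = v"
    using ss.linear_exists_left_inverse_on[OF s.linear_id V] by auto
  obtain q where q: "q ` UNIV \<subseteq> W" "Vector_Spaces.linear t t q" "\<forall>w\<in>W. q w = w"
    using tt.linear_exists_left_inverse_on[OF t.linear_id W] by auto
  interpret p: Vector_Spaces.linear s s p by fact
  interpret q: Vector_Spaces.linear t t q by fact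
  define f' where "f' v w = f (p v) (q w)" for v w
  have pV: "p v \<in> V" and qW: "q w \<in> W" for v w using p(1) q(1) by auto
  have f'1: "f' (v + v') w = f' v w + f' v' w" "f' (s c v) w = u c (f' v w)"
    and f'2: "f' v (w + w') = f' v w + f' v w'" "f' v (t c w) = u c (f' v w)" for v v' w w' c
    using f pV qW unfolding f'_def bilinear_on_def linear_on_def
    by (auto simp: p.add q.add p.scale q.scale)
  have "\<exists>F. Vector_Spaces.linear fscale u F \<and>
      (\<forall>i. F ((\<lambda>(v, w). tensor s t v w) i) = (\<lambda>(v, w). f' v w) i)"
  proof (rule linear_extension_of_family[OF fs u])
    fix I :: "('v \<times> 'w) set" and c
    assume I: "finite I" and eq: "(\<Sum>i\<in>I. fscale (c i) ((\<lambda>(v, w). tensor s t v w) i)) = 0"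
    show "(\<Sum>i\<in>I. u (c i) ((\<lambda>(v, w). f' v w) i)) = 0" (is "?z = 0")
    proof (rule ccontr)
      assume "?z \<noteq> 0"
      then obtain \<phi> where \<phi>: "Vector_Spaces.linear u (*) \<phi>" "\<phi> ?z = 1"
        using separating_functional[OF u] by blast
      interpret \<phi>: Vector_Spaces.linear u "(*)" \<phi> by fact
      let ?\<beta> = "\<lambda>v w. \<phi> (f' v w)"
      have \<beta>: "bilinear_on s t (*) UNIV UNIV ?\<beta>"
        unfolding bilinear_on_def linear_on_def by (auto simp: f'1 f'2 \<phi>.add \<phi>.scale)
      have "(\<Sum>i\<in>I. fscale (c i) ((\<lambda>(v, w). tensor s t v w) i)) ?\<beta> = 0" by (simp add: eq)
      then have "(\<Sum>(v, w)\<in>I. c (v, w) * \<phi> (f' v w)) = 0"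
        by (simp add: sum_fun_apply fscale_def tensor_def \<beta> case_prod_beta)
      moreover have "\<phi> ?z = (\<Sum>(v, w)\<in>I. c (v, w) * \<phi> (f' v w))"
        by (simp add: \<phi>.sum \<phi>.scale case_prod_beta)
      ultimately show False using \<phi>(2) by simp
    qed
  qed
  then obtain F where F: "Vector_Spaces.linear fscale u F" "\<And>v w. F (tensor s t v w) = f' v w"
    by auto
  then show ?thesis using p(3) q(3) by (auto simp: f'_def intro!: exI[of _ F])
qed

lemma tensor_unique:
  fixes F G :: "('k::field, 'v::ab_group_add, 'w::ab_group_add) tensor \<Rightarrow> 'u::ab_group_add"
  assumes F: "Vector_Spaces.linear fscale u F" and G: "Vector_Spaces.linear fscale u G"
    and eq: "\<And>v w. v \<in> V \<Longrightarrow> w \<in> W \<Longrightarrow> F (tensor s t v w) = G (tensor s t v w)"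
    and x: "x \<in> tspace s t V W"
  shows "F x = G x"
proof -
  have pair: "vector_space_pair (fscale :: 'k \<Rightarrow> ('k, 'v, 'w) tensor \<Rightarrow> _) u"
    using F unfolding Vector_Spaces.linear_def vector_space_pair_def by blast
  show ?thesis
    using vector_space_pair.linear_eq_on[OF pair F G, of x "{tensor s t v w |v w. v \<in> V \<and> w \<in> W}"] x eq
    unfolding tspace_def by blast
qed

lemma
  assumes "vector_space s" "vector_space t" "vector_space u"
    "module.subspace s V" "module.subspace t W" "bilinear_on s t u V W f"
  shows tlift_linear: "Vector_Spaces.linear fscale u (tlift s t u V W f)"
    and tlift_tensor: "v \<in> V \<Longrightarrow> w \<in> W \<Longrightarrow> tlift s t u V W f (tensor s t v w) = f v w"
  using someI_ex[OF tensor_universal[OF assms]] unfolding tlift_def by blast+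

section \<open>Algebras and Hopf algebras\<close>

text \<open>
  The ambient multiplication is associative by the sort; \<open>A\<close> is a unital subalgebra of it.
\<close>

locale k_algebra =
  fixes s :: "'k::field \<Rightarrow> 'a::{ring,monoid_mult} \<Rightarrow> 'a" and A :: "'a set"
  assumes vector_space: "vector_space s"
    and scale_mult_left: "s c x * y = s c (x * y)"
    and scale_mult_right: "x * s c y = s c (x * y)"
    and subspace: "module.subspace s A"
    and one_closed: "1 \<in> A"
    and mult_closed: "x \<in> A \<Longrightarrow> y \<in> A \<Longrightarrow> x * y \<in> A"

text \<open>
  Sweedler notation: \<open>sweedler s H \<Delta> u f h\<close> is \<open>f h\<^sub>1 h\<^sub>2\<close> for a bilinear \<open>f\<close> with values in a space with
  scaling \<open>u\<close>, and \<open>sweedler3\<close> is \<open>f h\<^sub>1 h\<^sub>2 h\<^sub>3\<close>.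
\<close>

definition sweedler ::
  "('k::field \<Rightarrow> 'h::ab_group_add \<Rightarrow> 'h) \<Rightarrow> 'h set \<Rightarrow> ('h \<Rightarrow> ('k, 'h, 'h) tensor) \<Rightarrow>
   ('k \<Rightarrow> 'u::ab_group_add \<Rightarrow> 'u) \<Rightarrow> ('h \<Rightarrow> 'h \<Rightarrow> 'u) \<Rightarrow> 'h \<Rightarrow> 'u"
  where
  "sweedler s H \<Delta> u f h = tlift s s u H H f (\<Delta> h)"

definition sweedler3 ::
  "('k::field \<Rightarrow> 'h::ab_group_add \<Rightarrow> 'h) \<Rightarrow> 'h set \<Rightarrow> ('h \<Rightarrow> ('k, 'h, 'h) tensor) \<Rightarrow>
   ('k \<Rightarrow> 'u::ab_group_add \<Rightarrow> 'u) \<Rightarrow> ('h \<Rightarrow> 'h \<Rightarrow> 'h \<Rightarrow> 'u) \<Rightarrow> 'h \<Rightarrow> 'u"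
  where
  "sweedler3 s H \<Delta> u f h =
     sweedler s H \<Delta> u (\<lambda>h12 h3. sweedler s H \<Delta> u (\<lambda>h1 h2. f h1 h2 h3) h12) h"

locale hopf_algebra = k_algebra s H
  for s :: "'k::field \<Rightarrow> 'h::{ring,monoid_mult} \<Rightarrow> 'h" and H :: "'h set" +
  fixes \<Delta> :: "'h \<Rightarrow> ('k, 'h, 'h) tensor" and \<epsilon> :: "'h \<Rightarrow> 'k" and S :: "'h \<Rightarrow> 'h"
  assumes comult_closed: "h \<in> H \<Longrightarrow> \<Delta> h \<in> tspace s s H H"
    and comult_linear: "linear_on s fscale H \<Delta>"
    and counit_linear: "linear_on s (*) H \<epsilon>"
    and coassoc: "h \<in> H \<Longrightarrow>
      sweedler s H \<Delta> fscale
        (\<lambda>a b. sweedler s H \<Delta> fscale (\<lambda>a1 a2. tensor s fscale a1 (tensor s s a2 b)) a) h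
      = sweedler s H \<Delta> fscale (\<lambda>a b. tensor s fscale a (\<Delta> b)) h"
    and counit_left: "h \<in> H \<Longrightarrow> sweedler s H \<Delta> s (\<lambda>h1 h2. s (\<epsilon> h1) h2) h = h"
    and counit_right: "h \<in> H \<Longrightarrow> sweedler s H \<Delta> s (\<lambda>h1 h2. s (\<epsilon> h2) h1) h = h"
    and comult_mult: "h \<in> H \<Longrightarrow> g \<in> H \<Longrightarrow>
      \<Delta> (h * g) =
        sweedler s H \<Delta> fscale (\<lambda>h1 h2. sweedler s H \<Delta> fscale (\<lambda>g1 g2. tensor s s (h1 * g1) (h2 * g2)) g) h"
    and comult_one: "\<Delta> 1 = tensor s s 1 1"
    and counit_mult: "h \<in> H \<Longrightarrow> g \<in> H \<Longrightarrow> \<epsilon> (h * g) = \<epsilon> h * \<epsilon> g"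
    and counit_one: "\<epsilon> 1 = 1"
    and antipode_linear: "linear_on s s H S"
    and antipode_left: "h \<in> H \<Longrightarrow> sweedler s H \<Delta> s (\<lambda>h1 h2. S h1 * h2) h = s (\<epsilon> h) 1"
    and antipode_right: "h \<in> H \<Longrightarrow> sweedler s H \<Delta> s (\<lambda>h1 h2. h1 * S h2) h = s (\<epsilon> h) 1"
    and antipode_bij: "bij_betw S H H"

section \<open>Crossed product data\<close>

text \<open>Convolution product of two maps \<open>H \<otimes> H \<rightarrow> B\<close>.\<close>

definition convolution2 ::
  "('k::field \<Rightarrow> 'h::ab_group_add \<Rightarrow> 'h) \<Rightarrow> 'h set \<Rightarrow> ('h \<Rightarrow> ('k, 'h, 'h) tensor) \<Rightarrow>
   ('k \<Rightarrow> 'b::ring \<Rightarrow> 'b) \<Rightarrow> ('h \<Rightarrow> 'h \<Rightarrow> 'b) \<Rightarrow> ('h \<Rightarrow> 'h \<Rightarrow> 'b) \<Rightarrow> 'h \<Rightarrow> 'h \<Rightarrow> 'b"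
  where
  "convolution2 s H \<Delta> t \<sigma> \<tau> h g =
     sweedler s H \<Delta> t (\<lambda>h1 h2. sweedler s H \<Delta> t (\<lambda>g1 g2. \<sigma> h1 g1 * \<tau> h2 g2) g) h"

text \<open>
  \<open>act h b\<close> is \<open>h \<cdot> b\<close>, and \<open>\<sigma>'\<close> is the (unique) convolution inverse of \<open>\<sigma>\<close>. In the calculus below
  \<open>B\<close> is the degree-zero piece and \<open>act\<close> also acts on forms; here only its restriction to \<open>B\<close> matters.
\<close>

locale crossed_product = hopf_algebra s H \<Delta> \<epsilon> S + B: k_algebra t B
  for s :: "'k::field \<Rightarrow> 'h::{ring,monoid_mult} \<Rightarrow> 'h" and H \<Delta> \<epsilon> S
    and t :: "'k \<Rightarrow> 'b::{ring,monoid_mult} \<Rightarrow> 'b" and B +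
  fixes act :: "'h \<Rightarrow> 'b \<Rightarrow> 'b" and \<sigma> \<sigma>' :: "'h \<Rightarrow> 'h \<Rightarrow> 'b"
  assumes act_bilinear: "bilinear_on s t t H B act"
    and act_closed: "h \<in> H \<Longrightarrow> b \<in> B \<Longrightarrow> act h b \<in> B"
    and act_mult: "h \<in> H \<Longrightarrow> b \<in> B \<Longrightarrow> b' \<in> B \<Longrightarrow>
      act h (b * b') = sweedler s H \<Delta> t (\<lambda>h1 h2. act h1 b * act h2 b') h"
    and act_unit: "h \<in> H \<Longrightarrow> act h 1 = t (\<epsilon> h) 1"
    and cocycle_bilinear: "bilinear_on s s t H H \<sigma>"
    and cocycle_closed: "h \<in> H \<Longrightarrow> g \<in> H \<Longrightarrow> \<sigma> h g \<in> B"
    and cocycle_inv_bilinear: "bilinear_on s s t H H \<sigma>'"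
    and cocycle_inv_closed: "h \<in> H \<Longrightarrow> g \<in> H \<Longrightarrow> \<sigma>' h g \<in> B"
    and cocycle_inv_right: "h \<in> H \<Longrightarrow> g \<in> H \<Longrightarrow> convolution2 s H \<Delta> t \<sigma> \<sigma>' h g = t (\<epsilon> h * \<epsilon> g) 1"
    and cocycle_inv_left: "h \<in> H \<Longrightarrow> g \<in> H \<Longrightarrow> convolution2 s H \<Delta> t \<sigma>' \<sigma> h g = t (\<epsilon> h * \<epsilon> g) 1"
    and act_one: "b \<in> B \<Longrightarrow> act 1 b = b"
    and act_twisted: "h \<in> H \<Longrightarrow> g \<in> H \<Longrightarrow> b \<in> B \<Longrightarrow>
      act h (act g b) =
        sweedler3 s H \<Delta> t (\<lambda>h1 h2 h3.
          sweedler3 s H \<Delta> t (\<lambda>g1 g2 g3. \<sigma> h1 g1 * act (h2 * g2) b * \<sigma>' h3 g3) g) h"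
    and cocycle_unit_right: "h \<in> H \<Longrightarrow> \<sigma> h 1 = t (\<epsilon> h) 1"
    and cocycle_unit_left: "h \<in> H \<Longrightarrow> \<sigma> 1 h = t (\<epsilon> h) 1"
    and cocycle: "h \<in> H \<Longrightarrow> g \<in> H \<Longrightarrow> l \<in> H \<Longrightarrow>
      sweedler s H \<Delta> t (\<lambda>h1 h2.
        sweedler s H \<Delta> t (\<lambda>g1 g2.
          sweedler s H \<Delta> t (\<lambda>l1 l2. act h1 (\<sigma> g1 l1) * \<sigma> h2 (g2 * l2)) l) g) h
      = sweedler s H \<Delta> t (\<lambda>h1 h2.
          sweedler s H \<Delta> t (\<lambda>g1 g2. \<sigma> h1 g1 * \<sigma> (h2 * g2) l) g) h"

section \<open>Differential graded algebras and differential calculi\<close>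

definition decomposes :: "(nat \<Rightarrow> 'a::ab_group_add set) \<Rightarrow> 'a \<Rightarrow> (nat \<Rightarrow> 'a) \<Rightarrow> bool" where
  "decomposes \<Omega> x f \<longleftrightarrow>
     (\<forall>k. f k \<in> \<Omega> k) \<and> finite {k. f k \<noteq> 0} \<and> x = (\<Sum>k | f k \<noteq> 0. f k)"

locale dga =
  fixes s :: "'k::field \<Rightarrow> 'a::{ring,monoid_mult} \<Rightarrow> 'a"
    and \<Omega> :: "nat \<Rightarrow> 'a set" and d :: "'a \<Rightarrow> 'a"
  assumes algebra: "k_algebra s UNIV"
    and degree_subspace: "module.subspace s (\<Omega> k)"
    and direct_sum: "\<exists>!f. decomposes \<Omega> x f"
    and one_degree: "1 \<in> \<Omega> 0"
    and mult_degree: "x \<in> \<Omega> k \<Longrightarrow> y \<in> \<Omega> l \<Longrightarrow> x * y \<in> \<Omega> (k + l)"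
    and diff_linear: "Vector_Spaces.linear s s d"
    and diff_degree: "x \<in> \<Omega> k \<Longrightarrow> d x \<in> \<Omega> (Suc k)"
    and diff_diff: "d (d x) = 0"
    and diff_mult: "x \<in> \<Omega> k \<Longrightarrow> d (x * y) = d x * y + s ((-1) ^ k) (x * d y)"

locale differential_calculus = dga s \<Omega> d
  for s :: "'k::field \<Rightarrow> 'a::{ring,monoid_mult} \<Rightarrow> 'a" and A :: "'a set"
    and \<Omega> :: "nat \<Rightarrow> 'a set" and d :: "'a \<Rightarrow> 'a" +
  assumes degree_zero: "\<Omega> 0 = A"
    and degree_span: "\<Omega> k = module.span s
      {a * prod_list (map d as) |a as. a \<in> A \<and> set as \<subseteq> A \<and> length as = k}"

definition hcomp :: "(nat \<Rightarrow> 'a::ab_group_add set) \<Rightarrow> nat \<Rightarrow> 'a \<Rightarrow> 'a" where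
  "hcomp \<Omega> k x = (THE f. decomposes \<Omega> x f) k"

text \<open>
  For bilinear \<open>f\<close>, \<open>koszul \<Omega> \<Omega>' u f\<close> is the bilinear map with value \<open>(-1)\<^bsup>j k\<^esup> f x y\<close> on \<open>x \<in> \<Omega> j\<close>,
  \<open>y \<in> \<Omega>' k\<close>.
\<close>

definition koszul ::
  "(nat \<Rightarrow> 'a::ab_group_add set) \<Rightarrow> (nat \<Rightarrow> 'b::ab_group_add set) \<Rightarrow>
   ('k::field \<Rightarrow> 'u::ab_group_add \<Rightarrow> 'u) \<Rightarrow> ('a \<Rightarrow> 'b \<Rightarrow> 'u) \<Rightarrow> 'a \<Rightarrow> 'b \<Rightarrow> 'u"
  where
  "koszul \<Omega> \<Omega>' u f x y =
     (\<Sum>j | hcomp \<Omega> j x \<noteq> 0. \<Sum>k | hcomp \<Omega>' k y \<noteq> 0.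
        u ((-1) ^ (j * k)) (f (hcomp \<Omega> j x) (hcomp \<Omega>' k y)))"

definition grade_inv ::
  "('k::field \<Rightarrow> 'a::ab_group_add \<Rightarrow> 'a) \<Rightarrow> (nat \<Rightarrow> 'a set) \<Rightarrow> 'a \<Rightarrow> 'a"
  where
  "grade_inv s \<Omega> x = (\<Sum>k | hcomp \<Omega> k x \<noteq> 0. s ((-1) ^ k) (hcomp \<Omega> k x))"

text \<open>The tensor product of two differential graded algebras.\<close>

definition tensor_degree ::
  "('k::field \<Rightarrow> 'a::ab_group_add \<Rightarrow> 'a) \<Rightarrow> (nat \<Rightarrow> 'a set) \<Rightarrow>
   ('k \<Rightarrow> 'b::ab_group_add \<Rightarrow> 'b) \<Rightarrow> (nat \<Rightarrow> 'b set) \<Rightarrow> nat \<Rightarrow> ('k, 'a, 'b) tensor set"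
  where
  "tensor_degree s \<Omega> t \<Omega>' n = module.span fscale
     {tensor s t x y |x y i. i \<le> n \<and> x \<in> \<Omega> (n - i) \<and> y \<in> \<Omega>' i}"

definition tensor_mult ::
  "('k::field \<Rightarrow> 'a::ring \<Rightarrow> 'a) \<Rightarrow> (nat \<Rightarrow> 'a set) \<Rightarrow>
   ('k \<Rightarrow> 'b::ring \<Rightarrow> 'b) \<Rightarrow> (nat \<Rightarrow> 'b set) \<Rightarrow>
   ('k, 'a, 'b) tensor \<Rightarrow> ('k, 'a, 'b) tensor \<Rightarrow> ('k, 'a, 'b) tensor"
  where
  "tensor_mult s \<Omega> t \<Omega>' X Y =
     tlift s t fscale UNIV UNIV (\<lambda>a b.
       tlift s t fscale UNIV UNIV (\<lambda>a' b'.
         koszul \<Omega>' \<Omega> fscale (\<lambda>b a'. tensor s t (a * a') (b * b')) b a') Y) X"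

definition tensor_diff ::
  "('k::field \<Rightarrow> 'a::ab_group_add \<Rightarrow> 'a) \<Rightarrow> (nat \<Rightarrow> 'a set) \<Rightarrow> ('a \<Rightarrow> 'a) \<Rightarrow>
   ('k \<Rightarrow> 'b::ab_group_add \<Rightarrow> 'b) \<Rightarrow> ('b \<Rightarrow> 'b) \<Rightarrow> ('k, 'a, 'b) tensor \<Rightarrow> ('k, 'a, 'b) tensor"
  where
  "tensor_diff s \<Omega> d t d' =
     tlift s t fscale UNIV UNIV (\<lambda>a b. tensor s t (d a) b + tensor s t (grade_inv s \<Omega> a) (d' b))"

section \<open>Bicovariant first order calculi and the maximal prolongation\<close>

text \<open>
  \<open>\<Gamma>\<close> is a subspace of an ambient algebra containing \<open>H\<close>, whose multiplication provides the bimodule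
  structure; only the restriction of \<open>d\<close> to \<open>H\<close> matters.
\<close>

locale first_order_calculus = k_algebra s H
  for s :: "'k::field \<Rightarrow> 'h::{ring,monoid_mult} \<Rightarrow> 'h" and H :: "'h set" +
  fixes \<Gamma> :: "'h set" and d :: "'h \<Rightarrow> 'h"
  assumes bimodule_subspace: "module.subspace s \<Gamma>"
    and left_module: "h \<in> H \<Longrightarrow> x \<in> \<Gamma> \<Longrightarrow> h * x \<in> \<Gamma>"
    and right_module: "x \<in> \<Gamma> \<Longrightarrow> h \<in> H \<Longrightarrow> x * h \<in> \<Gamma>"
    and deriv_linear: "linear_on s s H d"
    and leibniz: "h \<in> H \<Longrightarrow> g \<in> H \<Longrightarrow> d (h * g) = d h * g + h * d g"
    and bimodule_span: "\<Gamma> = module.span s {h * d g |h g. h \<in> H \<and> g \<in> H}"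

locale bicovariant_calculus = first_order_calculus s H \<Gamma> d
  for s :: "'k::field \<Rightarrow> 'h::{ring,monoid_mult} \<Rightarrow> 'h" and H :: "'h set"
    and \<Delta> :: "'h \<Rightarrow> ('k, 'h, 'h) tensor" and \<Gamma> :: "'h set" and d :: "'h \<Rightarrow> 'h" +
  assumes right_covariant: "\<exists>\<rho>. linear_on s fscale \<Gamma> \<rho> \<and> (\<forall>h\<in>H. \<forall>g\<in>H.
      \<rho> (h * d g) = sweedler s H \<Delta> fscale (\<lambda>h1 h2.
        sweedler s H \<Delta> fscale (\<lambda>g1 g2. tensor s s (h1 * d g1) (h2 * g2)) g) h)"
    and left_covariant: "\<exists>L. linear_on s fscale \<Gamma> L \<and> (\<forall>h\<in>H. \<forall>g\<in>H.
      L (h * d g) = sweedler s H \<Delta> fscale (\<lambda>h1 h2.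
        sweedler s H \<Delta> fscale (\<lambda>g1 g2. tensor s s (h1 * g1) (h2 * d g2)) g) h)"

text \<open>
  The tensor algebra in positive degrees, \<open>\<Gamma> \<otimes>\<^sub>H \<dots> \<otimes>\<^sub>H \<Gamma>\<close>, is the space of formal linear combinations
  of nonempty words in \<open>\<Gamma>\<close> modulo multilinearity and \<open>H\<close>-balancedness (\<open>tensor_relators\<close>); its
  degree-zero piece is \<open>H\<close>. A word \<open>[x\<^sub>1,\<dots>,x\<^sub>k]\<close> is represented by \<open>word [x\<^sub>1,\<dots>,x\<^sub>k]\<close>.
  The two-sided ideal generated by the elements \<open>\<Sum>\<^sub>i d h\<^sub>i \<otimes>\<^sub>H d g\<^sub>i\<close> with \<open>\<Sum>\<^sub>i h\<^sub>i d g\<^sub>i = 0\<close> is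
  spanned by the \<open>prolongation_relators\<close>: multiplication by degree-zero elements enters through
  \<open>a\<close>, \<open>b\<close>, and multiplication by elements of positive degree through the words \<open>p\<close>, \<open>q\<close>.
\<close>

definition word :: "'a list \<Rightarrow> 'a list \<Rightarrow> 'k::field" where
  "word w = (\<lambda>v. if v = w then 1 else 0)"

definition formal_words :: "'a set \<Rightarrow> ('a list \<Rightarrow> 'k::field) set" where
  "formal_words \<Gamma> = module.span fscale {word w |w. w \<in> lists \<Gamma> \<and> w \<noteq> []}"

definition eval_word ::
  "('k::field \<Rightarrow> 'a::{ring,monoid_mult} \<Rightarrow> 'a) \<Rightarrow> ('a list \<Rightarrow> 'k) \<Rightarrow> 'a"
  where
  "eval_word s P = (\<Sum>w | P w \<noteq> 0. s (P w) (prod_list w))"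

definition tensor_relators ::
  "('k::field \<Rightarrow> 'a::{ring,monoid_mult} \<Rightarrow> 'a) \<Rightarrow> 'a set \<Rightarrow> 'a set \<Rightarrow> ('a list \<Rightarrow> 'k) set"
  where
  "tensor_relators s H \<Gamma> =
     {word (p @ [x + y] @ q) - word (p @ [x] @ q) - word (p @ [y] @ q)
       |p q x y. p \<in> lists \<Gamma> \<and> q \<in> lists \<Gamma> \<and> x \<in> \<Gamma> \<and> y \<in> \<Gamma>} \<union>
     {word (p @ [s c x] @ q) - fscale c (word (p @ [x] @ q))
       |p q c x. p \<in> lists \<Gamma> \<and> q \<in> lists \<Gamma> \<and> x \<in> \<Gamma>} \<union>
     {word (p @ [x * h, y] @ q) - word (p @ [x, h * y] @ q)
       |p q x h y. p \<in> lists \<Gamma> \<and> q \<in> lists \<Gamma> \<and> x \<in> \<Gamma> \<and> h \<in> H \<and> y \<in> \<Gamma>}"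

definition prolongation_relators ::
  "'a::{ring,monoid_mult} set \<Rightarrow> 'a set \<Rightarrow> ('a \<Rightarrow> 'a) \<Rightarrow> ('a list \<Rightarrow> 'k::field) set"
  where
  "prolongation_relators H \<Gamma> d =
     {(\<Sum>(h, g)\<leftarrow>hgs. word (p @ [a * d h, d g * b] @ q))
       |p q a b hgs. p \<in> lists \<Gamma> \<and> q \<in> lists \<Gamma> \<and> a \<in> H \<and> b \<in> H \<and> set hgs \<subseteq> H \<times> H \<and>
         (\<Sum>(h, g)\<leftarrow>hgs. h * d g) = 0}"

text \<open>
  A calculus \<open>\<Omega>\<close> is the maximal prolongation of its first order part \<open>(\<Gamma>, d)\<close> if it is the quotient of
  the tensor algebra by this ideal, i.e. if the canonical map from the tensor algebra (which is
  onto for every differential calculus and is the identity in degrees zero and one) has the ideal as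
  its kernel.
\<close>

locale maximal_prolongation = differential_calculus s H \<Omega> d
  for s :: "'k::field \<Rightarrow> 'a::{ring,monoid_mult} \<Rightarrow> 'a" and H \<Gamma> :: "'a set"
    and \<Omega> :: "nat \<Rightarrow> 'a set" and d :: "'a \<Rightarrow> 'a" +
  assumes degree_one: "\<Omega> 1 = \<Gamma>"
    and kernel: "{P \<in> formal_words \<Gamma>. eval_word s P = 0} =
      module.span fscale (tensor_relators s H \<Gamma> \<union> prolongation_relators H \<Gamma> d)"

text \<open>The extension of the comultiplication of \<open>H\<close> to a morphism of differential graded algebras.\<close>

definition dga_comult ::
  "('k::field \<Rightarrow> 'a::{ring,monoid_mult} \<Rightarrow> 'a) \<Rightarrow> 'a set \<Rightarrow> ('a \<Rightarrow> ('k, 'a, 'a) tensor) \<Rightarrow>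
   (nat \<Rightarrow> 'a set) \<Rightarrow> ('a \<Rightarrow> 'a) \<Rightarrow> 'a \<Rightarrow> ('k, 'a, 'a) tensor"
  where
  "dga_comult s H \<Delta> \<Omega> d = (SOME D.
     Vector_Spaces.linear s fscale D \<and>
     (\<forall>h\<in>H. D h = \<Delta> h) \<and>
     (\<forall>k. \<forall>x\<in>\<Omega> k. D x \<in> tensor_degree s \<Omega> s \<Omega> k) \<and>
     (\<forall>x y. D (x * y) = tensor_mult s \<Omega> s \<Omega> (D x) (D y)) \<and>
     (\<forall>x. D (d x) = tensor_diff s \<Omega> d s d (D x)))"

text \<open>
  \<open>coaction_word s H \<Delta> d x y [h\<^sup>1,\<dots>,h\<^sup>k]\<close> is \<open>x h\<^sup>1\<^sub>1\<cdots>h\<^sup>k\<^sub>1 \<otimes> y d h\<^sup>1\<^sub>2 \<cdots> d h\<^sup>k\<^sub>2\<close>.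
\<close>

primrec coaction_word ::
  "('k::field \<Rightarrow> 'a::{ring,monoid_mult} \<Rightarrow> 'a) \<Rightarrow> 'a set \<Rightarrow> ('a \<Rightarrow> ('k, 'a, 'a) tensor) \<Rightarrow>
   ('a \<Rightarrow> 'a) \<Rightarrow> 'a \<Rightarrow> 'a \<Rightarrow> 'a list \<Rightarrow> ('k, 'a, 'a) tensor"
  where
  "coaction_word s H \<Delta> d x y [] = tensor s s x y"
| "coaction_word s H \<Delta> d x y (h # hs) =
     sweedler s H \<Delta> fscale (\<lambda>h1 h2. coaction_word s H \<Delta> d (x * h1) (y * d h2) hs) h"

definition left_coaction ::
  "('k::field \<Rightarrow> 'a::{ring,monoid_mult} \<Rightarrow> 'a) \<Rightarrow> 'a set \<Rightarrow> ('a \<Rightarrow> ('k, 'a, 'a) tensor) \<Rightarrow>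
   ('a \<Rightarrow> 'a) \<Rightarrow> 'a \<Rightarrow> ('k, 'a, 'a) tensor"
  where
  "left_coaction s H \<Delta> d = (SOME L.
     Vector_Spaces.linear s fscale L \<and>
     (\<forall>h\<in>H. \<forall>hs. set hs \<subseteq> H \<longrightarrow>
       L (h * prod_list (map d hs)) =
         sweedler s H \<Delta> fscale (\<lambda>h1 h2. coaction_word s H \<Delta> d h1 h2 hs) h))"

definition left_coinvariants ::
  "('k::field \<Rightarrow> 'a::{ring,monoid_mult} \<Rightarrow> 'a) \<Rightarrow> 'a set \<Rightarrow> ('a \<Rightarrow> ('k, 'a, 'a) tensor) \<Rightarrow>
   ('a \<Rightarrow> 'a) \<Rightarrow> 'a set"
  where
  "left_coinvariants s H \<Delta> d = {\<theta>. left_coaction s H \<Delta> d \<theta> = tensor s s 1 \<theta>}"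

text \<open>\<open>cosweedler s H \<Delta> d u f \<eta>\<close> is \<open>f \<eta>\<^bsub>-1\<^esub> \<eta>\<^bsub>0\<^esub>\<close>, and \<open>cosweedler3\<close> is \<open>f \<eta>\<^bsub>-2\<^esub> \<eta>\<^bsub>-1\<^esub> \<eta>\<^bsub>0\<^esub>\<close>.\<close>

definition cosweedler ::
  "('k::field \<Rightarrow> 'a::{ring,monoid_mult} \<Rightarrow> 'a) \<Rightarrow> 'a set \<Rightarrow> ('a \<Rightarrow> ('k, 'a, 'a) tensor) \<Rightarrow>
   ('a \<Rightarrow> 'a) \<Rightarrow> ('k \<Rightarrow> 'u::ab_group_add \<Rightarrow> 'u) \<Rightarrow> ('a \<Rightarrow> 'a \<Rightarrow> 'u) \<Rightarrow> 'a \<Rightarrow> 'u"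
  where
  "cosweedler s H \<Delta> d u f \<eta> = tlift s s u H UNIV f (left_coaction s H \<Delta> d \<eta>)"

definition cosweedler3 ::
  "('k::field \<Rightarrow> 'a::{ring,monoid_mult} \<Rightarrow> 'a) \<Rightarrow> 'a set \<Rightarrow> ('a \<Rightarrow> ('k, 'a, 'a) tensor) \<Rightarrow>
   ('a \<Rightarrow> 'a) \<Rightarrow> ('k \<Rightarrow> 'u::ab_group_add \<Rightarrow> 'u) \<Rightarrow> ('a \<Rightarrow> 'a \<Rightarrow> 'a \<Rightarrow> 'u) \<Rightarrow> 'a \<Rightarrow> 'u"
  where
  "cosweedler3 s H \<Delta> d u f \<eta> =
     cosweedler s H \<Delta> d u (\<lambda>h \<eta>0. sweedler s H \<Delta> u (\<lambda>h1 h2. f h1 h2 \<eta>0) h) \<eta>"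

section \<open>Twisted module calculi and the crossed product calculus\<close>

text \<open>
  \<open>iterated_act s H \<Delta> t act [y\<^sub>1,\<dots>,y\<^sub>k] x h\<close> is \<open>(h\<^sub>1 \<cdot> x) (h\<^sub>2 \<cdot> y\<^sub>1) \<cdots> (h\<^bsub>k+1\<^esub> \<cdot> y\<^sub>k)\<close>.
\<close>

primrec iterated_act ::
  "('k::field \<Rightarrow> 'h::ab_group_add \<Rightarrow> 'h) \<Rightarrow> 'h set \<Rightarrow> ('h \<Rightarrow> ('k, 'h, 'h) tensor) \<Rightarrow>
   ('k \<Rightarrow> 'b::ring \<Rightarrow> 'b) \<Rightarrow> ('h \<Rightarrow> 'b \<Rightarrow> 'b) \<Rightarrow> 'b list \<Rightarrow> 'b \<Rightarrow> 'h \<Rightarrow> 'b"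
  where
  "iterated_act s H \<Delta> t act [] x h = act h x"
| "iterated_act s H \<Delta> t act (y # ys) x h =
     sweedler s H \<Delta> t (\<lambda>h1 h2. act h1 x * iterated_act s H \<Delta> t act ys y h2) h"

text \<open>
  The actions on the pieces \<open>\<Omega> k\<close> are collected in one map \<open>act\<close>, which in degree zero is the measure of
  the crossed product.
\<close>

locale twisted_module_calculus = differential_calculus t B \<Omega> d
  for s :: "'k::field \<Rightarrow> 'h::{ring,monoid_mult} \<Rightarrow> 'h" and H :: "'h set"
    and \<Delta> :: "'h \<Rightarrow> ('k, 'h, 'h) tensor"
    and t :: "'k \<Rightarrow> 'b::{ring,monoid_mult} \<Rightarrow> 'b" and B :: "'b set"
    and \<Omega> :: "nat \<Rightarrow> 'b set" and d :: "'b \<Rightarrow> 'b" +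
  fixes act :: "'h \<Rightarrow> 'b \<Rightarrow> 'b" and \<sigma> :: "'h \<Rightarrow> 'h \<Rightarrow> 'b"
  assumes forms_act_bilinear: "bilinear_on s t t H UNIV act"
    and forms_act_degree: "h \<in> H \<Longrightarrow> x \<in> \<Omega> k \<Longrightarrow> act h x \<in> \<Omega> k"
    and forms_act_mult: "h \<in> H \<Longrightarrow> b \<in> B \<Longrightarrow> set bs \<subseteq> B \<Longrightarrow>
      act h (b * prod_list (map d bs)) = iterated_act s H \<Delta> t act (map d bs) b h"
    and forms_act_diff: "h \<in> H \<Longrightarrow> b \<in> B \<Longrightarrow> act h (d b) = d (act h b)"
    and diff_cocycle: "h \<in> H \<Longrightarrow> g \<in> H \<Longrightarrow> d (\<sigma> h g) = 0"

text \<open>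
  The crossed product calculus has underlying graded space \<open>\<Omega>(B) \<otimes> \<Omega>(H)\<close>, with degree-\<open>n\<close> piece
  \<open>tensor_degree t \<Omega>B s \<Omega>H n\<close> and unit \<open>1 \<otimes> 1\<close>. Its differential is
  \<open>tensor_diff t \<Omega>B dB s dH\<close>. The product below restricts in degree zero to that of the crossed product
  algebra on \<open>B \<otimes> H\<close>, because the left coaction of \<open>\<Omega>(H)\<close> restricts to \<open>\<Delta>\<close> on \<open>H\<close>.
\<close>

definition crossed_mult ::
  "('k::field \<Rightarrow> 'h::{ring,monoid_mult} \<Rightarrow> 'h) \<Rightarrow> 'h set \<Rightarrow> ('h \<Rightarrow> ('k, 'h, 'h) tensor) \<Rightarrow>
   (nat \<Rightarrow> 'h set) \<Rightarrow> ('h \<Rightarrow> 'h) \<Rightarrow>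
   ('k \<Rightarrow> 'b::{ring,monoid_mult} \<Rightarrow> 'b) \<Rightarrow> (nat \<Rightarrow> 'b set) \<Rightarrow>
   ('h \<Rightarrow> 'b \<Rightarrow> 'b) \<Rightarrow> ('h \<Rightarrow> 'h \<Rightarrow> 'b) \<Rightarrow>
   ('k, 'b, 'h) tensor \<Rightarrow> ('k, 'b, 'h) tensor \<Rightarrow> ('k, 'b, 'h) tensor"
  where
  "crossed_mult s H \<Delta> \<Omega>H dH t \<Omega>B act \<sigma> X Y =
     tlift t s fscale UNIV UNIV (\<lambda>\<omega> \<eta>.
       tlift t s fscale UNIV UNIV (\<lambda>\<omega>' \<eta>'.
         koszul \<Omega>H \<Omega>B fscale (\<lambda>\<eta> \<omega>'.
           cosweedler3 s H \<Delta> dH fscale (\<lambda>h2 h1 \<eta>0.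
             cosweedler s H \<Delta> dH fscale (\<lambda>h1' \<eta>0'.
               tensor t s (\<omega> * act h2 \<omega>' * \<sigma> h1 h1') (\<eta>0 * \<eta>0')) \<eta>') \<eta>) \<eta> \<omega>') Y) X"

text \<open>
  \<open>id \<otimes> \<Delta>\<^sup>\<bullet>\<close>, where \<open>\<Omega>(B) \<otimes> (\<Omega>(H) \<otimes> \<Omega>(H))\<close> is identified with \<open>(\<Omega>(B) \<otimes> \<Omega>(H)) \<otimes> \<Omega>(H)\<close>.
\<close>

definition crossed_coaction ::
  "('k::field \<Rightarrow> 'h::{ring,monoid_mult} \<Rightarrow> 'h) \<Rightarrow> 'h set \<Rightarrow> ('h \<Rightarrow> ('k, 'h, 'h) tensor) \<Rightarrow>
   (nat \<Rightarrow> 'h set) \<Rightarrow> ('h \<Rightarrow> 'h) \<Rightarrow> ('k \<Rightarrow> 'b::{ring,monoid_mult} \<Rightarrow> 'b) \<Rightarrow>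
   ('k, 'b, 'h) tensor \<Rightarrow> ('k, ('k, 'b, 'h) tensor, 'h) tensor"
  where
  "crossed_coaction s H \<Delta> \<Omega>H dH t =
     tlift t s fscale UNIV UNIV (\<lambda>\<omega> \<eta>.
       tlift s s fscale UNIV UNIV (\<lambda>\<eta>1 \<eta>2. tensor fscale s (tensor t s \<omega> \<eta>1) \<eta>2)
         (dga_comult s H \<Delta> \<Omega>H dH \<eta>))"

definition base_forms ::
  "('k::field \<Rightarrow> 'h::{ring,monoid_mult} \<Rightarrow> 'h) \<Rightarrow> 'h set \<Rightarrow> ('h \<Rightarrow> ('k, 'h, 'h) tensor) \<Rightarrow>
   (nat \<Rightarrow> 'h set) \<Rightarrow> ('h \<Rightarrow> 'h) \<Rightarrow> ('k \<Rightarrow> 'b::{ring,monoid_mult} \<Rightarrow> 'b) \<Rightarrow>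
   ('k, 'b, 'h) tensor set"
  where
  "base_forms s H \<Delta> \<Omega>H dH t =
     {X \<in> tspace t s UNIV UNIV. crossed_coaction s H \<Delta> \<Omega>H dH t X = tensor fscale s X 1}"

definition horizontal_forms ::
  "('k::field \<Rightarrow> 'h::{ring,monoid_mult} \<Rightarrow> 'h) \<Rightarrow> 'h set \<Rightarrow> ('h \<Rightarrow> ('k, 'h, 'h) tensor) \<Rightarrow>
   (nat \<Rightarrow> 'h set) \<Rightarrow> ('h \<Rightarrow> 'h) \<Rightarrow> ('k \<Rightarrow> 'b::{ring,monoid_mult} \<Rightarrow> 'b) \<Rightarrow>
   ('k, 'b, 'h) tensor set"
  where
  "horizontal_forms s H \<Delta> \<Omega>H dH t =
     {X \<in> tspace t s UNIV UNIV.
        crossed_coaction s H \<Delta> \<Omega>H dH t X \<in> tspace fscale s (tspace t s UNIV UNIV) H}"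

definition vertical_forms ::
  "('k::field \<Rightarrow> 'h::{ring,monoid_mult} \<Rightarrow> 'h) \<Rightarrow> 'h set \<Rightarrow> ('h \<Rightarrow> ('k, 'h, 'h) tensor) \<Rightarrow>
   ('h \<Rightarrow> 'h) \<Rightarrow> ('k \<Rightarrow> 'b::{ring,monoid_mult} \<Rightarrow> 'b) \<Rightarrow> 'b set \<Rightarrow>
   ('k, ('k, 'b, 'h) tensor, 'h) tensor set"
  where
  "vertical_forms s H \<Delta> dH t B = tspace fscale s (tspace t s B H) (left_coinvariants s H \<Delta> dH)"

end

theory Submission
  imports Defs
begin

text \<open>
  The comultiplication extends to \<open>\<Delta>\<^sup>\<bullet>\<close> because the maximal prolongation has a universal property: an algebra
  map on \<open>H\<close> and a compatible map on \<open>\<Gamma>\<close> into the degrees zero and one of any differential graded algebra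
  kill the generators of the defining ideal. The left coaction is the component of \<open>\<Delta>\<^sup>\<bullet>\<close> in \<open>H \<otimes> \<Omega>(H)\<close>, so
  it is multiplicative and coassociative. The counit, extended by zero to forms of positive degree,
  satisfies \<open>(\<epsilon> \<otimes> id) \<Delta>\<^sup>\<bullet> = id\<close>; applied to the middle factor of \<open>\<Omega>(B) \<otimes> \<Omega>(H) \<otimes> \<Omega>(H)\<close> it recovers a form from its
  image under \<open>id \<otimes> \<Delta>\<^sup>\<bullet>\<close>, which determines the base and horizontal forms. The vertical forms come from the
  fundamental theorem of Hopf modules for \<open>\<Omega>(H)\<close>, with inverse \<open>\<eta> \<mapsto> \<eta>\<^bsub>-2\<^esub> \<otimes> S(\<eta>\<^bsub>-1\<^esub>) \<eta>\<^bsub>0\<^esub>\<close>.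
\<close>

section \<open>Linear maps and tensors\<close>

text \<open>\<open>tlift\<close>, \<open>dga_comult\<close> and \<open>left_coaction\<close> are
  \<open>SOME\<close> terms and carry information only once a witness exists. For
  \<open>dga_comult\<close> the witness is the hard step: it starts as a linear map on formal words,
  which are linearly independent, and descends to forms because \<open>kernel\<close> lists
  everything that evaluation kills. For \<open>left_coaction\<close> uniqueness is wanted too, and
  it holds because the products h dh_1...dh_k span \<Omega>(H). A second obstacle:
  \<open>tlift\<close> is controlled only for bilinear arguments, so nested Sweedler sums would
  raise side conditions at every rewrite. They are moved to \<open>tsum\<close>, a finite sum over
  one fixed representative, which is additive in the function and commutes with other such sums
  unconditionally; bilinearity enters only when the tensor itself varies. Coassociativity and the
  counit law on \<Omega>(H) are checked on H and dH and carried to products by multiplicativity. The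
  left legs of the coaction lie in degree zero, so these computations show no Koszul signs.\<close>

lemma linear_iff:
  "Vector_Spaces.linear s u F \<longleftrightarrow> vector_space s \<and> vector_space u \<and>
     (\<forall>x y. F (x + y) = F x + F y) \<and> (\<forall>c x. F (s c x) = u c (F x))"
proof
  assume "Vector_Spaces.linear s u F"
  then interpret Vector_Spaces.linear s u F .
  show "vector_space s \<and> vector_space u \<and>
     (\<forall>x y. F (x + y) = F x + F y) \<and> (\<forall>c x. F (s c x) = u c (F x))"
    using add scale vs1.vector_space_axioms vs2.vector_space_axioms by blast
next
  assume "vector_space s \<and> vector_space u \<and>
     (\<forall>x y. F (x + y) = F x + F y) \<and> (\<forall>c x. F (s c x) = u c (F x))"
  then show "Vector_Spaces.linear s u F"
    unfolding Vector_Spaces.linear_def module_hom_def module_hom_axioms_def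
    by (simp add: module_iff_vector_space)
qed

lemma linear_add: "Vector_Spaces.linear s u F \<Longrightarrow> F (x + y) = F x + F y"
  and linear_scale: "Vector_Spaces.linear s u F \<Longrightarrow> F (s c x) = u c (F x)"
  by (simp_all add: linear_iff)

lemma linear_zero: "Vector_Spaces.linear s u F \<Longrightarrow> F 0 = 0"
  using linear_add[of s u F 0 0] by simp

lemma linear_sum: "Vector_Spaces.linear s u F \<Longrightarrow> F (\<Sum>i\<in>I. f i) = (\<Sum>i\<in>I. F (f i))"
  using linear_add[of s u F] linear_zero[of s u F] by (induction I rule: infinite_finite_induct) auto

lemma linear_diff: "Vector_Spaces.linear s u F \<Longrightarrow> F (x - y) = F x - F y"
  using linear_add[of s u F "x - y" y] by simp

lemma bilinear_onD:
  assumes "bilinear_on s t u V W f" and "v \<in> V" "w \<in> W"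
  shows "v' \<in> V \<Longrightarrow> f (v + v') w = f v w + f v' w" "f (s c v) w = u c (f v w)"
    "w' \<in> W \<Longrightarrow> f v (w + w') = f v w + f v w'" "f v (t c w) = u c (f v w)"
  using assms unfolding bilinear_on_def linear_on_def by blast+

lemma bilinear_onI:
  assumes "\<And>v v' w. v \<in> V \<Longrightarrow> v' \<in> V \<Longrightarrow> w \<in> W \<Longrightarrow> f (v + v') w = f v w + f v' w"
    "\<And>c v w. v \<in> V \<Longrightarrow> w \<in> W \<Longrightarrow> f (s c v) w = u c (f v w)"
    "\<And>v w w'. v \<in> V \<Longrightarrow> w \<in> W \<Longrightarrow> w' \<in> W \<Longrightarrow> f v (w + w') = f v w + f v w'"
    "\<And>c v w. v \<in> V \<Longrightarrow> w \<in> W \<Longrightarrow> f v (t c w) = u c (f v w)"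
  shows "bilinear_on s t u V W f"
  using assms unfolding bilinear_on_def linear_on_def by blast

text \<open>Tensors and formal words are both functions into the field, so this single
  interpretation serves both.\<close>

interpretation fs: vector_space "fscale :: 'k::field \<Rightarrow> ('x \<Rightarrow> 'k) \<Rightarrow> 'x \<Rightarrow> 'k"
  by (rule vector_space_fscale)

lemma span_closed:
  assumes F: "Vector_Spaces.linear s u F" and W: "module.subspace u W"
    and G: "\<And>x. x \<in> G \<Longrightarrow> F x \<in> W" and x: "x \<in> module.span s G"
  shows "F x \<in> W"
proof -
  interpret s: vector_space s using F by (simp add: linear_iff)
  interpret u: vector_space u using F by (simp add: linear_iff)
  show ?thesis using x
    by (induction rule: s.span_induct_alt)
      (simp_all add: linear_add[OF F] linear_scale[OF F] linear_zero[OF F] G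
        u.subspace_0[OF W] u.subspace_add[OF W] u.subspace_scale[OF W])
qed

lemma span_eqI:
  assumes F: "Vector_Spaces.linear s u F" and F': "Vector_Spaces.linear s u F'"
    and G: "\<And>x. x \<in> G \<Longrightarrow> F x = F' x" and x: "x \<in> module.span s G"
  shows "F x = F' x"
proof -
  interpret s: vector_space s using F by (simp add: linear_iff)
  show ?thesis using x
    by (induction rule: s.span_induct_alt)
      (simp_all add: linear_add[OF F] linear_scale[OF F] linear_zero[OF F] G
         linear_add[OF F'] linear_scale[OF F'] linear_zero[OF F'])
qed

text \<open>Both composites are linear, so being the identity on spanning sets makes them the
  identity on the spans. Isomorphisms of tensor spaces are obtained from this by giving an explicit
  inverse.\<close>

lemma bij_betw_span:
  assumes F: "Vector_Spaces.linear s u F" and G: "Vector_Spaces.linear u s G"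
    and FX: "\<And>x. x \<in> X \<Longrightarrow> F x \<in> module.span u Y" and GY: "\<And>y. y \<in> Y \<Longrightarrow> G y \<in> module.span s X"
    and GF: "\<And>x. x \<in> X \<Longrightarrow> G (F x) = x" and FG: "\<And>y. y \<in> Y \<Longrightarrow> F (G y) = y"
  shows "bij_betw F (module.span s X) (module.span u Y)"
proof -
  interpret s: vector_space s using F by (simp add: linear_iff)
  interpret u: vector_space u using F by (simp add: linear_iff)
  have 1: "F x \<in> module.span u Y" if "x \<in> module.span s X" for x
    using span_closed[OF F u.subspace_span FX that] .
  have 2: "G x \<in> module.span s X" if "x \<in> module.span u Y" for x
    using span_closed[OF G s.subspace_span GY that] .
  have "Vector_Spaces.linear s s (\<lambda>x. G (F x))" "Vector_Spaces.linear u u (\<lambda>x. F (G x))"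
    using F G by (simp_all add: linear_iff)
  from span_eqI[OF this(1) s.linear_ident] span_eqI[OF this(2) u.linear_ident] GF FG
  have "\<And>x. x \<in> module.span s X \<Longrightarrow> G (F x) = x" "\<And>y. y \<in> module.span u Y \<Longrightarrow> F (G y) = y"
    by blast+
  then show ?thesis using 1 2 by (intro bij_betw_byWitness[where f' = G]) auto
qed

text \<open>One fixed way to write a tensor as a finite sum of pure tensors. The subspaces are
  parameters so that the chosen factors lie in them.\<close>

definition tensor_rep ::
  "('k::field \<Rightarrow> 'v::ab_group_add \<Rightarrow> 'v) \<Rightarrow> ('k \<Rightarrow> 'w::ab_group_add \<Rightarrow> 'w) \<Rightarrow>
   'v set \<Rightarrow> 'w set \<Rightarrow> ('k, 'v, 'w) tensor \<Rightarrow> nat \<times> (nat \<Rightarrow> 'v) \<times> (nat \<Rightarrow> 'w)"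
  where
  "tensor_rep s t V W x = (SOME (n, a, b). range a \<subseteq> V \<and> range b \<subseteq> W \<and>
     x = (\<Sum>i<n. tensor s t (a i) (b i)))"

text \<open>A stand-in for \<open>tlift\<close> that makes sense for every \<open>f\<close>. As a
  plain sum over a fixed representative it respects sums, scalars and linear images of
  \<open>f\<close> without bilinearity; for bilinear \<open>f\<close> it agrees with
  \<open>tlift\<close>.\<close>

definition tsum ::
  "('k::field \<Rightarrow> 'v::ab_group_add \<Rightarrow> 'v) \<Rightarrow> ('k \<Rightarrow> 'w::ab_group_add \<Rightarrow> 'w) \<Rightarrow>
   'v set \<Rightarrow> 'w set \<Rightarrow> ('v \<Rightarrow> 'w \<Rightarrow> 'u::ab_group_add) \<Rightarrow> ('k, 'v, 'w) tensor \<Rightarrow> 'u"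
  where
  "tsum s t V W f x = (case tensor_rep s t V W x of (n, a, b) \<Rightarrow> \<Sum>i<n. f (a i) (b i))"

lemma tsum_add_fun: "tsum s t V W (\<lambda>v w. f v w + g v w) x = tsum s t V W f x + tsum s t V W g x"
  by (simp add: tsum_def sum.distrib split: prod.split)

lemma tsum_zero_fun [simp]: "tsum s t V W (\<lambda>v w. 0) x = 0"
  by (simp add: tsum_def split: prod.split)

lemma tsum_diff_fun: "tsum s t V W (\<lambda>v w. f v w - g v w) x = tsum s t V W f x - tsum s t V W g x"
  by (simp add: tsum_def sum_subtractf split: prod.split)

lemma tsum_linear_image:
  "Vector_Spaces.linear u u' F \<Longrightarrow> F (tsum s t V W f x) = tsum s t V W (\<lambda>v w. F (f v w)) x"
  by (simp add: tsum_def linear_sum split: prod.split)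

lemma tsum_scale_fun:
  assumes "vector_space u"
  shows "tsum s t V W (\<lambda>v w. u c (f v w)) x = u c (tsum s t V W f x)"
proof -
  interpret u: vector_space u by fact
  show ?thesis by (simp add: tsum_def u.scale_sum_right split: prod.split)
qed

text \<open>Both sides are finite double sums over fixed index sets.\<close>

lemma tsum_swap:
  "tsum s t V W (\<lambda>v w. tsum s' t' V' W' (\<lambda>v' w'. f v w v' w') y) x =
   tsum s' t' V' W' (\<lambda>v' w'. tsum s t V W (\<lambda>v w. f v w v' w') x) y"
  by (simp add: tsum_def split: prod.split) (intro allI impI, rule sum.swap)

lemma tensor_bilinear:
  assumes "vector_space s" "vector_space t"
  shows "bilinear_on s t fscale UNIV UNIV (tensor s t)"
  by (rule bilinear_onI)
    (auto simp: tensor_def fscale_def fun_eq_iff bilinear_on_def linear_on_def algebra_simps)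

lemma tspace_mono: "V \<subseteq> V' \<Longrightarrow> W \<subseteq> W' \<Longrightarrow> tspace s t V W \<subseteq> tspace s t V' W'"
  unfolding tspace_def by (rule fs.span_mono) auto

locale tensor_pair = s: vector_space s + t: vector_space t
  for s :: "'k::field \<Rightarrow> 'v::ab_group_add \<Rightarrow> 'v" and t :: "'k \<Rightarrow> 'w::ab_group_add \<Rightarrow> 'w" +
  fixes V :: "'v set" and W :: "'w set"
  assumes subspace_V: "s.subspace V" and subspace_W: "t.subspace W"
begin

lemma zero_V: "0 \<in> V" and add_V: "v \<in> V \<Longrightarrow> v' \<in> V \<Longrightarrow> v + v' \<in> V" and scale_V: "v \<in> V \<Longrightarrow> s c v \<in> V"
  using subspace_V by (auto simp: s.subspace_def)

lemma zero_W: "0 \<in> W"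
  using subspace_W by (auto simp: t.subspace_def)

lemma tensor_add_left: "tensor s t (v + v') w = tensor s t v w + tensor s t v' w"
  and tensor_scale_left: "tensor s t (s c v) w = fscale c (tensor s t v w)"
  and tensor_add_right: "tensor s t v (w + w') = tensor s t v w + tensor s t v w'"
  and tensor_scale_right: "tensor s t v (t c w) = fscale c (tensor s t v w)"
  using tensor_bilinear[OF s.vector_space_axioms t.vector_space_axioms]
  by (auto simp: bilinear_on_def linear_on_def)

lemma linear_tensor_left: "Vector_Spaces.linear s fscale (\<lambda>v. tensor s t v w)"
  and linear_tensor_right: "Vector_Spaces.linear t fscale (tensor s t v)"
  by (simp_all add: linear_iff s.vector_space_axioms t.vector_space_axioms vector_space_fscale
      tensor_add_left tensor_scale_left tensor_add_right tensor_scale_right)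

lemma tensor_zero_left [simp]: "tensor s t 0 w = 0"
  and tensor_zero_right [simp]: "tensor s t v 0 = 0"
  using linear_zero[OF linear_tensor_left] linear_zero[OF linear_tensor_right] by auto

lemma tensor_in: "v \<in> V \<Longrightarrow> w \<in> W \<Longrightarrow> tensor s t v w \<in> tspace s t V W"
  unfolding tspace_def by (rule fs.span_base) auto

lemma subspace_tspace: "module.subspace fscale (tspace s t V W)"
  unfolding tspace_def by (rule fs.subspace_span)

lemma tspace_add: "x \<in> tspace s t V W \<Longrightarrow> y \<in> tspace s t V W \<Longrightarrow> x + y \<in> tspace s t V W"
  and tspace_scale: "x \<in> tspace s t V W \<Longrightarrow> fscale c x \<in> tspace s t V W"
  and tspace_zero: "0 \<in> tspace s t V W"
  unfolding tspace_def by (rule fs.span_add fs.span_scale fs.span_zero; assumption?)+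

text \<open>The scalars of a linear combination are absorbed into the left factors, so sums of pure
  tensors suffice.\<close>

lemma tspace_explicit:
  assumes "x \<in> tspace s t V W"
  shows "\<exists>n a b. range a \<subseteq> V \<and> range b \<subseteq> W \<and> x = (\<Sum>i<(n::nat). tensor s t (a i) (b i))"
  using assms unfolding tspace_def
proof (induction rule: fs.span_induct_alt)
  case base
  \<comment> \<open>The empty sum still needs total factor functions with range in the subspaces;
    the constant zero supplies them.\<close>
  show ?case using zero_V zero_W by (intro exI[of _ 0] exI[of _ "\<lambda>_. 0"]) auto
next
  case (step c x y)
  then obtain v w where x: "x = tensor s t v w" "v \<in> V" "w \<in> W" by auto
  from step obtain n a b where y: "range a \<subseteq> V" "range b \<subseteq> W" "y = (\<Sum>i<(n::nat). tensor s t (a i) (b i))"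
    by auto
  have "fscale c x + y = (\<Sum>i<Suc n. tensor s t ((a(n := s c v)) i) ((b(n := w)) i))"
    by (simp add: x y tensor_scale_left add.commute)
  moreover have "range (a(n := s c v)) \<subseteq> V" "range (b(n := w)) \<subseteq> W"
    using x y scale_V by auto
  ultimately show ?case by blast
qed

lemma tensor_repE:
  assumes "x \<in> tspace s t V W"
  obtains n a b where "tensor_rep s t V W x = (n, a, b)" "\<And>i. a i \<in> V" "\<And>i. b i \<in> W"
    "x = (\<Sum>i<n. tensor s t (a i) (b i))"
proof -
  obtain n :: nat and a b where "range a \<subseteq> V" "range b \<subseteq> W"
      "x = (\<Sum>i<n. tensor s t (a i) (b i))"
    using tspace_explicit[OF assms] by blast
  then have "\<exists>p. case p of (n, a, b) \<Rightarrow> range a \<subseteq> V \<and> range b \<subseteq> W \<and>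
     x = (\<Sum>i<(n::nat). tensor s t (a i) (b i))"
    by (intro exI[of _ "(n, a, b)"]) (simp only: prod.case)
  from someI_ex[OF this] have rep: "case tensor_rep s t V W x of (n, a, b) \<Rightarrow>
      range a \<subseteq> V \<and> range b \<subseteq> W \<and> x = (\<Sum>i<n. tensor s t (a i) (b i))"
    unfolding tensor_rep_def .
  obtain n a b where eq: "tensor_rep s t V W x = (n, a, b)" by (cases "tensor_rep s t V W x") auto
  show ?thesis
    by (rule that[OF eq]) (use rep in \<open>auto simp: eq\<close>)
qed

lemma tsum_cong:
  assumes "x \<in> tspace s t V W" and "\<And>v w. v \<in> V \<Longrightarrow> w \<in> W \<Longrightarrow> f v w = g v w"
  shows "tsum s t V W f x = tsum s t V W g x"
  by (rule tensor_repE[OF assms(1)]) (simp add: tsum_def assms(2))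

lemma linear_eq_tsum:
  assumes "Vector_Spaces.linear fscale u F" and "x \<in> tspace s t V W"
  shows "F x = tsum s t V W (\<lambda>v w. F (tensor s t v w)) x"
proof -
  obtain n a b where "tensor_rep s t V W x = (n, a, b)" "x = (\<Sum>i<n. tensor s t (a i) (b i))"
    by (rule tensor_repE[OF assms(2)]) blast
  then show ?thesis by (simp add: tsum_def linear_sum[OF assms(1)])
qed

lemma tsum_tensor: "x \<in> tspace s t V W \<Longrightarrow> tsum s t V W (tensor s t) x = x"
  using linear_eq_tsum[OF fs.linear_ident] by simp

lemma tsum_in:
  assumes "module.subspace u U" "vector_space u" "x \<in> tspace s t V W"
    "\<And>v w. v \<in> V \<Longrightarrow> w \<in> W \<Longrightarrow> f v w \<in> U"
  shows "tsum s t V W f x \<in> U"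
proof -
  interpret u: vector_space u by fact
  show ?thesis
    by (rule tensor_repE[OF assms(3)]) (simp add: tsum_def u.subspace_sum[OF assms(1)] assms(4))
qed

lemma linear_tlift:
  "vector_space u \<Longrightarrow> bilinear_on s t u V W f \<Longrightarrow> Vector_Spaces.linear fscale u (tlift s t u V W f)"
  using tlift_linear s.vector_space_axioms t.vector_space_axioms subspace_V subspace_W by blast

lemma tlift_pure:
  "vector_space u \<Longrightarrow> bilinear_on s t u V W f \<Longrightarrow> v \<in> V \<Longrightarrow> w \<in> W \<Longrightarrow>
    tlift s t u V W f (tensor s t v w) = f v w"
  using tlift_tensor s.vector_space_axioms t.vector_space_axioms subspace_V subspace_W by blast

text \<open>The bridge out of the \<open>SOME\<close> definition: bilinearity makes the sum
  independent of the representative.\<close>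

lemma tlift_eq_tsum:
  assumes "vector_space u" "bilinear_on s t u V W f" "x \<in> tspace s t V W"
  shows "tlift s t u V W f x = tsum s t V W f x"
  unfolding linear_eq_tsum[OF linear_tlift[OF assms(1,2)] assms(3)]
  by (rule tsum_cong[OF assms(3)]) (rule tlift_pure[OF assms(1,2)])

lemma tsum_eq_linear:
  assumes "Vector_Spaces.linear fscale u F" "x \<in> tspace s t V W"
    and "\<And>v w. v \<in> V \<Longrightarrow> w \<in> W \<Longrightarrow> f v w = F (tensor s t v w)"
  shows "tsum s t V W f x = F x"
  using linear_eq_tsum[OF assms(1,2)] tsum_cong[OF assms(2), of f] assms(3) by simp

lemma
  assumes u: "vector_space u" and f: "bilinear_on s t u V W f"
  shows tsum_pure: "v \<in> V \<Longrightarrow> w \<in> W \<Longrightarrow> tsum s t V W f (tensor s t v w) = f v w"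
    and tsum_add: "x \<in> tspace s t V W \<Longrightarrow> y \<in> tspace s t V W \<Longrightarrow>
      tsum s t V W f (x + y) = tsum s t V W f x + tsum s t V W f y"
    and tsum_scale: "x \<in> tspace s t V W \<Longrightarrow> tsum s t V W f (fscale c x) = u c (tsum s t V W f x)"
proof -
  note eq = tlift_eq_tsum[OF u f, symmetric] and lin = linear_tlift[OF u f]
  show "tsum s t V W f (tensor s t v w) = f v w" if "v \<in> V" "w \<in> W"
    unfolding eq[OF tensor_in[OF that]] by (rule tlift_pure[OF u f that])
  show "tsum s t V W f (x + y) = tsum s t V W f x + tsum s t V W f y"
    if "x \<in> tspace s t V W" "y \<in> tspace s t V W"
    unfolding eq[OF tspace_add[OF that]] eq[OF that(1)] eq[OF that(2)] by (rule linear_add[OF lin])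
  show "tsum s t V W f (fscale c x) = u c (tsum s t V W f x)" if "x \<in> tspace s t V W"
    unfolding eq[OF tspace_scale[OF that]] eq[OF that] by (rule linear_scale[OF lin])
qed

end

section \<open>Graded spaces\<close>

locale graded_space = vector_space s
  for s :: "'k::field \<Rightarrow> 'a::ab_group_add \<Rightarrow> 'a" and \<Omega> :: "nat \<Rightarrow> 'a set" +
  assumes degree_subspace: "subspace (\<Omega> k)"
    and direct_sum: "\<exists>!f. decomposes \<Omega> x f"
begin

lemma decomposes_hcomp: "decomposes \<Omega> x (\<lambda>k. hcomp \<Omega> k x)"
  using theI'[OF direct_sum[of x]] by (simp add: hcomp_def)

lemma hcomp_in: "hcomp \<Omega> k x \<in> \<Omega> k" and finite_hcomp: "finite {k. hcomp \<Omega> k x \<noteq> 0}"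
  and sum_hcomp: "(\<Sum>k | hcomp \<Omega> k x \<noteq> 0. hcomp \<Omega> k x) = x"
  using decomposes_hcomp[of x] by (auto simp: decomposes_def)

text \<open>Uniqueness of the homogeneous decomposition, with any finite \<open>K\<close> containing
  the support so that candidates built from several elements can share one index set.\<close>

lemma hcomp_eqI:
  assumes "finite K" "\<And>k. f k \<in> \<Omega> k" "\<And>k. k \<notin> K \<Longrightarrow> f k = 0" "x = (\<Sum>k\<in>K. f k)"
  shows "hcomp \<Omega> k x = f k"
proof -
  have sub: "{k. f k \<noteq> 0} \<subseteq> K" using assms(3) by auto
  have "x = (\<Sum>k | f k \<noteq> 0. f k)"
    unfolding assms(4) by (intro sum.mono_neutral_right assms(1) sub) auto
  then have "decomposes \<Omega> x f"
    unfolding decomposes_def using assms(2) finite_subset[OF sub assms(1)] by blast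
  then show ?thesis using direct_sum[of x] decomposes_hcomp[of x] by metis
qed

lemma hcomp_homogeneous: "x \<in> \<Omega> k \<Longrightarrow> hcomp \<Omega> j x = (if j = k then x else 0)"
  by (rule hcomp_eqI[of "{k}"]) (auto simp: subspace_0[OF degree_subspace])

lemma sum_hcomp_superset:
  assumes "finite K" "{k. hcomp \<Omega> k x \<noteq> 0} \<subseteq> K"
  shows "(\<Sum>k\<in>K. hcomp \<Omega> k x) = x"
proof -
  have "(\<Sum>k\<in>K. hcomp \<Omega> k x) = (\<Sum>k | hcomp \<Omega> k x \<noteq> 0. hcomp \<Omega> k x)"
    by (intro sum.mono_neutral_right assms) auto
  then show ?thesis by (simp add: sum_hcomp)
qed

lemma linear_hcomp: "Vector_Spaces.linear s s (hcomp \<Omega> k)"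
proof -
  have "hcomp \<Omega> k (x + y) = hcomp \<Omega> k x + hcomp \<Omega> k y" for x y
    by (rule hcomp_eqI[of "{k. hcomp \<Omega> k x \<noteq> 0} \<union> {k. hcomp \<Omega> k y \<noteq> 0}"])
      (auto simp: finite_hcomp hcomp_in subspace_add[OF degree_subspace] sum.distrib sum_hcomp_superset)
  moreover have "hcomp \<Omega> k (s c x) = s c (hcomp \<Omega> k x)" for c x
    by (rule hcomp_eqI[of "{k. hcomp \<Omega> k x \<noteq> 0}"])
      (auto simp: finite_hcomp hcomp_in subspace_scale[OF degree_subspace] sum_hcomp simp flip: scale_sum_right)
  ultimately show ?thesis by (simp add: linear_iff vector_space_axioms)
qed

lemma span_homogeneous: "x \<in> span (\<Union>k. \<Omega> k)"
proof -
  have "(\<Sum>k | hcomp \<Omega> k x \<noteq> 0. hcomp \<Omega> k x) \<in> span (\<Union>k. \<Omega> k)"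
    by (intro span_sum span_base) (use hcomp_in in blast)
  then show ?thesis by (simp add: sum_hcomp)
qed

lemma linear_eq_homogeneous:
  assumes "Vector_Spaces.linear s u F" "Vector_Spaces.linear s u G"
    "\<And>k x. x \<in> \<Omega> k \<Longrightarrow> F x = G x"
  shows "F x = G x"
  using span_eqI[OF assms(1,2) _ span_homogeneous] assms(3) by blast

lemma grade_inv_superset:
  assumes "finite K" "{k. hcomp \<Omega> k x \<noteq> 0} \<subseteq> K"
  shows "grade_inv s \<Omega> x = (\<Sum>k\<in>K. s ((-1) ^ k) (hcomp \<Omega> k x))"
  unfolding grade_inv_def by (intro sum.mono_neutral_left assms) auto

lemma linear_grade_inv: "Vector_Spaces.linear s s (grade_inv s \<Omega>)"
proof -
  have "grade_inv s \<Omega> (x + y) = grade_inv s \<Omega> x + grade_inv s \<Omega> y" for x y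
  proof -
    let ?K = "{k. hcomp \<Omega> k x \<noteq> 0} \<union> {k. hcomp \<Omega> k y \<noteq> 0}"
    have "{k. hcomp \<Omega> k (x + y) \<noteq> 0} \<subseteq> ?K" by (auto simp: linear_add[OF linear_hcomp])
    then show ?thesis
      by (simp add: grade_inv_superset[of ?K] finite_hcomp linear_add[OF linear_hcomp]
          scale_right_distrib sum.distrib)
  qed
  moreover have "grade_inv s \<Omega> (s c x) = s c (grade_inv s \<Omega> x)" for c x
  proof -
    let ?K = "{k. hcomp \<Omega> k x \<noteq> 0}"
    have "{k. hcomp \<Omega> k (s c x) \<noteq> 0} \<subseteq> ?K" by (auto simp: linear_scale[OF linear_hcomp])
    then show ?thesis
      by (simp add: grade_inv_superset[of ?K] finite_hcomp linear_scale[OF linear_hcomp]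
          scale_sum_right mult.commute)
  qed
  ultimately show ?thesis by (simp add: linear_iff vector_space_axioms)
qed

lemma grade_inv_homogeneous: "x \<in> \<Omega> k \<Longrightarrow> grade_inv s \<Omega> x = s ((-1) ^ k) x"
  by (subst grade_inv_superset[of "{k}"]) (auto simp: hcomp_homogeneous)

end

locale graded_pair = A: graded_space s \<Omega> + B: graded_space t \<Omega>'
  for s :: "'k::field \<Rightarrow> 'a::ab_group_add \<Rightarrow> 'a" and \<Omega> :: "nat \<Rightarrow> 'a set"
    and t :: "'k \<Rightarrow> 'b::ab_group_add \<Rightarrow> 'b" and \<Omega>' :: "nat \<Rightarrow> 'b set"
begin

sublocale tensor_pair s t UNIV UNIV by standard (rule A.subspace_UNIV B.subspace_UNIV)+

context
  fixes u :: "'k \<Rightarrow> 'u::ab_group_add \<Rightarrow> 'u" and f :: "'a \<Rightarrow> 'b \<Rightarrow> 'u"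
  assumes u: "vector_space u" and f: "bilinear_on s t u UNIV UNIV f"
begin

interpretation u: vector_space u by (rule u)

lemma bilinear_UNIV:
  "f (x + x') y = f x y + f x' y" "f x (y + y') = f x y + f x y'"
  "f (s c x) y = u c (f x y)" "f x (t c y) = u c (f x y)" "f 0 y = 0" "f x 0 = 0"
proof -
  show *: "f (x + x') y = f x y + f x' y" "f x (y + y') = f x y + f x y'"
    "f (s c x) y = u c (f x y)" "f x (t c y) = u c (f x y)" for x x' y y' c
    using bilinear_onD[OF f] by auto
  show "f 0 y = 0" "f x 0 = 0" using *(1)[of 0 0 y] *(2)[of x 0 0] by auto
qed

text \<open>The index sets in \<open>koszul\<close> depend on the arguments. Enlarging them to
  common finite sets adds only zero terms and lets values at different arguments be compared summand
  by summand.\<close>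

lemma koszul_superset:
  assumes "finite J" "{j. hcomp \<Omega> j x \<noteq> 0} \<subseteq> J" "finite K" "{k. hcomp \<Omega>' k y \<noteq> 0} \<subseteq> K"
  shows "koszul \<Omega> \<Omega>' u f x y =
    (\<Sum>j\<in>J. \<Sum>k\<in>K. u ((-1) ^ (j * k)) (f (hcomp \<Omega> j x) (hcomp \<Omega>' k y)))"
proof -
  have "koszul \<Omega> \<Omega>' u f x y = (\<Sum>j | hcomp \<Omega> j x \<noteq> 0.
      \<Sum>k\<in>K. u ((-1) ^ (j * k)) (f (hcomp \<Omega> j x) (hcomp \<Omega>' k y)))"
    unfolding koszul_def by (intro sum.cong refl sum.mono_neutral_left assms) (auto simp: bilinear_UNIV)
  also have "\<dots> = (\<Sum>j\<in>J. \<Sum>k\<in>K. u ((-1) ^ (j * k)) (f (hcomp \<Omega> j x) (hcomp \<Omega>' k y)))"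
    by (intro sum.mono_neutral_left assms) (auto simp: bilinear_UNIV)
  finally show ?thesis .
qed

lemma koszul_homogeneous:
  "x \<in> \<Omega> j \<Longrightarrow> y \<in> \<Omega>' k \<Longrightarrow> koszul \<Omega> \<Omega>' u f x y = u ((-1) ^ (j * k)) (f x y)"
  by (subst koszul_superset[of "{j}" _ "{k}"]) (auto simp: A.hcomp_homogeneous B.hcomp_homogeneous)

lemma koszul_bilinear: "bilinear_on s t u UNIV UNIV (koszul \<Omega> \<Omega>' u f)"
proof (rule bilinear_onI)
  fix x x' y y' c
  let ?J = "\<lambda>x. {j. hcomp \<Omega> j x \<noteq> 0}" and ?K = "\<lambda>y. {j. hcomp \<Omega>' j y \<noteq> 0}"
  have sub: "?J (x + x') \<subseteq> ?J x \<union> ?J x'" "?K (y + y') \<subseteq> ?K y \<union> ?K y'"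
    "?J (s c x) \<subseteq> ?J x" "?K (t c y) \<subseteq> ?K y"
    by (auto simp: linear_add[OF A.linear_hcomp] linear_add[OF B.linear_hcomp]
        linear_scale[OF A.linear_hcomp] linear_scale[OF B.linear_hcomp])
  note fin = A.finite_hcomp B.finite_hcomp
  show "koszul \<Omega> \<Omega>' u f (x + x') y = koszul \<Omega> \<Omega>' u f x y + koszul \<Omega> \<Omega>' u f x' y"
    using sub by (simp add: koszul_superset[of "?J x \<union> ?J x'" _ "?K y"] fin
        linear_add[OF A.linear_hcomp] bilinear_UNIV u.scale_right_distrib sum.distrib)
  show "koszul \<Omega> \<Omega>' u f x (y + y') = koszul \<Omega> \<Omega>' u f x y + koszul \<Omega> \<Omega>' u f x y'"
    using sub by (simp add: koszul_superset[of "?J x" _ "?K y \<union> ?K y'"] fin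
        linear_add[OF B.linear_hcomp] bilinear_UNIV u.scale_right_distrib sum.distrib)
  show "koszul \<Omega> \<Omega>' u f (s c x) y = u c (koszul \<Omega> \<Omega>' u f x y)"
    using sub by (simp add: koszul_superset[of "?J x" _ "?K y"] fin
        linear_scale[OF A.linear_hcomp] bilinear_UNIV u.scale_sum_right mult.commute)
  show "koszul \<Omega> \<Omega>' u f x (t c y) = u c (koszul \<Omega> \<Omega>' u f x y)"
    using sub by (simp add: koszul_superset[of "?J x" _ "?K y"] fin
        linear_scale[OF B.linear_hcomp] bilinear_UNIV u.scale_sum_right mult.commute)
qed

end

lemma koszul_add_fun:
  assumes "vector_space u"
  shows "koszul \<Omega> \<Omega>' u (\<lambda>x y. f x y + g x y) x y = koszul \<Omega> \<Omega>' u f x y + koszul \<Omega> \<Omega>' u g x y"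
proof -
  interpret u: vector_space u by fact
  show ?thesis by (simp add: koszul_def u.scale_right_distrib sum.distrib)
qed

lemma koszul_scale_fun:
  assumes "vector_space u"
  shows "koszul \<Omega> \<Omega>' u (\<lambda>x y. u c (f x y)) x y = u c (koszul \<Omega> \<Omega>' u f x y)"
proof -
  interpret u: vector_space u by fact
  show ?thesis by (simp add: koszul_def u.scale_sum_right mult.commute)
qed

text \<open>Splitting first the right and then the left factor into components. Identities with
  signs can then be tested where the degrees are known.\<close>

lemma tspace_homogeneous:
  "tspace s t UNIV UNIV = fs.span {tensor s t x y |x y i j. x \<in> \<Omega> i \<and> y \<in> \<Omega>' j}" (is "_ = fs.span ?G")
proof
  have 1: "tensor s t x y \<in> fs.span ?G" if "x \<in> \<Omega> i" for x y i
    by (rule span_closed[OF linear_tensor_right fs.subspace_span _ B.span_homogeneous])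
      (use that in \<open>auto intro!: fs.span_base\<close>)
  have 2: "tensor s t x y \<in> fs.span ?G" for x y
    by (rule span_closed[OF linear_tensor_left fs.subspace_span _ A.span_homogeneous]) (use 1 in auto)
  show "tspace s t UNIV UNIV \<subseteq> fs.span ?G"
    unfolding tspace_def by (rule fs.span_minimal) (use 2 in blast, rule fs.subspace_span)
  show "fs.span ?G \<subseteq> tspace s t UNIV UNIV"
    unfolding tspace_def by (rule fs.span_mono) auto
qed

lemma tensor_degree_subset: "tensor_degree s \<Omega> t \<Omega>' n \<subseteq> tspace s t UNIV UNIV"
  unfolding tensor_degree_def tspace_def by (rule fs.span_mono) auto

lemma tensor_in_degree: "x \<in> \<Omega> i \<Longrightarrow> y \<in> \<Omega>' j \<Longrightarrow> tensor s t x y \<in> tensor_degree s \<Omega> t \<Omega>' (i + j)"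
  unfolding tensor_degree_def by (rule fs.span_base) (clarify, rule exI[of _ x], rule exI[of _ y], rule exI[of _ j], simp)

lemma tensor_degree_cases:
  assumes "z \<in> {tensor s t x y |x y i. i \<le> n \<and> x \<in> \<Omega> (n - i) \<and> y \<in> \<Omega>' i}"
  obtains x y i j where "z = tensor s t x y" "n = i + j" "x \<in> \<Omega> i" "y \<in> \<Omega>' j"
  using assms by (smt (verit, best) le_add_diff_inverse2 mem_Collect_eq)

end

section \<open>The tensor product of differential graded algebras\<close>

text \<open>Eta-contracted, these rules would rewrite sums of tensors to lambda abstractions.\<close>

declare plus_fun_apply [simp del] zero_fun_apply [simp del]

lemma (in dga) graded_space: "graded_space s \<Omega>"
  using k_algebra.vector_space[OF algebra] degree_subspace direct_sum
  by (simp add: graded_space_def graded_space_axioms_def)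

lemma (in differential_calculus) span_generators:
  "x \<in> module.span s {a * prod_list (map d as) |a as. a \<in> A \<and> set as \<subseteq> A}"
proof -
  interpret graded_space s \<Omega> by (rule graded_space)
  have "\<Omega> k \<subseteq> span {a * prod_list (map d as) |a as. a \<in> A \<and> set as \<subseteq> A}" for k
    unfolding degree_span[of k] by (rule span_mono) auto
  then have "span (\<Union>k. \<Omega> k) \<subseteq> span {a * prod_list (map d as) |a as. a \<in> A \<and> set as \<subseteq> A}"
    by (intro span_minimal subspace_span) auto
  then show ?thesis using span_homogeneous by blast
qed

locale dga_pair = A: dga s \<Omega> d + B: dga t \<Omega>' d'
  for s :: "'k::field \<Rightarrow> 'a::{ring,monoid_mult} \<Rightarrow> 'a" and \<Omega> d
    and t :: "'k \<Rightarrow> 'b::{ring,monoid_mult} \<Rightarrow> 'b" and \<Omega>' d'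
begin

sublocale graded_pair s \<Omega> t \<Omega>'
  by (simp add: graded_pair_def A.graded_space B.graded_space)

sublocale swap: graded_pair t \<Omega>' s \<Omega>
  by (simp add: graded_pair_def A.graded_space B.graded_space)

abbreviation "T \<equiv> tspace s t UNIV UNIV"
abbreviation "T_degree \<equiv> tensor_degree s \<Omega> t \<Omega>'"
abbreviation mult (infixl "\<star>" 70) where "X \<star> Y \<equiv> tensor_mult s \<Omega> t \<Omega>' X Y"
abbreviation "D \<equiv> tensor_diff s \<Omega> d t d'"

lemmas scale_mult = k_algebra.scale_mult_left[OF A.algebra] k_algebra.scale_mult_right[OF A.algebra]
  k_algebra.scale_mult_left[OF B.algebra] k_algebra.scale_mult_right[OF B.algebra]

lemmas tensor_linear = tensor_add_left tensor_scale_left tensor_add_right tensor_scale_right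

lemma mult_kernel_bilinear: "bilinear_on t s fscale UNIV UNIV (\<lambda>b a'. tensor s t (a * a') (b * b'))"
  by (rule bilinear_onI) (simp_all add: scale_mult tensor_linear distrib_left distrib_right)

text \<open>The product of two pure tensors, as a function of its four factors. Only the middle
  factors \<open>b\<close> and \<open>a'\<close> pass each other, so the sign is taken over that
  pair.\<close>

definition pure_mult where
  "pure_mult a b a' b' = koszul \<Omega>' \<Omega> fscale (\<lambda>b a'. tensor s t (a * a') (b * b')) b a'"

lemma pure_mult_linear:
  "pure_mult (a + a1) b a' b' = pure_mult a b a' b' + pure_mult a1 b a' b'"
  "pure_mult (s c a) b a' b' = fscale c (pure_mult a b a' b')"
  "pure_mult a (b + b1) a' b' = pure_mult a b a' b' + pure_mult a b1 a' b'"
  "pure_mult a (t c b) a' b' = fscale c (pure_mult a b a' b')"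
  "pure_mult a b (a' + a1) b' = pure_mult a b a' b' + pure_mult a b a1 b'"
  "pure_mult a b (s c a') b' = fscale c (pure_mult a b a' b')"
  "pure_mult a b a' (b' + b1) = pure_mult a b a' b' + pure_mult a b a' b1"
  "pure_mult a b a' (t c b') = fscale c (pure_mult a b a' b')"
  using bilinear_onD[OF swap.koszul_bilinear[OF vector_space_fscale mult_kernel_bilinear]]
  by (simp_all add: pure_mult_def distrib_left distrib_right scale_mult tensor_linear
      swap.koszul_add_fun[OF vector_space_fscale] swap.koszul_scale_fun[OF vector_space_fscale])

lemma pure_mult_linear_fun:
  "pure_mult (a + a1) b = (\<lambda>a' b'. pure_mult a b a' b' + pure_mult a1 b a' b')"
  "pure_mult (s c a) b = (\<lambda>a' b'. fscale c (pure_mult a b a' b'))"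
  "pure_mult a (b + b1) = (\<lambda>a' b'. pure_mult a b a' b' + pure_mult a b1 a' b')"
  "pure_mult a (t c b) = (\<lambda>a' b'. fscale c (pure_mult a b a' b'))"
  by (intro ext pure_mult_linear)+

lemma pure_mult_bilinear: "bilinear_on s t fscale UNIV UNIV (pure_mult a b)"
  by (rule bilinear_onI) (simp_all add: pure_mult_linear)

lemma tensor_mult_eq:
  "X \<star> Y = tlift s t fscale UNIV UNIV (\<lambda>a b. tlift s t fscale UNIV UNIV (pure_mult a b) Y) X"
  by (simp add: tensor_mult_def pure_mult_def[abs_def])

lemma mult_outer_bilinear:
  assumes "Y \<in> T"
  shows "bilinear_on s t fscale UNIV UNIV (\<lambda>a b. tlift s t fscale UNIV UNIV (pure_mult a b) Y)"
  unfolding tlift_eq_tsum[OF vector_space_fscale pure_mult_bilinear assms]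
  by (rule bilinear_onI) (simp_all add: pure_mult_linear_fun tsum_add_fun tsum_scale_fun[OF vector_space_fscale])

lemma mult_eq_tsum:
  assumes "X \<in> T" "Y \<in> T"
  shows "X \<star> Y = tsum s t UNIV UNIV (\<lambda>a b. tsum s t UNIV UNIV (pure_mult a b) Y) X"
  unfolding tensor_mult_eq tlift_eq_tsum[OF vector_space_fscale mult_outer_bilinear[OF assms(2)] assms(1)]
  by (simp add: tlift_eq_tsum[OF vector_space_fscale pure_mult_bilinear assms(2)])

lemma mult_tensor: "tensor s t a b \<star> tensor s t a' b' = pure_mult a b a' b'"
  unfolding tensor_mult_eq
    tlift_pure[OF vector_space_fscale mult_outer_bilinear[OF tensor_in[OF UNIV_I UNIV_I]] UNIV_I UNIV_I]
  by (rule tlift_pure[OF vector_space_fscale pure_mult_bilinear UNIV_I UNIV_I])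

lemma mult_homogeneous:
  "b \<in> \<Omega>' j \<Longrightarrow> a' \<in> \<Omega> k \<Longrightarrow>
    tensor s t a b \<star> tensor s t a' b' = fscale ((-1) ^ (j * k)) (tensor s t (a * a') (b * b'))"
  unfolding mult_tensor pure_mult_def
  by (rule swap.koszul_homogeneous[OF vector_space_fscale mult_kernel_bilinear])

lemma mult_bilinear: "bilinear_on fscale fscale fscale T T (\<star>)"
proof (rule bilinear_onI)
  fix X X' Y Y' :: "('k, 'a, 'b) tensor" and c assume T: "X \<in> T" "Y \<in> T"
  note lin = linear_tlift[OF vector_space_fscale mult_outer_bilinear[OF T(2)]]
  show "(X + X') \<star> Y = X \<star> Y + X' \<star> Y" "fscale c X \<star> Y = fscale c (X \<star> Y)"
    unfolding tensor_mult_eq using linear_add[OF lin] linear_scale[OF lin] by auto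
  show "X \<star> fscale c Y = fscale c (X \<star> Y)"
    by (simp add: T mult_eq_tsum tspace_scale tsum_scale[OF vector_space_fscale pure_mult_bilinear]
        tsum_scale_fun[OF vector_space_fscale])
  show "X \<star> (Y + Y') = X \<star> Y + X \<star> Y'" if "Y' \<in> T"
    by (simp add: T that mult_eq_tsum tspace_add tsum_add[OF vector_space_fscale pure_mult_bilinear]
        tsum_add_fun)
qed

lemmas mult_linear = bilinear_onD[OF mult_bilinear]

text \<open>Membership in \<open>T\<close> is kept in the inductive step because the product is
  bilinear on \<open>T\<close> and not on the whole function type.\<close>

lemma T_induct [consumes 1, case_names pure zero lin]:
  assumes "X \<in> T" and "\<And>x y i j. x \<in> \<Omega> i \<Longrightarrow> y \<in> \<Omega>' j \<Longrightarrow> P (tensor s t x y)" and "P 0"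
    and "\<And>c X Y. X \<in> T \<Longrightarrow> Y \<in> T \<Longrightarrow> P X \<Longrightarrow> P Y \<Longrightarrow> P (fscale c X + Y)"
  shows "P X"
proof -
  have "X \<in> T \<and> P X"
    using assms(1) unfolding tspace_homogeneous
  proof (induction rule: fs.span_induct_alt)
    case base
    then show ?case using assms(3) fs.span_zero by blast
  next
    case (step c x y)
    then obtain a b i j where x: "x = tensor s t a b" "a \<in> \<Omega> i" "b \<in> \<Omega>' j" by blast
    then have "x \<in> T" "P x" using assms(2) by (auto intro: tensor_in)
    moreover have "y \<in> T" "P y" using step unfolding tspace_homogeneous by blast+
    ultimately show ?case
      using assms(4) tspace_add[OF tspace_scale] unfolding tspace_homogeneous by blast
  qed
  then show ?thesis by blast
qed

lemma T_degree_induct [consumes 1, case_names pure zero lin]: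
  assumes "X \<in> T_degree n" and "\<And>x y i j. n = i + j \<Longrightarrow> x \<in> \<Omega> i \<Longrightarrow> y \<in> \<Omega>' j \<Longrightarrow> P (tensor s t x y)"
    and "P 0" and "\<And>c X Y. X \<in> T_degree n \<Longrightarrow> Y \<in> T_degree n \<Longrightarrow> P X \<Longrightarrow> P Y \<Longrightarrow> P (fscale c X + Y)"
  shows "P X"
proof -
  have "X \<in> T_degree n \<and> P X"
    using assms(1) unfolding tensor_degree_def
  proof (induction rule: fs.span_induct_alt)
    case base
    then show ?case using assms(3) fs.span_zero by blast
  next
    case (step c x y)
    from step(1) have "P x" by (rule tensor_degree_cases) (use assms(2) in blast)
    moreover have "x \<in> T_degree n" "y \<in> T_degree n" "P y"
      using step fs.span_base[OF step(1)] unfolding tensor_degree_def by blast+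
    ultimately show ?case
      using assms(4) fs.span_add[OF fs.span_scale] unfolding tensor_degree_def by blast
  qed
  then show ?thesis by blast
qed

lemma T_degree_subspace: "fs.subspace (T_degree n)"
  unfolding tensor_degree_def by (rule fs.subspace_span)

lemmas T_degree_in_T = subsetD[OF tensor_degree_subset]

lemma mult_T_degree:
  assumes "X \<in> T_degree m" "Y \<in> T_degree n"
  shows "X \<star> Y \<in> T_degree (m + n)"
  using assms
proof (induction rule: T_degree_induct)
  case (pure a b i j)
  from pure(4) show ?case
  proof (induction rule: T_degree_induct)
    case (pure a' b' k l)
    have "tensor s t (a * a') (b * b') \<in> T_degree ((i + k) + (j + l))"
      by (intro tensor_in_degree A.mult_degree B.mult_degree) fact+
    then show ?case
      using mult_homogeneous[of b j a' k] fs.subspace_scale[OF T_degree_subspace]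
        \<open>b \<in> \<Omega>' j\<close> \<open>a' \<in> \<Omega> k\<close> \<open>m = i + j\<close> \<open>n = k + l\<close>
      by (simp add: add.commute add.left_commute)
  next
    case zero
    show ?case using mult_linear(4)[of "tensor s t a b" 0 0] T_degree_subspace
      by (simp add: tensor_in tspace_zero fs.subspace_0)
  next
    case (lin c Y Y')
    then show ?case using T_degree_subspace
      by (simp add: mult_linear tensor_in tspace_scale T_degree_in_T fs.subspace_def)
  qed
next
  case zero
  then show ?case using mult_linear(2)[of 0 Y 0] T_degree_subspace
    by (simp add: T_degree_in_T tspace_zero fs.subspace_0)
next
  case (lin c X X')
  then show ?case using T_degree_subspace
    by (simp add: mult_linear tspace_scale T_degree_in_T fs.subspace_def)
qed

lemma mult_T: "X \<in> T \<Longrightarrow> Y \<in> T \<Longrightarrow> X \<star> Y \<in> T"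
  unfolding mult_eq_tsum pure_mult_def[abs_def] koszul_def
  by (intro tsum_in[OF subspace_tspace vector_space_fscale] fs.subspace_sum[OF subspace_tspace]
      tspace_scale tensor_in UNIV_I; assumption?)

lemma mult_zero: "X \<in> T \<Longrightarrow> X \<star> 0 = 0" "X \<in> T \<Longrightarrow> 0 \<star> X = 0"
  using mult_linear(4)[of X 0 0] mult_linear(2)[of 0 X 0] by (simp_all add: tspace_zero)

text \<open>On homogeneous pure tensors the two sign exponents are j k + (j + l) m and l m + j (k +
  m), which are equal.\<close>

lemma mult_assoc:
  assumes "X \<in> T" "Y \<in> T" "Z \<in> T"
  shows "X \<star> Y \<star> Z = X \<star> (Y \<star> Z)"
  using assms
proof (induction X rule: T_induct)
  case (pure a b i j)
  from pure(3,4) show ?case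
  proof (induction Y rule: T_induct)
    case (pure a' b' k l)
    from pure(3) show ?case
    proof (induction Z rule: T_induct)
      case (pure a'' b'' m n)
      have "b * b' \<in> \<Omega>' (j + l)" "a' * a'' \<in> \<Omega> (k + m)"
        by (intro A.mult_degree B.mult_degree; fact)+
      with pure show ?case
        using \<open>b \<in> \<Omega>' j\<close> \<open>a' \<in> \<Omega> k\<close> \<open>b' \<in> \<Omega>' l\<close>
        by (simp add: mult_homogeneous mult_linear tensor_in mult.assoc)
          (simp add: algebra_simps power_add)
    qed (simp_all add: mult_linear mult_zero mult_T tensor_in tspace_scale tspace_add)
  qed (simp_all add: mult_linear mult_zero mult_T tensor_in tspace_scale tspace_add)
qed (simp_all add: mult_linear mult_zero mult_T tensor_in tspace_scale tspace_add)

abbreviation "one_tensor \<equiv> tensor s t 1 1"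

lemma one_tensor_degree: "one_tensor \<in> T_degree 0"
  using tensor_in_degree[OF A.one_degree B.one_degree] by simp

lemma mult_one:
  assumes "X \<in> T"
  shows "one_tensor \<star> X = X" "X \<star> one_tensor = X"
  using assms
  by (induction X rule: T_induct)
    (simp_all add: mult_homogeneous[OF B.one_degree] mult_homogeneous[OF _ A.one_degree] mult_zero
      mult_linear tensor_in tspace_scale)

lemma diff_bilinear:
  "bilinear_on s t fscale UNIV UNIV (\<lambda>a b. tensor s t (d a) b + tensor s t (grade_inv s \<Omega> a) (d' b))"
  by (rule bilinear_onI)
    (simp_all add: linear_add[OF A.diff_linear] linear_scale[OF A.diff_linear] linear_add[OF B.diff_linear]
      linear_scale[OF B.diff_linear] linear_add[OF A.linear_grade_inv] linear_scale[OF A.linear_grade_inv]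
      tensor_linear fs.scale_right_distrib)

lemma linear_D: "Vector_Spaces.linear fscale fscale D"
  unfolding tensor_diff_def by (rule linear_tlift[OF vector_space_fscale diff_bilinear])

lemma D_tensor: "D (tensor s t a b) = tensor s t (d a) b + tensor s t (grade_inv s \<Omega> a) (d' b)"
  unfolding tensor_diff_def by (rule tlift_pure[OF vector_space_fscale diff_bilinear UNIV_I UNIV_I])

lemma D_homogeneous:
  "a \<in> \<Omega> i \<Longrightarrow> D (tensor s t a b) = tensor s t (d a) b + fscale ((-1) ^ i) (tensor s t a (d' b))"
  by (simp add: D_tensor A.grade_inv_homogeneous tensor_linear)

lemmas D_linear = linear_add[OF linear_D] linear_scale[OF linear_D] linear_zero[OF linear_D]

lemma D_T: "X \<in> T \<Longrightarrow> D X \<in> T"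
  by (induction X rule: T_induct)
    (simp_all add: D_tensor D_linear tspace_add tspace_scale tspace_zero tensor_in)

lemma D_degree:
  assumes "X \<in> T_degree n" shows "D X \<in> T_degree (Suc n)"
  using assms
proof (induction rule: T_degree_induct)
  case (pure a b i j)
  have "tensor s t (d a) b \<in> T_degree (Suc i + j)" "tensor s t a (d' b) \<in> T_degree (i + Suc j)"
    by (intro tensor_in_degree A.diff_degree B.diff_degree pure)+
  then show ?case using T_degree_subspace
    by (simp add: D_homogeneous[OF pure(2)] \<open>n = i + j\<close> fs.subspace_def)
qed (use T_degree_subspace in \<open>simp_all add: D_linear fs.subspace_def\<close>)

lemma D_D:
  assumes "X \<in> T" shows "D (D X) = 0"
  using assms
proof (induction X rule: T_induct)
  case (pure a b i j)
  then show ?case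
    by (simp add: D_homogeneous D_linear A.diff_degree D_homogeneous[OF A.diff_degree] A.diff_diff B.diff_diff
        swap.tensor_zero_left)
qed (simp_all add: D_linear)

lemma D_mult:
  assumes "X \<in> T_degree n" "Y \<in> T"
  shows "D (X \<star> Y) = D X \<star> Y + fscale ((-1) ^ n) (X \<star> D Y)"
  using assms
proof (induction rule: T_degree_induct)
  case (pure a b i j)
  from pure(4) show ?case
  proof (induction Y rule: T_induct)
    case (pure a' b' k l)
    have "d a' \<in> \<Omega> (Suc k)" "d' b \<in> \<Omega>' (Suc j)" "a * a' \<in> \<Omega> (i + k)"
      by (intro A.diff_degree B.diff_degree A.mult_degree; fact)+
    with pure \<open>a \<in> \<Omega> i\<close> \<open>b \<in> \<Omega>' j\<close> \<open>n = i + j\<close> show ?case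
      \<comment> \<open>The degree of \<open>b'\<close> contributes no sign, so the parities of the
        other three degrees decide all of them.\<close>
      by (cases "even i"; cases "even j"; cases "even k")
        (simp_all add: mult_homogeneous D_homogeneous D_linear mult_linear tensor_in tspace_scale
          A.diff_mult[OF \<open>a \<in> \<Omega> i\<close>] B.diff_mult[OF \<open>b \<in> \<Omega>' j\<close>] tensor_linear
          fs.scale_right_distrib minus_one_power_iff ac_simps
          del: fs.scale_minus_left A.scale_minus_left B.scale_minus_left)
  qed (simp_all add: mult_linear mult_zero D_linear tensor_in tspace_scale D_T algebra_simps)
qed (simp_all add: mult_linear mult_zero D_linear T_degree_in_T tspace_scale D_T algebra_simps)

end

section \<open>The universal property of the maximal prolongation\<close>

text \<open>The target of the universal property has to include the tensor product of two calculi,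
  which in general is a proper subset of a function type with its own product. Hence an explicit
  carrier, multiplication and unit instead of the type-class structure used in
  \<open>dga\<close>.\<close>

locale carrier_dga = vector_space u
  for u :: "'k::field \<Rightarrow> 'c::ab_group_add \<Rightarrow> 'c" +
  fixes C :: "'c set" and \<Theta> :: "nat \<Rightarrow> 'c set" and m :: "'c \<Rightarrow> 'c \<Rightarrow> 'c" (infixl "\<star>" 70)
    and e :: 'c and \<delta> :: "'c \<Rightarrow> 'c"
  assumes subspace_C: "subspace C"
    and degree_subspace: "subspace (\<Theta> n)"
    and degree_in_C: "X \<in> \<Theta> n \<Longrightarrow> X \<in> C"
    and mult_bilinear: "bilinear_on u u u C C (\<star>)"
    and mult_C: "X \<in> C \<Longrightarrow> Y \<in> C \<Longrightarrow> X \<star> Y \<in> C"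
    and mult_degree: "X \<in> \<Theta> k \<Longrightarrow> Y \<in> \<Theta> l \<Longrightarrow> X \<star> Y \<in> \<Theta> (k + l)"
    and mult_assoc: "X \<in> C \<Longrightarrow> Y \<in> C \<Longrightarrow> Z \<in> C \<Longrightarrow> X \<star> Y \<star> Z = X \<star> (Y \<star> Z)"
    and one_degree: "e \<in> \<Theta> 0"
    and mult_one_left: "X \<in> C \<Longrightarrow> e \<star> X = X"
    and mult_one_right: "X \<in> C \<Longrightarrow> X \<star> e = X"
    and diff_linear: "Vector_Spaces.linear u u \<delta>"
    and diff_degree: "X \<in> \<Theta> k \<Longrightarrow> \<delta> X \<in> \<Theta> (Suc k)"
    and diff_diff: "X \<in> C \<Longrightarrow> \<delta> (\<delta> X) = 0"
    and diff_mult: "X \<in> \<Theta> k \<Longrightarrow> Y \<in> C \<Longrightarrow> \<delta> (X \<star> Y) = \<delta> X \<star> Y + u ((-1) ^ k) (X \<star> \<delta> Y)"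
begin

lemmas mult_linear = bilinear_onD[OF mult_bilinear]

lemma zero_C: "0 \<in> C" and add_C: "X \<in> C \<Longrightarrow> Y \<in> C \<Longrightarrow> X + Y \<in> C" and scale_C: "X \<in> C \<Longrightarrow> u c X \<in> C"
  using subspace_C by (auto simp: subspace_def)

lemma mult_zero: "X \<in> C \<Longrightarrow> X \<star> 0 = 0" "X \<in> C \<Longrightarrow> 0 \<star> X = 0"
  using mult_linear(4)[of X 0 0] mult_linear(2)[of 0 X 0] by (simp_all add: zero_C)

definition word_product where "word_product f w = foldr (\<lambda>x. (\<star>) (f x)) w e"

lemma word_product_simps [simp]:
  "word_product f [] = e" "word_product f (x # w) = f x \<star> word_product f w"
  by (simp_all add: word_product_def)

lemma word_product_degree:
  assumes "\<And>x. x \<in> set w \<Longrightarrow> f x \<in> \<Theta> (Suc 0)"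
  shows "word_product f w \<in> \<Theta> (length w)"
  using assms
proof (induction w)
  case (Cons x w)
  then have "f x \<star> word_product f w \<in> \<Theta> (Suc 0 + length w)" by (intro mult_degree) auto
  then show ?case by simp
qed (simp add: one_degree)

lemma word_product_append:
  assumes "\<And>x. x \<in> set v \<union> set w \<Longrightarrow> f x \<in> \<Theta> (Suc 0)"
  shows "word_product f (v @ w) = word_product f v \<star> word_product f w"
  using assms
proof (induction v)
  case Nil
  then show ?case using word_product_degree[of w f] by (simp add: mult_one_left degree_in_C)
next
  case (Cons x v)
  then have "word_product f v \<in> C" "word_product f w \<in> C" "f x \<in> C"
    using degree_in_C[OF word_product_degree[of v f]] degree_in_C[OF word_product_degree[of w f]]
      degree_in_C[of "f x" "Suc 0"] by auto
  with Cons show ?case by (simp add: mult_assoc)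
qed

end

text \<open>Reading off coefficients shows that distinct words are linearly independent.\<close>

lemma word_coefficient:
  "finite I \<Longrightarrow> (\<Sum>w\<in>I. fscale (c w) (word w)) v = (if v \<in> I then c v else 0)"
  by (simp add: sum_fun_apply fscale_def word_def if_distrib sum.delta' cong: if_cong)

lemma eval_word_sum:
  assumes "vector_space s" "finite I"
  shows "eval_word s (\<Sum>w\<in>I. fscale (c w) (word w)) = (\<Sum>w\<in>I. s (c w) (prod_list w))"
proof -
  interpret vector_space s by fact
  show ?thesis unfolding eval_word_def word_coefficient[OF assms(2)]
    by (rule sum.mono_neutral_cong_left) (use assms(2) in auto)
qed

text \<open>The data to be extended: an algebra map \<open>\<phi>\<close> into degree zero and a map
  \<open>D1\<close> on \<Gamma>. Linearity of \<open>D1\<close> together with \<open>D1_diff\<close>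
  is a well-definedness condition, since each relation among the h dg must also hold among their
  images. For the comultiplication this is what bicovariance supplies.\<close>

locale prolongation_extension = maximal_prolongation s H \<Gamma> \<Omega> d + C: carrier_dga u C \<Theta> m e \<delta>
  for s :: "'k::field \<Rightarrow> 'a::{ring,monoid_mult} \<Rightarrow> 'a" and H \<Gamma> \<Omega> d
    and u :: "'k \<Rightarrow> 'c::ab_group_add \<Rightarrow> 'c" and C \<Theta> and m (infixl "\<star>" 70) and e \<delta> +
  fixes \<phi> D1 :: "'a \<Rightarrow> 'c"
  assumes phi_linear: "linear_on s u H \<phi>"
    and phi_degree: "h \<in> H \<Longrightarrow> \<phi> h \<in> \<Theta> 0"
    and phi_one: "\<phi> 1 = e"
    and phi_mult: "h \<in> H \<Longrightarrow> g \<in> H \<Longrightarrow> \<phi> (h * g) = \<phi> h \<star> \<phi> g"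
    and D1_linear: "linear_on s u \<Gamma> D1"
    and D1_diff: "h \<in> H \<Longrightarrow> g \<in> H \<Longrightarrow> D1 (h * d g) = \<phi> h \<star> \<delta> (\<phi> g)"
begin

sublocale graded_space s \<Omega> by (rule graded_space)

lemmas scale_mult = k_algebra.scale_mult_left[OF algebra] k_algebra.scale_mult_right[OF algebra]

lemma H_subspace: "subspace H" and one_H: "1 \<in> H" and mult_H: "h \<in> H \<Longrightarrow> g \<in> H \<Longrightarrow> h * g \<in> H"
  using degree_subspace[of 0] one_degree mult_degree[of _ 0 _ 0] by (simp_all add: degree_zero)

lemma Gamma_subspace: "subspace \<Gamma>"
  using degree_subspace[of 1] by (simp only: degree_one)

lemma zero_Gamma: "0 \<in> \<Gamma>" and add_Gamma: "x \<in> \<Gamma> \<Longrightarrow> y \<in> \<Gamma> \<Longrightarrow> x + y \<in> \<Gamma>"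
  and scale_Gamma: "x \<in> \<Gamma> \<Longrightarrow> s c x \<in> \<Gamma>"
  using Gamma_subspace by (auto simp: subspace_def)

lemma mult_Gamma: "h \<in> H \<Longrightarrow> x \<in> \<Gamma> \<Longrightarrow> h * x \<in> \<Gamma>" "x \<in> \<Gamma> \<Longrightarrow> h \<in> H \<Longrightarrow> x * h \<in> \<Gamma>"
  using mult_degree[of h 0 x 1] mult_degree[of x 1 h 0] by (auto simp: degree_zero degree_one[symmetric])

lemma d_Gamma: "h \<in> H \<Longrightarrow> d h \<in> \<Gamma>"
  using diff_degree[of h 0] by (simp add: degree_zero degree_one[symmetric])

lemma Gamma_induct [consumes 1, case_names diff zero lin]:
  assumes "x \<in> \<Gamma>" "\<And>h g. h \<in> H \<Longrightarrow> g \<in> H \<Longrightarrow> P (h * d g)" "P 0"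
    "\<And>c x y. x \<in> \<Gamma> \<Longrightarrow> y \<in> \<Gamma> \<Longrightarrow> P x \<Longrightarrow> P y \<Longrightarrow> P (s c x + y)"
  shows "P x"
proof -
  have "x \<in> span {a * prod_list (map d as) |a as. a \<in> H \<and> set as \<subseteq> H \<and> length as = 1}"
    using assms(1) degree_span[of 1] by (simp only: degree_one)
  then have "x \<in> \<Gamma> \<and> P x"
  proof (induction rule: span_induct_alt)
    case (step c x y)
    then obtain h g where "x = h * d g" "h \<in> H" "g \<in> H" by (auto simp: length_Suc_conv)
    then have "x \<in> \<Gamma>" "P x" using assms(2) mult_Gamma(1) d_Gamma by simp_all
    then show ?case using step(2) assms(4)[of x y c] add_Gamma scale_Gamma by simp
  qed (use assms(3) zero_Gamma in blast)
  then show ?thesis by blast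
qed

lemma phi_C: "h \<in> H \<Longrightarrow> \<phi> h \<in> C" and diff_phi: "h \<in> H \<Longrightarrow> \<delta> (\<phi> h) \<in> \<Theta> (Suc 0)"
  and diff_phi_C: "h \<in> H \<Longrightarrow> \<delta> (\<phi> h) \<in> C"
  using C.diff_degree[of "\<phi> h" 0] C.degree_in_C[of "\<phi> h" 0] C.degree_in_C[of "\<delta> (\<phi> h)" "Suc 0"]
  by (simp_all add: phi_degree)

lemma D1_add: "x \<in> \<Gamma> \<Longrightarrow> y \<in> \<Gamma> \<Longrightarrow> D1 (x + y) = D1 x + D1 y"
  and D1_scale: "x \<in> \<Gamma> \<Longrightarrow> D1 (s c x) = u c (D1 x)"
  using D1_linear by (auto simp: linear_on_def)

lemma D1_zero: "D1 0 = 0" using D1_add[OF zero_Gamma zero_Gamma] by simp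

lemma D1_minus: "x \<in> \<Gamma> \<Longrightarrow> y \<in> \<Gamma> \<Longrightarrow> D1 (x - y) = D1 x - D1 y"
  using D1_add[of "x - y" y] Gamma_subspace subspace_diff by simp

lemma D1_degree: "x \<in> \<Gamma> \<Longrightarrow> D1 x \<in> \<Theta> (Suc 0)"
proof (induction x rule: Gamma_induct)
  case (diff h g)
  then show ?case using C.mult_degree[OF phi_degree diff_phi] by (simp add: D1_diff)
qed (use C.degree_subspace in \<open>auto simp: D1_zero D1_add D1_scale scale_Gamma C.subspace_def\<close>)

lemma D1_C: "x \<in> \<Gamma> \<Longrightarrow> D1 x \<in> C"
  using D1_degree C.degree_in_C by blast

lemma diff_phi_mult:
  "h \<in> H \<Longrightarrow> g \<in> H \<Longrightarrow> \<delta> (\<phi> (h * g)) = \<delta> (\<phi> h) \<star> \<phi> g + \<phi> h \<star> \<delta> (\<phi> g)"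
  by (simp add: phi_mult C.diff_mult[OF phi_degree phi_C])

lemma D1_left: "x \<in> \<Gamma> \<Longrightarrow> h \<in> H \<Longrightarrow> D1 (h * x) = \<phi> h \<star> D1 x"
  by (induction x rule: Gamma_induct)
    (simp_all add: D1_diff phi_mult C.mult_assoc phi_C diff_phi_C mult_H D1_zero C.mult_zero D1_add D1_scale
      scale_mult C.mult_linear C.scale_C D1_C scale_Gamma mult_Gamma distrib_left flip: mult.assoc)

text \<open>The Leibniz rule rewrites (g dk) h as g d(kh) - (gk) dh, so right multiplication is
  reduced to elements on which \<open>D1\<close> is prescribed.\<close>

lemma D1_right: "x \<in> \<Gamma> \<Longrightarrow> h \<in> H \<Longrightarrow> D1 (x * h) = D1 x \<star> \<phi> h"
proof (induction x rule: Gamma_induct)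
  case (diff g k)
  have "d (k * h) = d k * h + k * d h"
    using diff_mult[of k 0 h] diff by (simp add: degree_zero)
  then have "g * d k * h = g * d (k * h) - (g * k) * d h" by (simp add: algebra_simps)
  then have "D1 (g * d k * h) = D1 (g * d (k * h)) - D1 ((g * k) * d h)"
    using diff by (simp only: D1_minus mult_Gamma mult_H d_Gamma)
  also have "\<dots> = \<phi> g \<star> (\<delta> (\<phi> k) \<star> \<phi> h)"
    using diff by (simp add: D1_diff mult_H diff_phi_mult C.mult_linear(3) C.mult_C phi_C diff_phi_C
        C.mult_assoc phi_mult[of g k])
  finally show ?case using diff by (simp add: D1_diff C.mult_assoc phi_C diff_phi_C)
qed (simp_all add: D1_zero C.mult_zero D1_add D1_scale scale_mult C.mult_linear C.scale_C D1_C phi_C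
      scale_Gamma mult_Gamma distrib_right)

abbreviation "W \<equiv> C.word_product D1"

lemma W_degree: "w \<in> lists \<Gamma> \<Longrightarrow> W w \<in> \<Theta> (length w)"
  by (rule C.word_product_degree) (auto simp: D1_degree)

lemma W_C: "w \<in> lists \<Gamma> \<Longrightarrow> W w \<in> C"
  using W_degree C.degree_in_C by blast

lemma W_append: "v \<in> lists \<Gamma> \<Longrightarrow> w \<in> lists \<Gamma> \<Longrightarrow> W (v @ w) = W v \<star> W w"
  by (rule C.word_product_append) (auto simp: D1_degree)

text \<open>Words are linearly independent, so any prescription on them extends linearly.\<close>

lemma formal_extension:
  "\<exists>F. Vector_Spaces.linear fscale u F \<and> (\<forall>w\<in>lists \<Gamma>. F (word w :: 'a list \<Rightarrow> 'k) = W w)"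
proof -
  have "\<exists>F. Vector_Spaces.linear fscale u F \<and>
      (\<forall>w. F (word w :: 'a list \<Rightarrow> 'k) = (if w \<in> lists \<Gamma> then W w else 0))"
  proof (rule linear_extension_of_family[OF vector_space_fscale C.vector_space_axioms])
    fix I :: "'a list set" and c assume I: "finite I" and *: "(\<Sum>w\<in>I. fscale (c w) (word w)) = (0 :: _ \<Rightarrow> 'k)"
    have "c w = 0" if "w \<in> I" for w
      using word_coefficient[OF I, of c w] that * by (simp add: zero_fun_def)
    then show "(\<Sum>w\<in>I. u (c w) (if w \<in> lists \<Gamma> then W w else 0)) = 0" by simp
  qed
  then show ?thesis by auto
qed

text \<open>The three kinds of relators are killed by additivity, homogeneity and left and right
  H-linearity of \<open>D1\<close>, respectively.\<close>

lemma vanish_tensor_relators: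
  assumes F: "Vector_Spaces.linear fscale u F" "\<And>w. w \<in> lists \<Gamma> \<Longrightarrow> F (word w :: 'a list \<Rightarrow> 'k) = W w"
    and "P \<in> tensor_relators s H \<Gamma>"
  shows "F P = 0"
proof -
  from assms(3) consider
      (add) p q x y where "P = word (p @ [x + y] @ q) - word (p @ [x] @ q) - word (p @ [y] @ q)"
        "p \<in> lists \<Gamma>" "q \<in> lists \<Gamma>" "x \<in> \<Gamma>" "y \<in> \<Gamma>"
    | (scale) p q c x where "P = word (p @ [s c x] @ q) - fscale c (word (p @ [x] @ q))"
        "p \<in> lists \<Gamma>" "q \<in> lists \<Gamma>" "x \<in> \<Gamma>"
    | (balanced) p q x h y where "P = word (p @ [x * h, y] @ q) - word (p @ [x, h * y] @ q)"
        "p \<in> lists \<Gamma>" "q \<in> lists \<Gamma>" "x \<in> \<Gamma>" "h \<in> H" "y \<in> \<Gamma>"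
    unfolding tensor_relators_def by blast
  then show ?thesis
    by cases (simp_all add: linear_diff[OF F(1)] linear_scale[OF F(1)] F(2) W_append W_C add_Gamma scale_Gamma
      mult_Gamma D1_add D1_scale D1_left D1_right C.mult_linear C.mult_C C.add_C C.scale_C D1_C phi_C C.mult_assoc)
qed

lemma sum_list_mult:
  assumes "A \<in> C" "B \<in> C" "\<And>x. x \<in> set xs \<Longrightarrow> f x \<in> C"
  shows "(\<Sum>x\<leftarrow>xs. f x) \<in> C" "(\<Sum>x\<leftarrow>xs. A \<star> (f x \<star> B)) = A \<star> ((\<Sum>x\<leftarrow>xs. f x) \<star> B)"
proof -
  have "(\<Sum>x\<leftarrow>xs. f x) \<in> C \<and> (\<Sum>x\<leftarrow>xs. A \<star> (f x \<star> B)) = A \<star> ((\<Sum>x\<leftarrow>xs. f x) \<star> B)"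
    using assms(3)
    by (induction xs) (simp_all add: C.zero_C C.add_C C.mult_linear C.mult_C C.mult_zero assms(1,2))
  then show "(\<Sum>x\<leftarrow>xs. f x) \<in> C" "(\<Sum>x\<leftarrow>xs. A \<star> (f x \<star> B)) = A \<star> ((\<Sum>x\<leftarrow>xs. f x) \<star> B)" by auto
qed

text \<open>Applying \<open>\<delta>\<close> after \<open>D1\<close> to the vanishing sum of h dg
  turns each summand into a product of two differentials; that sum of products is the factor common
  to the image of the relator.\<close>

lemma vanish_prolongation_relators:
  assumes F: "Vector_Spaces.linear fscale u F" "\<And>w. w \<in> lists \<Gamma> \<Longrightarrow> F (word w :: 'a list \<Rightarrow> 'k) = W w"
    and "P \<in> prolongation_relators H \<Gamma> d"
  shows "F P = 0"
proof -
  from assms(3) obtain p q a b hgs where P: "P = (\<Sum>(h, g)\<leftarrow>hgs. word (p @ [a * d h, d g * b] @ q))"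
    and pq: "p \<in> lists \<Gamma>" "q \<in> lists \<Gamma>" "a \<in> H" "b \<in> H" and hgs: "set hgs \<subseteq> H \<times> H"
    and zero: "(\<Sum>(h, g)\<leftarrow>hgs. h * d g) = 0"
    unfolding prolongation_relators_def by blast
  have D1_d: "D1 (d g) = \<delta> (\<phi> g)" if "g \<in> H" for g
    using D1_diff[OF one_H that] that by (simp add: phi_one C.mult_one_left diff_phi_C)
  let ?S = "\<Sum>(h, g)\<leftarrow>hgs. \<delta> (\<phi> h) \<star> \<delta> (\<phi> g)"
  have "?S = \<delta> (D1 (\<Sum>(h, g)\<leftarrow>hgs. h * d g)) \<and> (\<Sum>(h, g)\<leftarrow>hgs. h * d g) \<in> \<Gamma>" using hgs
  proof (induction hgs)
    case (Cons x hgs)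
    obtain h g where x: "x = (h, g)" "h \<in> H" "g \<in> H" using Cons(2) by auto
    \<comment> \<open>The second Leibniz term vanishes because \<open>\<delta>\<close> squares to
      zero.\<close>
    have "\<delta> (\<phi> h \<star> \<delta> (\<phi> g)) = \<delta> (\<phi> h) \<star> \<delta> (\<phi> g)"
      using C.diff_mult[OF phi_degree diff_phi_C] x
      by (simp add: C.diff_diff phi_C diff_phi_C C.mult_zero)
    then show ?case using Cons x
      by (simp add: D1_add D1_diff mult_Gamma d_Gamma add_Gamma linear_add[OF C.diff_linear])
  qed (simp add: D1_zero linear_zero[OF C.diff_linear] zero_Gamma)
  then have S: "?S = 0" using zero by (simp add: D1_zero linear_zero[OF C.diff_linear])
  have "F (word (p @ [a * d h, d g * b] @ q)) =
      W p \<star> \<phi> a \<star> ((\<delta> (\<phi> h) \<star> \<delta> (\<phi> g)) \<star> (\<phi> b \<star> W q))" if "h \<in> H" "g \<in> H" for h g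
    using pq that
    by (simp add: F(2) mult_Gamma d_Gamma W_append D1_left D1_right D1_d C.mult_assoc C.mult_C W_C phi_C
        diff_phi_C)
  moreover have "F P = (\<Sum>(h, g)\<leftarrow>hgs. F (word (p @ [a * d h, d g * b] @ q)))"
    unfolding P by (induction hgs) (auto simp: linear_add[OF F(1)] linear_zero[OF F(1)])
  ultimately have "F P = (\<Sum>x\<leftarrow>hgs. W p \<star> \<phi> a \<star> ((case x of (h, g) \<Rightarrow> \<delta> (\<phi> h) \<star> \<delta> (\<phi> g)) \<star> (\<phi> b \<star> W q)))"
    using hgs by (auto intro!: arg_cong[of _ _ sum_list] map_cong)
  also have "\<dots> = W p \<star> \<phi> a \<star> (?S \<star> (\<phi> b \<star> W q))"
    by (rule sum_list_mult(2)) (use hgs pq in \<open>auto intro!: C.mult_C W_C phi_C diff_phi_C\<close>)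
  finally show ?thesis using pq by (simp add: S C.mult_zero C.mult_C W_C phi_C)
qed

lemma vanish_kernel:
  assumes F: "Vector_Spaces.linear fscale u F" "\<And>w. w \<in> lists \<Gamma> \<Longrightarrow> F (word w :: 'a list \<Rightarrow> 'k) = W w"
    and P: "P \<in> formal_words \<Gamma>" "eval_word s P = 0"
  shows "F P = 0"
proof -
  have span: "P \<in> fs.span (tensor_relators s H \<Gamma> \<union> prolongation_relators H \<Gamma> d)"
    using kernel P by blast
  have "C.subspace {0}" by (simp add: C.subspace_def)
  from span_closed[OF F(1) this _ span] have "F P \<in> {0}"
    using vanish_tensor_relators[OF F] vanish_prolongation_relators[OF F] by blast
  then show ?thesis by simp
qed

lemma prod_list_degree: "w \<in> lists \<Gamma> \<Longrightarrow> prod_list w \<in> \<Omega> (length w)"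
proof (induction w)
  case (Cons x w)
  then show ?case using mult_degree[of x 1 "prod_list w" "length w"] degree_one by auto
qed (simp add: one_degree)

text \<open>Elements of H and products of nonempty words span \<Omega>, but with many relations. A
  relation splits by degree into one inside H, respected by linearity of \<open>\<phi>\<close>, and
  one among words, respected because the formal combination lies in the kernel of
  evaluation.\<close>

lemma extension_on_words:
  "\<exists>D. Vector_Spaces.linear s u D \<and> (\<forall>h\<in>H. D h = \<phi> h) \<and> (\<forall>w\<in>lists \<Gamma>. D (prod_list w) = W w)"
proof -
  obtain F where F: "Vector_Spaces.linear fscale u F" "\<And>w. w \<in> lists \<Gamma> \<Longrightarrow> F (word w :: 'a list \<Rightarrow> 'k) = W w"
    using formal_extension by blast
  \<comment> \<open>The empty word evaluates to 1, which has degree zero and is already covered by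
    H; leaving it out makes the degree argument work.\<close>
  define L where "L = lists \<Gamma> - {[]}"
  define g where "g i = (case i of Inl h \<Rightarrow> if h \<in> H then h else 0 | Inr w \<Rightarrow> if w \<in> L then prod_list w else 0)"
    for i
  define y where "y i = (case i of Inl h \<Rightarrow> if h \<in> H then \<phi> h else 0 | Inr w \<Rightarrow> if w \<in> L then W w else 0)"
    for i
  have "\<exists>D. Vector_Spaces.linear s u D \<and> (\<forall>i. D (g i) = y i)"
  proof (rule linear_extension_of_family[OF vector_space_axioms C.vector_space_axioms])
    fix I :: "('a + 'a list) set" and c assume I: "finite I" and *: "(\<Sum>i\<in>I. s (c i) (g i)) = 0"
    define A where "A = {h\<in>H. Inl h \<in> I}"
    define B where "B = {w\<in>L. Inr w \<in> I}"
    have fin: "finite A" "finite B"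
      using finite_vimageI[OF I, of Inl] finite_vimageI[OF I, of Inr] unfolding A_def B_def
      by (auto elim!: finite_subset[rotated])
    have split: "(\<Sum>i\<in>I. z (c i) (case i of Inl h \<Rightarrow> if h \<in> H then f h else 0 | Inr w \<Rightarrow> if w \<in> L then f' w else 0)) =
        (\<Sum>h\<in>A. z (c (Inl h)) (f h)) + (\<Sum>w\<in>B. z (c (Inr w)) (f' w))"
      if "\<And>c. z c 0 = 0" for z :: "'k \<Rightarrow> 'z \<Rightarrow> 'z::ab_group_add" and f f'
    proof -
      have "(\<Sum>i\<in>I. z (c i) (case i of Inl h \<Rightarrow> if h \<in> H then f h else 0 | Inr w \<Rightarrow> if w \<in> L then f' w else 0)) =
        (\<Sum>i\<in>A <+> B. z (c i) (case i of Inl h \<Rightarrow> if h \<in> H then f h else 0 | Inr w \<Rightarrow> if w \<in> L then f' w else 0))"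
        by (rule sum.mono_neutral_right) (use I in \<open>auto simp: A_def B_def that split: sum.splits\<close>)
      also have "\<dots> = (\<Sum>h\<in>A. z (c (Inl h)) (f h)) + (\<Sum>w\<in>B. z (c (Inr w)) (f' w))"
        by (subst sum.Plus[OF fin]) (auto simp: A_def B_def)
      finally show ?thesis .
    qed
    let ?P = "\<Sum>w\<in>B. fscale (c (Inr w)) (word w :: 'a list \<Rightarrow> 'k)"
    define x1 x2 where "x1 = (\<Sum>h\<in>A. s (c (Inl h)) h)" and "x2 = (\<Sum>w\<in>B. s (c (Inr w)) (prod_list w))"
    have sum0: "x1 + x2 = 0" using * split[of s] by (simp add: g_def x1_def x2_def)
    have x1: "x1 \<in> \<Omega> 0"
      unfolding x1_def by (intro subspace_sum subspace_scale degree_subspace) (auto simp: A_def degree_zero)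
    \<comment> \<open>Nonempty words have positive degree, so the degree-zero part of the relation
      is exactly \<open>x1\<close>, and both parts vanish separately.\<close>
    have "hcomp \<Omega> 0 (s c (prod_list w)) = 0" if "w \<in> B" for w c
    proof -
      have "s c (prod_list w) \<in> \<Omega> (length w)" "length w \<noteq> 0"
        using that prod_list_degree subspace_scale[OF degree_subspace] by (auto simp: B_def L_def)
      then show ?thesis by (simp add: hcomp_homogeneous)
    qed
    then have "hcomp \<Omega> 0 x2 = 0" by (simp add: x2_def linear_sum[OF linear_hcomp])
    then have "x1 = hcomp \<Omega> 0 (x1 + x2)"
      by (simp add: linear_add[OF linear_hcomp] hcomp_homogeneous[OF x1])
    then have x: "x1 = 0" "x2 = 0" using sum0 by (simp_all add: linear_zero[OF linear_hcomp])
    have "?P \<in> formal_words \<Gamma>"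
      unfolding formal_words_def
      by (intro fs.span_sum fs.span_scale fs.span_base) (auto simp: B_def L_def)
    moreover have "eval_word s ?P = 0"
      using eval_word_sum[OF vector_space_axioms fin(2)] x(2) by (simp add: x2_def)
    ultimately have "F ?P = 0" using vanish_kernel[OF F, of ?P] by fast
    moreover have "F ?P = (\<Sum>w\<in>B. u (c (Inr w)) (W w))"
      unfolding linear_sum[OF F(1)] linear_scale[OF F(1)]
      by (intro sum.cong refl) (simp add: B_def L_def F(2))
    moreover have phi0: "\<phi> 0 = 0"
      using phi_linear subspace_0[OF H_subspace] unfolding linear_on_def by (metis add_cancel_right_right)
    moreover have "(\<Sum>h\<in>A. u (c (Inl h)) (\<phi> h)) = \<phi> x1 \<and> x1 \<in> H"
    proof -
      have "A \<subseteq> H" by (auto simp: A_def)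
      with fin(1) show ?thesis unfolding x1_def
      proof (induction A rule: finite_induct)
        case (insert x A)
        then show ?case using phi_linear H_subspace by (simp add: linear_on_def subspace_def)
      qed (simp add: phi0 subspace_0[OF H_subspace])
    qed
    ultimately show "(\<Sum>i\<in>I. u (c i) (y i)) = 0"
      using split[of u] x(1) by (simp add: y_def)
  qed
  then obtain D where D: "Vector_Spaces.linear s u D" "\<And>i. D (g i) = y i" by blast
  have DH: "D h = \<phi> h" if "h \<in> H" for h
    using D(2)[of "Inl h"] that by (simp add: g_def y_def)
  have "D (prod_list w) = W w" if "w \<in> lists \<Gamma>" for w
    using D(2)[of "Inr w"] that DH[OF one_H]
    by (cases "w = []") (simp_all add: g_def y_def L_def phi_one)
  with D(1) DH show ?thesis by blast
qed

text \<open>Multiplicativity is widened through the left factor: from H to \<Gamma>, to products of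
  elements of \<Gamma>, to everything. Each time both sides are linear in the remaining argument and
  are compared on the generators a da_1...da_k.\<close>

theorem dga_extension:
  "\<exists>D. Vector_Spaces.linear s u D \<and> (\<forall>h\<in>H. D h = \<phi> h) \<and> (\<forall>k. \<forall>x\<in>\<Omega> k. D x \<in> \<Theta> k) \<and>
     (\<forall>x y. D (x * y) = D x \<star> D y) \<and> (\<forall>x. D (d x) = \<delta> (D x))"
proof -
  obtain D where D: "Vector_Spaces.linear s u D" "\<And>h. h \<in> H \<Longrightarrow> D h = \<phi> h"
      "\<And>w. w \<in> lists \<Gamma> \<Longrightarrow> D (prod_list w) = W w"
    using extension_on_words by blast
  note D_linear = linear_add[OF D(1)] linear_scale[OF D(1)] linear_zero[OF D(1)]
  have D_word: "D (h * prod_list w) = \<phi> h \<star> W w" if "h \<in> H" "w \<in> lists \<Gamma>" for h w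
  proof (cases w)
    case Nil
    then show ?thesis using that by (simp add: D C.mult_one_right phi_C)
  next
    case (Cons x v)
    \<comment> \<open>The coefficient is absorbed by the first letter, which stays in
      \<Gamma>.\<close>
    then have "D (h * prod_list w) = D (prod_list ((h * x) # v))" by (simp add: mult.assoc)
    also have "\<dots> = D1 (h * x) \<star> W v" using that Cons mult_Gamma by (subst D(3)) auto
    finally show ?thesis using that Cons by (simp add: D1_left C.mult_assoc phi_C D1_C W_C)
  qed
  have gen: "map d as \<in> lists \<Gamma>" if "set as \<subseteq> H" for as using that by (induction as) (simp_all add: d_Gamma)
  have gen_degree: "\<phi> a \<star> W (map d as) \<in> \<Theta> (length as)" if "a \<in> H" "set as \<subseteq> H" for a as
    using C.mult_degree[OF phi_degree[OF that(1)] W_degree[OF gen[OF that(2)]]] by simp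
  have degree: "D x \<in> \<Theta> k" if "x \<in> \<Omega> k" for x k
    using that unfolding degree_span[of k]
    by (rule span_closed[OF D(1) C.degree_subspace, rotated])
      (use gen gen_degree in \<open>auto simp: D_word\<close>)
  have D_C: "D x \<in> C" for x
    by (rule span_closed[OF D(1) C.subspace_C _ span_homogeneous]) (use degree C.degree_in_C in blast)
  have lin_mult_right: "Vector_Spaces.linear s u (\<lambda>y. D (x * y))"
    and lin_mult_left: "Vector_Spaces.linear s u (\<lambda>x. D (x * y))"
    and lin_right: "X \<in> C \<Longrightarrow> Vector_Spaces.linear s u (\<lambda>y. X \<star> D y)"
    and lin_left: "X \<in> C \<Longrightarrow> Vector_Spaces.linear s u (\<lambda>y. D y \<star> X)" for x y X
    by (simp_all add: linear_iff vector_space_axioms C.vector_space_axioms D_linear distrib_left distrib_right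
        scale_mult C.mult_linear D_C)
  have left_H: "D (h * y) = \<phi> h \<star> D y" if "h \<in> H" for h y
    by (rule span_eqI[OF lin_mult_right lin_right[OF phi_C[OF that]] _ span_generators])
      (use that gen in \<open>auto simp: D_word mult_H phi_mult C.mult_assoc phi_C W_C simp flip: mult.assoc\<close>)
  have left_Gamma: "D (x * y) = D1 x \<star> D y" if "x \<in> \<Gamma>" for x y
  proof (rule span_eqI[OF lin_mult_right lin_right[OF D1_C[OF that]] _ span_generators])
    fix y assume "y \<in> {a * prod_list (map d as) |a as. a \<in> H \<and> set as \<subseteq> H}"
    then obtain a as where y: "y = a * prod_list (map d as)" "a \<in> H" "set as \<subseteq> H" by blast
    \<comment> \<open>Here \<open>x\<close> absorbs the coefficient of the generator from the right,
      so the product is again a word in \<Gamma>.\<close>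
    then have "D (x * y) = D (prod_list ((x * a) # map d as))" by (simp add: mult.assoc)
    also have "\<dots> = D1 (x * a) \<star> W (map d as)" using that y gen mult_Gamma by (subst D(3)) auto
    finally show "D (x * y) = D1 x \<star> D y"
      using that y gen by (simp add: D1_right C.mult_assoc phi_C D1_C W_C D_word)
  qed
  have left_word: "D (prod_list w * y) = W w \<star> D y" if "w \<in> lists \<Gamma>" for w y
    using that
    by (induction w) (simp_all add: C.mult_one_left D_C left_Gamma C.mult_assoc D1_C W_C mult.assoc)
  have mult: "D (x * y) = D x \<star> D y" for x y
    by (rule span_eqI[OF lin_mult_left lin_left[OF D_C] _ span_generators])
      (use gen in \<open>auto simp: mult.assoc left_H left_word D(3) C.mult_assoc phi_C W_C D_C\<close>)
  have D1_d: "D1 (d g) = \<delta> (\<phi> g)" if "g \<in> H" for g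
    using D1_diff[OF one_H that] that by (simp add: phi_one C.mult_one_left diff_phi_C)
  have one: "e \<in> C" using C.one_degree C.degree_in_C by blast
  \<comment> \<open>The unit is closed: the Leibniz rule for e = e \<star> e gives \<delta> e twice
    on the right.\<close>
  have "\<delta> e = \<delta> e \<star> e + e \<star> \<delta> e" using C.diff_mult[OF C.one_degree one] by (simp add: C.mult_one_left one)
  then have diff_one: "\<delta> e = 0"
    using C.diff_degree[OF C.one_degree] C.degree_in_C by (simp add: C.mult_one_left C.mult_one_right)
  have "d 1 = d 1 + d 1" using diff_mult[OF one_degree, of 1] by simp
  then have d_one: "d 1 = 0" by simp
  \<comment> \<open>Products of differentials are closed on both sides, so a differential acts only
    on the coefficient of a generator.\<close>
  have closed: "d (prod_list (map d as)) = 0 \<and> \<delta> (W (map d as)) = 0" if "set as \<subseteq> H" for as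
    using that
  proof (induction as)
    case (Cons a as)
    then have "W (map d as) \<in> C" using gen W_C by simp
    then show ?case using Cons diff_mult[of "d a" "Suc 0"] diff_degree[of a 0] C.diff_mult[OF diff_phi, of a "W (map d as)"]
      by (simp add: degree_zero diff_diff D1_d C.diff_diff phi_C C.mult_zero diff_phi_C)
  qed (simp add: diff_one d_one)
  have "D (d x) = \<delta> (D x)" for x
  proof (rule span_eqI[OF _ _ _ span_generators])
    show "Vector_Spaces.linear s u (\<lambda>x. D (d x))" "Vector_Spaces.linear s u (\<lambda>x. \<delta> (D x))"
      using D(1) C.diff_linear diff_linear by (simp_all add: linear_iff)
    fix x assume "x \<in> {a * prod_list (map d as) |a as. a \<in> H \<and> set as \<subseteq> H}"
    then obtain a as where x: "x = a * prod_list (map d as)" "a \<in> H" "set as \<subseteq> H" by blast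
    have "d x = d a * prod_list (map d as)"
      using diff_mult[of a 0 "prod_list (map d as)"] x closed by (simp add: degree_zero)
    moreover have "\<delta> (\<phi> a \<star> W (map d as)) = \<delta> (\<phi> a) \<star> W (map d as)"
      using C.diff_mult[OF phi_degree W_C, of a "map d as"] x closed gen by (simp add: C.mult_zero phi_C)
    ultimately show "D (d x) = \<delta> (D x)"
      using x gen left_Gamma[of "d a" "prod_list (map d as)"] by (simp add: D_word d_Gamma D1_d D(3))
  qed
  with D degree mult show ?thesis by blast
qed

end

section \<open>The extended comultiplication and the left coaction\<close>

lemma (in carrier_dga) mult_sum_right:
  "X \<in> C \<Longrightarrow> (\<And>i. i \<in> I \<Longrightarrow> f i \<in> C) \<Longrightarrow> X \<star> (\<Sum>i\<in>I. f i) = (\<Sum>i\<in>I. X \<star> f i)"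
proof (induction I rule: infinite_finite_induct)
  case (insert i I)
  then have "(\<Sum>i\<in>I. f i) \<in> C" by (intro subspace_sum[OF subspace_C]) auto
  with insert show ?case by (simp add: mult_linear)
qed (simp_all add: mult_zero)

lemma (in dga_pair) carrier_dga: "carrier_dga fscale T T_degree (\<star>) one_tensor D"
  unfolding carrier_dga_def carrier_dga_axioms_def
  using vector_space_fscale subspace_tspace T_degree_subspace T_degree_in_T mult_bilinear mult_T mult_T_degree
    mult_assoc one_tensor_degree mult_one linear_D D_degree D_D D_mult
  by blast

context dga_pair
begin

lemma linear_mult_left: "Y \<in> T \<Longrightarrow> Vector_Spaces.linear fscale fscale (\<lambda>X. X \<star> Y)"
  unfolding tensor_mult_eq by (rule linear_tlift[OF vector_space_fscale mult_outer_bilinear])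

text \<open>A degree-zero \<open>b\<close> passes any \<open>a'\<close> without a sign. Since
  \<open>a'\<close> may be inhomogeneous, both sides are compared as linear functions of it.\<close>

lemma mult_tensor_degree_zero_left:
  assumes "b \<in> \<Omega>' 0"
  shows "tensor s t a b \<star> tensor s t a' b' = tensor s t (a * a') (b * b')"
proof -
  have "Vector_Spaces.linear s fscale (\<lambda>a'. pure_mult a b a' b')"
    "Vector_Spaces.linear s fscale (\<lambda>a'. tensor s t (a * a') (b * b'))"
    by (simp_all add: linear_iff A.vector_space_axioms vector_space_fscale pure_mult_linear distrib_left
        scale_mult tensor_linear)
  then have "pure_mult a b a' b' = tensor s t (a * a') (b * b')"
    by (rule A.linear_eq_homogeneous) (use mult_homogeneous[OF assms] in \<open>simp add: mult_tensor\<close>)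
  then show ?thesis by (simp add: mult_tensor)
qed

lemma mult_tensor_degree_zero_right:
  assumes "a' \<in> \<Omega> 0"
  shows "tensor s t a b \<star> tensor s t a' b' = tensor s t (a * a') (b * b')"
proof -
  have "Vector_Spaces.linear t fscale (\<lambda>b. pure_mult a b a' b')"
    "Vector_Spaces.linear t fscale (\<lambda>b. tensor s t (a * a') (b * b'))"
    by (simp_all add: linear_iff B.vector_space_axioms vector_space_fscale pure_mult_linear distrib_right
        scale_mult tensor_linear)
  then have "pure_mult a b a' b' = tensor s t (a * a') (b * b')"
    by (rule B.linear_eq_homogeneous) (use mult_homogeneous[OF _ assms] in \<open>simp add: mult_tensor\<close>)
  then show ?thesis by (simp add: mult_tensor)
qed

lemma mult_tsum_right:
  assumes "tensor_pair s' t' V W" "y \<in> tspace s' t' V W" "X \<in> T"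
    "\<And>v w. v \<in> V \<Longrightarrow> w \<in> W \<Longrightarrow> f v w \<in> T"
  shows "X \<star> tsum s' t' V W f y = tsum s' t' V W (\<lambda>v w. X \<star> f v w) y"
proof -
  interpret C: carrier_dga fscale T T_degree "(\<star>)" one_tensor D by (rule carrier_dga)
  show ?thesis
    by (rule tensor_pair.tensor_repE[OF assms(1,2)])
      (simp add: tsum_def C.mult_sum_right assms(3,4))
qed

end

locale bicovariant_prolongation =
  Hopf: hopf_algebra s H \<Delta> \<epsilon> S + Cov: bicovariant_calculus s H \<Delta> \<Gamma> d + maximal_prolongation s H \<Gamma> \<Omega> d
  for s :: "'k::field \<Rightarrow> 'h::{ring,monoid_mult} \<Rightarrow> 'h" and H \<Delta> \<epsilon> S \<Gamma> \<Omega> d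
begin

sublocale graded_space s \<Omega> by (rule graded_space)

sublocale TP: dga_pair s \<Omega> d s \<Omega> d by (simp add: dga_pair_def dga_axioms)

sublocale HH: tensor_pair s s H H
  by standard (use Hopf.subspace in blast)+

sublocale HO: tensor_pair s s H UNIV
  by standard (use Hopf.subspace in blast, rule subspace_UNIV)

notation TP.mult (infixl "\<star>" 70)

lemma scale_mult: "s c x * y = s c (x * y)" "x * s c y = s c (x * y)"
  by (rule Hopf.scale_mult_left Hopf.scale_mult_right)+

lemma H_degree: "h \<in> H \<Longrightarrow> h \<in> \<Omega> 0" by (simp add: degree_zero)

lemma tspace_H_subset: "tspace s s H H \<subseteq> TP.T" "tspace s s H UNIV \<subseteq> TP.T" "tspace s s H H \<subseteq> tspace s s H UNIV"
  by (rule tspace_mono; simp)+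

lemma tspace_H_degree: "tspace s s H H \<subseteq> TP.T_degree 0"
  unfolding tspace_def
  by (rule fs.span_minimal[OF _ TP.T_degree_subspace]) (use TP.tensor_in_degree[of _ 0 _ 0] degree_zero in auto)

lemma comult_T: "h \<in> H \<Longrightarrow> \<Delta> h \<in> TP.T"
  using Hopf.comult_closed tspace_H_subset by blast

lemma sweedler_eq_tsum:
  "vector_space u \<Longrightarrow> bilinear_on s s u H H f \<Longrightarrow> h \<in> H \<Longrightarrow> sweedler s H \<Delta> u f h = tsum s s H H f (\<Delta> h)"
  unfolding sweedler_def by (rule HH.tlift_eq_tsum[OF _ _ Hopf.comult_closed])

lemma comult_add: "h \<in> H \<Longrightarrow> g \<in> H \<Longrightarrow> \<Delta> (h + g) = \<Delta> h + \<Delta> g"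
  and comult_scale: "h \<in> H \<Longrightarrow> \<Delta> (s c h) = fscale c (\<Delta> h)"
  using Hopf.comult_linear by (auto simp: linear_on_def)

text \<open>Here the nested \<open>SOME\<close> terms are traded for sums. Bilinearity in the inner
  pair evaluates the inner lift; bilinearity in the outer pair passes through the inner sum and
  evaluates the outer one.\<close>

lemma sweedler2_eq_tsum:
  assumes u: "vector_space u" and hg: "h \<in> H" "g \<in> H"
    and f1: "\<And>a b. a \<in> H \<Longrightarrow> b \<in> H \<Longrightarrow> bilinear_on s s u H H (f a b)"
    and f2: "\<And>a b. a \<in> H \<Longrightarrow> b \<in> H \<Longrightarrow> bilinear_on s s u H H (\<lambda>c d. f c d a b)"
  shows "sweedler s H \<Delta> u (\<lambda>h1 h2. sweedler s H \<Delta> u (f h1 h2) g) h =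
    tsum s s H H (\<lambda>h1 h2. tsum s s H H (f h1 h2) (\<Delta> g)) (\<Delta> h)"
proof -
  have 1: "sweedler s H \<Delta> u (f h1 h2) g = tsum s s H H (f h1 h2) (\<Delta> g)" if "h1 \<in> H" "h2 \<in> H" for h1 h2
    by (rule sweedler_eq_tsum[OF u f1[OF that] hg(2)])
  note cong = HH.tsum_cong[OF Hopf.comult_closed[OF hg(2)]]
  have 2: "bilinear_on s s u H H (\<lambda>h1 h2. sweedler s H \<Delta> u (f h1 h2) g)"
    by (rule bilinear_onI)
      (simp_all add: 1 HH.add_V HH.scale_V bilinear_onD[OF f2] flip: tsum_add_fun tsum_scale_fun[OF u] cong: cong)
  show ?thesis
    unfolding sweedler_eq_tsum[OF u 2 hg(1)]
    by (rule HH.tsum_cong[OF Hopf.comult_closed[OF hg(1)]]) (rule 1)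
qed

lemma mult_comult:
  assumes "h \<in> H" "Y \<in> TP.T"
  shows "\<Delta> h \<star> Y = tsum s s H H (\<lambda>h1 h2. tensor s s h1 h2 \<star> Y) (\<Delta> h)"
  by (rule HH.linear_eq_tsum[OF TP.linear_mult_left[OF assms(2)] Hopf.comult_closed[OF assms(1)]])

lemma comult_mult: assumes "h \<in> H" "g \<in> H" shows "\<Delta> (h * g) = \<Delta> h \<star> \<Delta> g"
proof -
  note lin = HH.tensor_add_left HH.tensor_add_right HH.tensor_scale_left HH.tensor_scale_right
  have "\<Delta> (h * g) = tsum s s H H (\<lambda>h1 h2. tsum s s H H (\<lambda>g1 g2. tensor s s (h1 * g1) (h2 * g2)) (\<Delta> g)) (\<Delta> h)"
    unfolding Hopf.comult_mult[OF assms]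
    by (rule sweedler2_eq_tsum[OF vector_space_fscale assms]; rule bilinear_onI)
      (simp_all add: lin distrib_left distrib_right scale_mult)
  also have "\<dots> = tsum s s H H (\<lambda>h1 h2. tensor s s h1 h2 \<star> \<Delta> g) (\<Delta> h)"
  proof (rule HH.tsum_cong[OF Hopf.comult_closed[OF assms(1)]])
    fix h1 h2 assume h: "h1 \<in> H" "h2 \<in> H"
    have "tensor s s h1 h2 \<star> \<Delta> g = tensor s s h1 h2 \<star> tsum s s H H (tensor s s) (\<Delta> g)"
      by (simp add: HH.tsum_tensor Hopf.comult_closed assms)
    also have "\<dots> = tsum s s H H (\<lambda>g1 g2. tensor s s h1 h2 \<star> tensor s s g1 g2) (\<Delta> g)"
      by (rule TP.mult_tsum_right[OF HH.tensor_pair_axioms]) (simp_all add: Hopf.comult_closed assms TP.tensor_in)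
    finally show "tsum s s H H (\<lambda>g1 g2. tensor s s (h1 * g1) (h2 * g2)) (\<Delta> g) = tensor s s h1 h2 \<star> \<Delta> g"
      using h by (simp add: TP.mult_tensor_degree_zero_left H_degree)
  qed
  finally show ?thesis using mult_comult[OF assms(1) comult_T[OF assms(2)]] by simp
qed

lemma diff_add: "d (x + y) = d x + d y" and diff_scale: "d (s c x) = s c (d x)"
  using linear_add[OF diff_linear] linear_scale[OF diff_linear] by auto

lemma D_comult:
  "h \<in> H \<Longrightarrow> TP.D (\<Delta> h) = tsum s s H H (\<lambda>h1 h2. tensor s s (d h1) h2 + tensor s s h1 (d h2)) (\<Delta> h)"
  by (rule HH.tsum_eq_linear[symmetric, OF TP.linear_D Hopf.comult_closed])
    (simp_all add: TP.D_homogeneous[of _ 0] H_degree)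

lemma comult_diff_first_order:
  assumes "h \<in> H" "g \<in> H"
  shows "\<Delta> h \<star> TP.D (\<Delta> g) = tsum s s H H (\<lambda>h1 h2. tsum s s H H (\<lambda>g1 g2.
      tensor s s (h1 * d g1) (h2 * g2) + tensor s s (h1 * g1) (h2 * d g2)) (\<Delta> g)) (\<Delta> h)"
proof -
  have "\<Delta> h \<star> TP.D (\<Delta> g) = tsum s s H H (\<lambda>h1 h2. tensor s s h1 h2 \<star> TP.D (\<Delta> g)) (\<Delta> h)"
    by (rule mult_comult[OF assms(1) TP.D_T[OF comult_T[OF assms(2)]]])
  also have "\<dots> = tsum s s H H (\<lambda>h1 h2. tsum s s H H (\<lambda>g1 g2.
      tensor s s (h1 * d g1) (h2 * g2) + tensor s s (h1 * g1) (h2 * d g2)) (\<Delta> g)) (\<Delta> h)"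
  proof (rule HH.tsum_cong[OF Hopf.comult_closed[OF assms(1)]])
    fix h1 h2 assume h: "h1 \<in> H" "h2 \<in> H"
    have "tensor s s h1 h2 \<star> TP.D (\<Delta> g) =
        tsum s s H H (\<lambda>g1 g2. tensor s s h1 h2 \<star> (tensor s s (d g1) g2 + tensor s s g1 (d g2))) (\<Delta> g)"
      unfolding D_comult[OF assms(2)]
      by (rule TP.mult_tsum_right[OF HH.tensor_pair_axioms])
        (simp_all add: Hopf.comult_closed assms TP.tensor_in TP.tspace_add)
    then show "tensor s s h1 h2 \<star> TP.D (\<Delta> g) = tsum s s H H (\<lambda>g1 g2.
      tensor s s (h1 * d g1) (h2 * g2) + tensor s s (h1 * g1) (h2 * d g2)) (\<Delta> g)"
      using h by (simp add: TP.mult_linear TP.tensor_in TP.mult_tensor_degree_zero_left H_degree)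
  qed
  finally show ?thesis .
qed

text \<open>The differential of g_1 \<otimes> g_2 has the terms dg_1 \<otimes> g_2 and g_1 \<otimes>
  dg_2, which are the right and the left coaction. So \<open>D1\<close> is the sum of the two maps
  given by bicovariance, and its well-definedness is theirs.\<close>

lemma first_order_comult:
  "\<exists>D1. linear_on s fscale \<Gamma> D1 \<and> (\<forall>h\<in>H. \<forall>g\<in>H. D1 (h * d g) = \<Delta> h \<star> TP.D (\<Delta> g))"
proof -
  obtain \<rho> where \<rho>: "linear_on s fscale \<Gamma> \<rho>" "\<And>h g. h \<in> H \<Longrightarrow> g \<in> H \<Longrightarrow>
      \<rho> (h * d g) = sweedler s H \<Delta> fscale (\<lambda>h1 h2.
        sweedler s H \<Delta> fscale (\<lambda>g1 g2. tensor s s (h1 * d g1) (h2 * g2)) g) h"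
    using Cov.right_covariant by blast
  obtain L where L: "linear_on s fscale \<Gamma> L" "\<And>h g. h \<in> H \<Longrightarrow> g \<in> H \<Longrightarrow>
      L (h * d g) = sweedler s H \<Delta> fscale (\<lambda>h1 h2.
        sweedler s H \<Delta> fscale (\<lambda>g1 g2. tensor s s (h1 * g1) (h2 * d g2)) g) h"
    using Cov.left_covariant by blast
  note lin = HH.tensor_add_left HH.tensor_add_right HH.tensor_scale_left HH.tensor_scale_right
  have "\<rho> (h * d g) + L (h * d g) = \<Delta> h \<star> TP.D (\<Delta> g)" if "h \<in> H" "g \<in> H" for h g
  proof -
    have "\<rho> (h * d g) = tsum s s H H (\<lambda>h1 h2. tsum s s H H (\<lambda>g1 g2. tensor s s (h1 * d g1) (h2 * g2)) (\<Delta> g)) (\<Delta> h)"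
      unfolding \<rho>(2)[OF that]
      by (rule sweedler2_eq_tsum[OF vector_space_fscale that]; rule bilinear_onI)
        (simp_all add: lin distrib_left distrib_right scale_mult diff_add diff_scale)
    moreover have "L (h * d g) = tsum s s H H (\<lambda>h1 h2. tsum s s H H (\<lambda>g1 g2. tensor s s (h1 * g1) (h2 * d g2)) (\<Delta> g)) (\<Delta> h)"
      unfolding L(2)[OF that]
      by (rule sweedler2_eq_tsum[OF vector_space_fscale that]; rule bilinear_onI)
        (simp_all add: lin distrib_left distrib_right scale_mult diff_add diff_scale)
    ultimately show ?thesis using that by (simp add: comult_diff_first_order tsum_add_fun)
  qed
  moreover have "linear_on s fscale \<Gamma> (\<lambda>x. \<rho> x + L x)"
    using \<rho>(1) L(1) by (auto simp: linear_on_def fs.scale_right_distrib)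
  ultimately show ?thesis by blast
qed

section \<open>The comultiplication on forms and the coaction cut out of it\<close>

abbreviation "dcomult \<equiv> dga_comult s H \<Delta> \<Omega> d"

text \<open>The universal property exhibits a witness for the \<open>SOME\<close> term. Everything
  proved later about \<open>dcomult\<close> rests on these properties alone.\<close>

lemma dcomult_props:
  "Vector_Spaces.linear s fscale dcomult \<and> (\<forall>h\<in>H. dcomult h = \<Delta> h) \<and>
     (\<forall>k. \<forall>x\<in>\<Omega> k. dcomult x \<in> TP.T_degree k) \<and>
     (\<forall>x y. dcomult (x * y) = dcomult x \<star> dcomult y) \<and> (\<forall>x. dcomult (d x) = TP.D (dcomult x))"
proof -
  obtain D1 where D1: "linear_on s fscale \<Gamma> D1" "\<And>h g. h \<in> H \<Longrightarrow> g \<in> H \<Longrightarrow> D1 (h * d g) = \<Delta> h \<star> TP.D (\<Delta> g)"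
    using first_order_comult by blast
  interpret C: carrier_dga fscale TP.T TP.T_degree "(\<star>)" TP.one_tensor TP.D by (rule TP.carrier_dga)
  interpret E: prolongation_extension s H \<Gamma> \<Omega> d fscale TP.T TP.T_degree "(\<star>)" TP.one_tensor TP.D \<Delta> D1
    by standard (use Hopf.comult_linear Hopf.comult_closed tspace_H_degree Hopf.comult_one comult_mult D1 in auto)
  show ?thesis unfolding dga_comult_def by (rule someI_ex[OF E.dga_extension])
qed

lemma linear_dcomult: "Vector_Spaces.linear s fscale dcomult"
  and dcomult_H: "h \<in> H \<Longrightarrow> dcomult h = \<Delta> h"
  and dcomult_degree: "x \<in> \<Omega> k \<Longrightarrow> dcomult x \<in> TP.T_degree k"
  and dcomult_mult: "dcomult (x * y) = dcomult x \<star> dcomult y"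
  and dcomult_diff: "dcomult (d x) = TP.D (dcomult x)"
  using dcomult_props by blast+

lemma dcomult_T: "dcomult x \<in> TP.T"
  by (rule span_closed[OF linear_dcomult TP.subspace_tspace _ span_homogeneous])
    (use dcomult_degree TP.T_degree_in_T in blast)

definition proj :: "('k, 'h, 'h) tensor \<Rightarrow> ('k, 'h, 'h) tensor" where
  "proj = tlift s s fscale UNIV UNIV (\<lambda>x y. tensor s s (hcomp \<Omega> 0 x) y)"

lemma proj_bilinear: "bilinear_on s s fscale UNIV UNIV (\<lambda>x y. tensor s s (hcomp \<Omega> 0 x) y)"
  by (rule bilinear_onI) (simp_all add: linear_add[OF linear_hcomp] linear_scale[OF linear_hcomp] TP.tensor_linear)

lemma linear_proj: "Vector_Spaces.linear fscale fscale proj"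
  unfolding proj_def by (rule TP.linear_tlift[OF vector_space_fscale proj_bilinear])

lemma proj_tensor: "proj (tensor s s x y) = tensor s s (hcomp \<Omega> 0 x) y"
  unfolding proj_def by (rule TP.tlift_pure[OF vector_space_fscale proj_bilinear UNIV_I UNIV_I])

lemmas proj_linear = linear_add[OF linear_proj] linear_scale[OF linear_proj] linear_zero[OF linear_proj]

lemma proj_T: "X \<in> TP.T \<Longrightarrow> proj X \<in> TP.T"
  by (induction X rule: TP.T_induct)
    (simp_all add: proj_tensor proj_linear TP.tensor_in TP.tspace_add TP.tspace_scale TP.tspace_zero)

text \<open>Forms of positive degree are an ideal, so dropping them in the left factor respects
  products; when both left factors have degree zero the same sign stands on both sides.\<close>

lemma proj_mult: "X \<in> TP.T \<Longrightarrow> Y \<in> TP.T \<Longrightarrow> proj (X \<star> Y) = proj X \<star> proj Y"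
proof (induction X rule: TP.T_induct)
  case (pure a b i j)
  from pure(3) show ?case
  proof (induction Y rule: TP.T_induct)
    case (pure a' b' k l)
    have "a * a' \<in> \<Omega> (i + k)" by (rule mult_degree) fact+
    then show ?case using \<open>a \<in> \<Omega> i\<close> \<open>b \<in> \<Omega> j\<close> pure
      by (simp add: TP.mult_homogeneous proj_linear proj_tensor hcomp_homogeneous TP.mult_zero TP.tensor_in)
  qed (simp_all add: TP.mult_linear proj_linear TP.mult_zero proj_tensor TP.tensor_in proj_T TP.tspace_scale)
qed (simp_all add: TP.mult_linear proj_linear TP.mult_zero proj_T TP.tspace_scale)

lemma proj_H: "X \<in> tspace s s H UNIV \<Longrightarrow> proj X = X"
  unfolding tspace_def
  by (rule span_eqI[OF linear_proj fs.linear_ident])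
    (auto simp: proj_tensor hcomp_homogeneous[of _ 0] degree_zero)

definition coact :: "'h \<Rightarrow> ('k, 'h, 'h) tensor" where "coact x = proj (dcomult x)"

lemma linear_coact: "Vector_Spaces.linear s fscale coact"
  using linear_proj linear_dcomult by (simp add: linear_iff coact_def)

lemma coact_mult: "coact (x * y) = coact x \<star> coact y"
  by (simp add: coact_def dcomult_mult proj_mult dcomult_T)

lemma coact_H: "h \<in> H \<Longrightarrow> coact h = \<Delta> h"
  by (simp add: coact_def dcomult_H proj_H subsetD[OF tspace_H_subset(3)] Hopf.comult_closed)

lemma coact_T: "coact x \<in> TP.T"
  by (simp add: coact_def proj_T dcomult_T)

lemma coact_diff: "h \<in> H \<Longrightarrow> coact (d h) = tsum s s H H (\<lambda>h1 h2. tensor s s h1 (d h2)) (\<Delta> h)"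
proof -
  assume h: "h \<in> H"
  have "coact (d h) = tsum s s H H (\<lambda>h1 h2. proj (tensor s s (d h1) h2 + tensor s s h1 (d h2))) (\<Delta> h)"
    by (simp add: coact_def dcomult_diff dcomult_H h D_comult tsum_linear_image[OF linear_proj])
  also have "\<dots> = tsum s s H H (\<lambda>h1 h2. tensor s s h1 (d h2)) (\<Delta> h)"
  proof (rule HH.tsum_cong[OF Hopf.comult_closed[OF h]])
    fix h1 h2 assume "h1 \<in> H"
    then have "d h1 \<in> \<Omega> (Suc 0)" "h1 \<in> \<Omega> 0" using diff_degree[of h1 0] by (simp_all add: degree_zero)
    then show "proj (tensor s s (d h1) h2 + tensor s s h1 (d h2)) = tensor s s h1 (d h2)"
      by (simp add: proj_linear proj_tensor hcomp_homogeneous)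
  qed
  finally show ?thesis .
qed

text \<open>The accumulators \<open>x\<close> and \<open>y\<close> only ever grow on the right, so
  the recursion computes left multiplication by \<open>tensor s s x y\<close>. No sign appears
  because each new left leg h_1 has degree zero.\<close>

lemma coaction_word_eq:
  "x \<in> H \<Longrightarrow> set hs \<subseteq> H \<Longrightarrow>
    coaction_word s H \<Delta> d x y hs = tensor s s x y \<star> coact (prod_list (map d hs))"
proof (induction hs arbitrary: x y)
  case Nil
  then show ?case by (simp add: coact_H Hopf.one_closed Hopf.comult_one TP.mult_one TP.tensor_in)
next
  case (Cons h hs)
  let ?Z = "coact (prod_list (map d hs))"
  have h: "h \<in> H" and hs: "set hs \<subseteq> H" using Cons by auto
  have IH: "coaction_word s H \<Delta> d (x * h1) (y * d h2) hs = tensor s s (x * h1) (y * d h2) \<star> ?Z" if "h1 \<in> H" for h1 h2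
    using Cons.IH[OF Hopf.mult_closed hs] Cons that by blast
  have "bilinear_on s s fscale H H (\<lambda>h1 h2. coaction_word s H \<Delta> d (x * h1) (y * d h2) hs)"
    by (rule bilinear_onI)
      (simp only: IH HH.add_V HH.scale_V, simp add: distrib_left scale_mult diff_add diff_scale TP.tensor_linear
        TP.mult_linear TP.tensor_in coact_T)+
  then have "coaction_word s H \<Delta> d x y (h # hs) =
      tsum s s H H (\<lambda>h1 h2. coaction_word s H \<Delta> d (x * h1) (y * d h2) hs) (\<Delta> h)"
    using h by (simp add: sweedler_eq_tsum[OF vector_space_fscale])
  also have "\<dots> = tsum s s H H (\<lambda>h1 h2. (tensor s s x y \<star> tensor s s h1 (d h2)) \<star> ?Z) (\<Delta> h)"
    by (rule HH.tsum_cong[OF Hopf.comult_closed[OF h]])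
      (simp add: IH TP.mult_tensor_degree_zero_right H_degree)
  also have "\<dots> = tensor s s x y \<star> coact (d h) \<star> ?Z"
    unfolding coact_diff[OF h] tsum_linear_image[OF TP.linear_mult_left[OF coact_T], symmetric]
    by (subst TP.mult_tsum_right[OF HH.tensor_pair_axioms])
      (simp_all add: TP.tensor_in Hopf.comult_closed h)
  finally show ?case by (simp add: coact_mult TP.mult_assoc TP.tensor_in coact_T)
qed

lemma coact_word:
  assumes "h \<in> H" "set hs \<subseteq> H"
  shows "coact (h * prod_list (map d hs)) =
    sweedler s H \<Delta> fscale (\<lambda>h1 h2. coaction_word s H \<Delta> d h1 h2 hs) h"
proof -
  have "bilinear_on s s fscale H H (\<lambda>h1 h2. coaction_word s H \<Delta> d h1 h2 hs)"
    by (rule bilinear_onI)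
      (simp_all add: coaction_word_eq assms HH.add_V HH.scale_V TP.tensor_linear TP.mult_linear TP.tensor_in coact_T)
  from sweedler_eq_tsum[OF vector_space_fscale this assms(1)]
  have "sweedler s H \<Delta> fscale (\<lambda>h1 h2. coaction_word s H \<Delta> d h1 h2 hs) h =
      tsum s s H H (\<lambda>h1 h2. tensor s s h1 h2 \<star> coact (prod_list (map d hs))) (\<Delta> h)"
    by (simp add: coaction_word_eq assms(2) cong: HH.tsum_cong[OF Hopf.comult_closed[OF assms(1)]])
  then show ?thesis by (simp add: coact_mult coact_H assms(1) mult_comult coact_T)
qed

text \<open>The defining condition of \<open>left_coaction\<close> fixes a linear map on a spanning
  set, and \<open>coact\<close> satisfies it.\<close>

lemma left_coaction_eq: "left_coaction s H \<Delta> d = coact"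
proof -
  let ?P = "\<lambda>L. Vector_Spaces.linear s fscale L \<and> (\<forall>h\<in>H. \<forall>hs. set hs \<subseteq> H \<longrightarrow>
       L (h * prod_list (map d hs)) = sweedler s H \<Delta> fscale (\<lambda>h1 h2. coaction_word s H \<Delta> d h1 h2 hs) h)"
  have *: "?P (left_coaction s H \<Delta> d)"
    unfolding left_coaction_def
    by (rule someI[of ?P coact]) (simp add: linear_coact coact_word)
  show ?thesis
  proof
    fix x show "left_coaction s H \<Delta> d x = coact x"
      by (rule span_eqI[OF _ linear_coact _ span_generators]) (use * in \<open>auto simp: coact_word\<close>)
  qed
qed

text \<open>A term of total degree n survives \<open>proj\<close> only if its left factor has degree
  zero, which leaves degree n on the right.\<close>

lemma coact_degree:
  assumes "x \<in> \<Omega> n" shows "coact x \<in> tspace s s H (\<Omega> n)"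
proof -
  interpret HOn: tensor_pair s s H "\<Omega> n"
    by standard (use Hopf.subspace degree_subspace in blast)+
  have "proj X \<in> tspace s s H (\<Omega> n)" if "X \<in> TP.T_degree n" for X
    using that
  proof (induction rule: TP.T_degree_induct)
    case (pure x y i j)
    have "x \<in> H" "y \<in> \<Omega> n" if "i = 0" using pure that degree_zero by simp_all
    then show ?case
      by (cases "i = 0")
        (simp_all add: proj_tensor hcomp_homogeneous[OF pure(2)] HOn.tensor_in HOn.tspace_zero)
  qed (simp_all add: proj_linear HOn.tspace_add HOn.tspace_scale HOn.tspace_zero)
  then show ?thesis using dcomult_degree[OF assms] by (simp add: coact_def)
qed

lemma coact_in: "coact x \<in> tspace s s H UNIV"
proof (rule span_closed[OF linear_coact HO.subspace_tspace _ span_homogeneous])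
  fix x assume "x \<in> (\<Union>k. \<Omega> k)"
  then obtain k where "coact x \<in> tspace s s H (\<Omega> k)" using coact_degree by blast
  then show "coact x \<in> tspace s s H UNIV"
    using tspace_mono[OF order_refl subset_UNIV] by blast
qed

end

section \<open>Sweedler calculus\<close>

text \<open>The first two arguments are comultiplication or coaction legs in \<open>V\<close>, the
  last one ranges over \<open>W\<close>. Stated as bilinearity of each section \<open>f a\<close>
  plus linearity in \<open>a\<close>, so that the sections can be lifted directly.\<close>

definition trilinear_on ::
  "('k \<Rightarrow> 'v::ab_group_add \<Rightarrow> 'v) \<Rightarrow> ('k \<Rightarrow> 'u::ab_group_add \<Rightarrow> 'u) \<Rightarrow> 'v set \<Rightarrow> 'v set \<Rightarrow>
   ('v \<Rightarrow> 'v \<Rightarrow> 'v \<Rightarrow> 'u) \<Rightarrow> bool"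
  where
  "trilinear_on s u V W f \<longleftrightarrow>
     (\<forall>a\<in>V. bilinear_on s s u V W (f a)) \<and> (\<forall>b\<in>V. \<forall>w\<in>W. linear_on s u V (\<lambda>a. f a b w))"

lemma trilinear_onD:
  assumes "trilinear_on s u V W f" "a \<in> V" "b \<in> V" "w \<in> W"
  shows "a' \<in> V \<Longrightarrow> f (a + a') b w = f a b w + f a' b w" "f (s c a) b w = u c (f a b w)"
    "b' \<in> V \<Longrightarrow> f a (b + b') w = f a b w + f a b' w" "f a (s c b) w = u c (f a b w)"
    "w' \<in> W \<Longrightarrow> f a b (w + w') = f a b w + f a b w'" "f a b (s c w) = u c (f a b w)"
  using assms unfolding trilinear_on_def linear_on_def bilinear_on_def by blast+

lemma trilinear_onI:
  assumes "\<And>a a' b w. a \<in> V \<Longrightarrow> a' \<in> V \<Longrightarrow> b \<in> V \<Longrightarrow> w \<in> W \<Longrightarrow> f (a + a') b w = f a b w + f a' b w"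
    "\<And>c a b w. a \<in> V \<Longrightarrow> b \<in> V \<Longrightarrow> w \<in> W \<Longrightarrow> f (s c a) b w = u c (f a b w)"
    "\<And>a b b' w. a \<in> V \<Longrightarrow> b \<in> V \<Longrightarrow> b' \<in> V \<Longrightarrow> w \<in> W \<Longrightarrow> f a (b + b') w = f a b w + f a b' w"
    "\<And>c a b w. a \<in> V \<Longrightarrow> b \<in> V \<Longrightarrow> w \<in> W \<Longrightarrow> f a (s c b) w = u c (f a b w)"
    "\<And>a b w w'. a \<in> V \<Longrightarrow> b \<in> V \<Longrightarrow> w \<in> W \<Longrightarrow> w' \<in> W \<Longrightarrow> f a b (w + w') = f a b w + f a b w'"
    "\<And>c a b w. a \<in> V \<Longrightarrow> b \<in> V \<Longrightarrow> w \<in> W \<Longrightarrow> f a b (s c w) = u c (f a b w)"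
  shows "trilinear_on s u V W f"
  unfolding trilinear_on_def linear_on_def bilinear_on_def by (simp add: assms)

context bicovariant_prolongation
begin

text \<open>\<open>sw f h\<close> is \<open>f h\<^sub>1 h\<^sub>2\<close> and \<open>cosw f x\<close> is \<open>f x\<^bsub>-1\<^esub> x\<^bsub>0\<^esub>\<close>. Being sums over chosen representatives, they
  are defined, and additive in \<open>f\<close>, without bilinearity of \<open>f\<close>.\<close>

definition sw :: "('h \<Rightarrow> 'h \<Rightarrow> 'u::ab_group_add) \<Rightarrow> 'h \<Rightarrow> 'u" where
  "sw f h = tsum s s H H f (\<Delta> h)"

definition cosw :: "('h \<Rightarrow> 'h \<Rightarrow> 'u::ab_group_add) \<Rightarrow> 'h \<Rightarrow> 'u" where
  "cosw f x = tsum s s H UNIV f (coact x)"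

lemma sw_cong: "h = h' \<Longrightarrow> h' \<in> H \<Longrightarrow> (\<And>a b. a \<in> H \<Longrightarrow> b \<in> H \<Longrightarrow> f a b = g a b) \<Longrightarrow> sw f h = sw g h'"
  unfolding sw_def by (simp only:) (rule HH.tsum_cong[OF Hopf.comult_closed])

lemma cosw_cong: "(\<And>a x. a \<in> H \<Longrightarrow> f a x = g a x) \<Longrightarrow> cosw f y = cosw g y"
  unfolding cosw_def by (rule HO.tsum_cong[OF coact_in])

lemma sw_add_fun: "sw (\<lambda>a b. f a b + g a b) h = sw f h + sw g h"
  and cosw_add_fun: "cosw (\<lambda>a x. f a x + g a x) y = cosw f y + cosw g y"
  by (simp_all add: sw_def cosw_def tsum_add_fun)

lemma sw_scale_fun: "vector_space u \<Longrightarrow> sw (\<lambda>a b. u c (f a b)) h = u c (sw f h)"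
  and cosw_scale_fun: "vector_space u \<Longrightarrow> cosw (\<lambda>a x. u c (f a x)) y = u c (cosw f y)"
  by (simp_all add: sw_def cosw_def tsum_scale_fun)

lemma sw_linear_image: "Vector_Spaces.linear u u' F \<Longrightarrow> F (sw f h) = sw (\<lambda>a b. F (f a b)) h"
  and cosw_linear_image: "Vector_Spaces.linear u u' F \<Longrightarrow> F (cosw f y) = cosw (\<lambda>a x. F (f a x)) y"
  by (simp_all add: sw_def cosw_def tsum_linear_image)

lemma cosw_sw_swap: "cosw (\<lambda>a x. sw (f a x) h) y = sw (\<lambda>b c. cosw (\<lambda>a x. f a x b c) y) h"
  and cosw_swap: "cosw (\<lambda>a x. cosw (g a x) z) y = cosw (\<lambda>b w. cosw (\<lambda>a x. g a x b w) y) z"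
  unfolding sw_def cosw_def by (rule tsum_swap)+

lemma sw_add: "vector_space u \<Longrightarrow> bilinear_on s s u H H f \<Longrightarrow> h \<in> H \<Longrightarrow> g \<in> H \<Longrightarrow> sw f (h + g) = sw f h + sw f g"
  and sw_scale: "vector_space u \<Longrightarrow> bilinear_on s s u H H f \<Longrightarrow> h \<in> H \<Longrightarrow> sw f (s c h) = u c (sw f h)"
  by (simp_all add: sw_def comult_add comult_scale HH.tsum_add HH.tsum_scale Hopf.comult_closed)

lemma linear_cosw:
  assumes "vector_space u" "bilinear_on s s u H UNIV f"
  shows "Vector_Spaces.linear s u (cosw f)"
  using assms by (simp add: linear_iff vector_space_axioms cosw_def[abs_def] HO.tsum_add HO.tsum_scale coact_in
      linear_add[OF linear_coact] linear_scale[OF linear_coact])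

context
  fixes u :: "'k \<Rightarrow> 'u::ab_group_add \<Rightarrow> 'u"
  assumes u: "vector_space u"
begin

lemma cosw_tlift:
  assumes f: "bilinear_on s s u H UNIV f"
  shows "cosw f x = tlift s s u H UNIV f (coact x)"
  unfolding cosw_def by (rule HO.tlift_eq_tsum[symmetric, OF u f coact_in])

lemma cosw_H:
  assumes f: "bilinear_on s s u H UNIV f" and h: "h \<in> H"
  shows "cosw f h = sw f h"
  unfolding cosw_tlift[OF f] sw_def coact_H[OF h]
  by (rule HH.tsum_eq_linear[symmetric, OF HO.linear_tlift[OF u f] Hopf.comult_closed[OF h]])
    (simp add: HO.tlift_pure[OF u f])

lemma cosw_diff:
  assumes f: "bilinear_on s s u H UNIV f" and h: "h \<in> H"
  shows "cosw f (d h) = sw (\<lambda>h1 h2. f h1 (d h2)) h"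
  unfolding cosw_tlift[OF f] coact_diff[OF h] tsum_linear_image[OF HO.linear_tlift[OF u f]] sw_def
  by (rule HH.tsum_cong[OF Hopf.comult_closed[OF h]]) (simp add: HO.tlift_pure[OF u f])

text \<open>The coaction is multiplicative, and the left leg of y lies in H, so the graded product
  produces no sign.\<close>

lemma cosw_mult:
  assumes f: "bilinear_on s s u H UNIV f"
  shows "cosw f (x * y) = cosw (\<lambda>a v. cosw (\<lambda>b w. f (a * b) (v * w)) y) x"
proof -
  have "coact x \<star> coact y = cosw (\<lambda>a v. tensor s s a v \<star> coact y) x"
    unfolding cosw_def by (rule HO.linear_eq_tsum[OF TP.linear_mult_left[OF coact_T] coact_in])
  also have "\<dots> = cosw (\<lambda>a v. cosw (\<lambda>b w. tensor s s (a * b) (v * w)) y) x"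
  proof (rule cosw_cong)
    fix a v assume "a \<in> H"
    have "tensor s s a v \<star> coact y = tensor s s a v \<star> cosw (tensor s s) y"
      by (simp add: cosw_def HO.tsum_tensor coact_in)
    also have "\<dots> = cosw (\<lambda>b w. tensor s s a v \<star> tensor s s b w) y"
      unfolding cosw_def
      by (rule TP.mult_tsum_right[OF HO.tensor_pair_axioms coact_in]) (simp_all add: TP.tensor_in)
    also have "\<dots> = cosw (\<lambda>b w. tensor s s (a * b) (v * w)) y"
      by (rule cosw_cong) (simp add: TP.mult_tensor_degree_zero_right H_degree)
    finally show "tensor s s a v \<star> coact y = cosw (\<lambda>b w. tensor s s (a * b) (v * w)) y" .
  qed
  finally have "cosw f (x * y) = tlift s s u H UNIV f (cosw (\<lambda>a v. cosw (\<lambda>b w. tensor s s (a * b) (v * w)) y) x)"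
    by (simp add: cosw_tlift[OF f] coact_mult)
  also have "\<dots> = cosw (\<lambda>a v. cosw (\<lambda>b w. f (a * b) (v * w)) y) x"
    unfolding cosw_linear_image[OF HO.linear_tlift[OF u f]]
    by (intro cosw_cong) (simp add: HO.tlift_pure[OF u f] Hopf.mult_closed)
  finally show ?thesis .
qed

lemma sw_mult:
  assumes f: "bilinear_on s s u H H f" and hg: "h \<in> H" "g \<in> H"
  shows "sw f (h * g) = sw (\<lambda>a v. sw (\<lambda>b w. f (a * b) (v * w)) g) h"
proof -
  have "\<Delta> (h * g) = sw (\<lambda>a v. tensor s s a v \<star> \<Delta> g) h"
    unfolding comult_mult[OF hg] sw_def by (rule mult_comult[OF hg(1) comult_T[OF hg(2)]])
  also have "\<dots> = sw (\<lambda>a v. sw (\<lambda>b w. tensor s s (a * b) (v * w)) g) h"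
  proof (rule sw_cong[OF refl hg(1)])
    fix a v assume "a \<in> H"
    have "tensor s s a v \<star> \<Delta> g = tensor s s a v \<star> sw (tensor s s) g"
      by (simp add: sw_def HH.tsum_tensor Hopf.comult_closed hg)
    also have "\<dots> = sw (\<lambda>b w. tensor s s a v \<star> tensor s s b w) g"
      unfolding sw_def
      by (rule TP.mult_tsum_right[OF HH.tensor_pair_axioms]) (simp_all add: TP.tensor_in Hopf.comult_closed hg)
    also have "\<dots> = sw (\<lambda>b w. tensor s s (a * b) (v * w)) g"
      by (rule sw_cong[OF refl hg(2)]) (simp add: TP.mult_tensor_degree_zero_right H_degree)
    finally show "tensor s s a v \<star> \<Delta> g = sw (\<lambda>b w. tensor s s (a * b) (v * w)) g" .
  qed
  finally have "sw f (h * g) = tlift s s u H H f (sw (\<lambda>a v. sw (\<lambda>b w. tensor s s (a * b) (v * w)) g) h)"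
    using HH.tlift_eq_tsum[OF u f Hopf.comult_closed[OF Hopf.mult_closed[OF hg]]] by (simp add: sw_def[of f])
  also have "\<dots> = sw (\<lambda>a v. sw (\<lambda>b w. f (a * b) (v * w)) g) h"
    unfolding sw_linear_image[OF HH.linear_tlift[OF u f]]
    by (intro sw_cong refl hg) (simp add: HH.tlift_pure[OF u f] Hopf.mult_closed)
  finally show ?thesis .
qed

lemma bilinear_sw_first:
  assumes f: "trilinear_on s u H W f"
  shows "bilinear_on s s u H W (\<lambda>a w. sw (\<lambda>a1 a2. f a1 a2 w) a)"
proof -
  have 1: "bilinear_on s s u H H (\<lambda>a1 a2. f a1 a2 w)" if "w \<in> W" for w
    by (rule bilinear_onI) (simp_all add: trilinear_onD[OF f] that)
  show ?thesis
    by (rule bilinear_onI)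
      (simp_all add: sw_add[OF u 1] sw_scale[OF u 1] trilinear_onD[OF f] flip: sw_add_fun sw_scale_fun[OF u]
        cong: sw_cong)
qed

text \<open>The Hopf axiom equates two elements of H \<otimes> (H \<otimes> H). A trilinear
  \<open>f\<close> induces a linear map there, lifting first the last two arguments and then the
  first; applying it to both elements gives the claim.\<close>

lemma sw_coassoc:
  assumes f: "trilinear_on s u H H f" and h: "h \<in> H"
  shows "sw (\<lambda>a b. sw (\<lambda>a1 a2. f a1 a2 b) a) h = sw (\<lambda>a b. sw (f a) b) h"
proof -
  interpret Tr: tensor_pair s fscale UNIV UNIV by standard (rule subspace_UNIV fs.subspace_UNIV)+
  interpret TH: tensor_pair s fscale H "tspace s s H H"
    by standard (use Hopf.subspace HH.subspace_tspace in blast)+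
  let ?t = "\<lambda>a1 a2 b. tensor s fscale a1 (tensor s s a2 b)"
  note lin = Tr.tensor_add_left Tr.tensor_add_right Tr.tensor_scale_left Tr.tensor_scale_right TP.tensor_linear
  have b1: "bilinear_on s s fscale H H (\<lambda>a1 a2. ?t a1 a2 b)" for b
    by (rule bilinear_onI) (simp_all add: lin)
  have sw_eq: "sweedler s H \<Delta> fscale g a = sw g a" if "bilinear_on s s fscale H H g" "a \<in> H" for g a
    unfolding sw_def by (rule sweedler_eq_tsum[OF vector_space_fscale that])
  have inner: "sweedler s H \<Delta> fscale (\<lambda>a1 a2. ?t a1 a2 b) a = sw (\<lambda>a1 a2. ?t a1 a2 b) a" if "a \<in> H" for a b
    by (rule sw_eq[OF b1 that])
  have tri': "bilinear_on s s fscale H H (\<lambda>a b. sweedler s H \<Delta> fscale (\<lambda>a1 a2. ?t a1 a2 b) a)"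
    by (rule bilinear_onI)
      (simp only: inner HH.add_V HH.scale_V, simp add: sw_add[OF vector_space_fscale b1]
        sw_scale[OF vector_space_fscale b1] lin sw_add_fun sw_scale_fun[OF vector_space_fscale])+
  have comult_bil: "bilinear_on s s fscale H H (\<lambda>a b. tensor s fscale a (\<Delta> b))"
    by (rule bilinear_onI) (simp_all add: lin comult_add comult_scale)
  have "sw (\<lambda>a b. sw (\<lambda>a1 a2. ?t a1 a2 b) a) h = sw (\<lambda>a b. tensor s fscale a (\<Delta> b)) h"
    using Hopf.coassoc[OF h] unfolding sw_eq[OF tri' h] sw_eq[OF comult_bil h]
    by (simp add: inner h cong: sw_cong)
  moreover have f1: "bilinear_on s s u H H (f a)" if "a \<in> H" for a
    using f that by (simp add: trilinear_on_def)
  have G: "bilinear_on s fscale u H (tspace s s H H) (\<lambda>a X. tlift s s u H H (f a) X)"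
  proof -
    have "bilinear_on s fscale u H (tspace s s H H) (\<lambda>a X. tsum s s H H (f a) X)"
    proof (rule bilinear_onI)
      fix a a' X X' c assume a: "a \<in> H" and X: "X \<in> tspace s s H H"
      show "tsum s s H H (f (a + a')) X = tsum s s H H (f a) X + tsum s s H H (f a') X" if "a' \<in> H"
        unfolding tsum_add_fun[symmetric]
        by (rule HH.tsum_cong[OF X]) (use a that trilinear_onD[OF f] in auto)
      show "tsum s s H H (f (s c a)) X = u c (tsum s s H H (f a) X)"
        unfolding tsum_scale_fun[OF u, symmetric]
        by (rule HH.tsum_cong[OF X]) (use a trilinear_onD[OF f] in auto)
      show "tsum s s H H (f a) (X + X') = tsum s s H H (f a) X + tsum s s H H (f a) X'" if "X' \<in> tspace s s H H"
        by (rule HH.tsum_add[OF u f1[OF a] X that])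
      show "tsum s s H H (f a) (fscale c X) = u c (tsum s s H H (f a) X)"
        by (rule HH.tsum_scale[OF u f1[OF a] X])
    qed
    then show ?thesis
      unfolding bilinear_on_def linear_on_def
      by (simp add: HH.tlift_eq_tsum[OF u f1] HH.add_V HH.scale_V HH.tspace_add HH.tspace_scale)
  qed
  let ?G = "tlift s fscale u H (tspace s s H H) (\<lambda>a X. tlift s s u H H (f a) X)"
  have G_lin: "Vector_Spaces.linear fscale u ?G" by (rule TH.linear_tlift[OF u G])
  have G_tensor: "?G (tensor s fscale a X) = tsum s s H H (f a) X" if "a \<in> H" "X \<in> tspace s s H H" for a X
    using TH.tlift_pure[OF u G that] HH.tlift_eq_tsum[OF u f1[OF that(1)] that(2)] by simp
  have "?G (sw (\<lambda>a b. sw (\<lambda>a1 a2. ?t a1 a2 b) a) h) = sw (\<lambda>a b. sw (\<lambda>a1 a2. f a1 a2 b) a) h"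
    by (simp add: sw_linear_image[OF G_lin] h G_tensor HH.tensor_in HH.tsum_pure[OF u f1] cong: sw_cong)
  moreover have "?G (sw (\<lambda>a b. tensor s fscale a (\<Delta> b)) h) = sw (\<lambda>a b. sw (f a) b) h"
    unfolding sw_linear_image[OF G_lin]
    by (rule sw_cong[OF refl h]) (simp add: G_tensor Hopf.comult_closed sw_def)
  ultimately show ?thesis by simp
qed

lemma bilinear_cosw_second:
  assumes f: "trilinear_on s u H UNIV f"
  shows "bilinear_on s s u H UNIV (\<lambda>a x. cosw (f a) x)"
proof -
  have f1: "Vector_Spaces.linear s u (cosw (f a))" if "a \<in> H" for a
    using linear_cosw[OF u] f that by (simp add: trilinear_on_def)
  have "cosw (f (a + a')) x = cosw (f a) x + cosw (f a') x" if "a \<in> H" "a' \<in> H" for a a' x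
    unfolding cosw_add_fun[symmetric] by (rule cosw_cong) (use that trilinear_onD[OF f] in auto)
  moreover have "cosw (f (s c a)) x = u c (cosw (f a) x)" if "a \<in> H" for a c x
    unfolding cosw_scale_fun[OF u, symmetric] by (rule cosw_cong) (use that trilinear_onD[OF f] in auto)
  ultimately show ?thesis
    by (intro bilinear_onI) (simp_all add: linear_add[OF f1] linear_scale[OF f1])
qed

text \<open>Quantified over all trilinear \<open>f\<close>, because passing to a product replaces
  \<open>f\<close> by translates of it.\<close>

definition coassoc_at :: "'h \<Rightarrow> bool" where
  "coassoc_at x \<longleftrightarrow> (\<forall>f. trilinear_on s u H UNIV f \<longrightarrow>
     cosw (\<lambda>a x. sw (\<lambda>a1 a2. f a1 a2 x) a) x = cosw (\<lambda>a x. cosw (f a) x) x)"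

lemma coassoc_at_H:
  assumes "h \<in> H" shows "coassoc_at h"
  unfolding coassoc_at_def
proof (intro allI impI)
  fix f :: "'h \<Rightarrow> 'h \<Rightarrow> 'h \<Rightarrow> 'u" assume f: "trilinear_on s u H UNIV f"
  then have f': "trilinear_on s u H H f" and f1: "\<And>a. a \<in> H \<Longrightarrow> bilinear_on s s u H UNIV (f a)"
    by (auto simp: trilinear_on_def bilinear_on_def linear_on_def)
  show "cosw (\<lambda>a x. sw (\<lambda>a1 a2. f a1 a2 x) a) h = cosw (\<lambda>a x. cosw (f a) x) h"
    unfolding cosw_H[OF bilinear_sw_first[OF f] assms] cosw_H[OF bilinear_cosw_second[OF f] assms]
      sw_coassoc[OF f' assms]
    by (rule sw_cong[OF refl assms]) (simp add: cosw_H f1)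
qed

lemma coassoc_at_diff:
  assumes "h \<in> H" shows "coassoc_at (d h)"
  unfolding coassoc_at_def
proof (intro allI impI)
  fix f :: "'h \<Rightarrow> 'h \<Rightarrow> 'h \<Rightarrow> 'u" assume f: "trilinear_on s u H UNIV f"
  then have f1: "\<And>a. a \<in> H \<Longrightarrow> bilinear_on s s u H UNIV (f a)"
    by (auto simp: trilinear_on_def)
  have f': "trilinear_on s u H H (\<lambda>a b c. f a b (d c))"
    by (rule trilinear_onI) (simp_all add: diff_add diff_scale trilinear_onD[OF f])
  show "cosw (\<lambda>a x. sw (\<lambda>a1 a2. f a1 a2 x) a) (d h) = cosw (\<lambda>a x. cosw (f a) x) (d h)"
    unfolding cosw_diff[OF bilinear_sw_first[OF f] assms] cosw_diff[OF bilinear_cosw_second[OF f] assms]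
      sw_coassoc[OF f' assms]
    by (rule sw_cong[OF refl assms]) (simp add: cosw_diff f1)
qed

text \<open>Coassociativity at y is applied with the legs of x held fixed, then coassociativity at x
  with the resulting sum over y as the function; the finite sums are swapped to bring each into
  position.\<close>

lemma coassoc_at_mult:
  assumes x: "coassoc_at x" and y: "coassoc_at y" shows "coassoc_at (x * y)"
  unfolding coassoc_at_def
proof (intro allI impI)
  fix f :: "'h \<Rightarrow> 'h \<Rightarrow> 'h \<Rightarrow> 'u" assume f: "trilinear_on s u H UNIV f"
  note fD = trilinear_onD[OF f]
  have f1: "bilinear_on s s u H UNIV (f a)" if "a \<in> H" for a
    using f that by (auto simp: trilinear_on_def)
  have f2: "bilinear_on s s u H H (\<lambda>a b. f a b w)" for w
    by (rule bilinear_onI) (simp_all add: fD)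
  have f3: "trilinear_on s u H UNIV (\<lambda>b1 b2 w. f (a1 * b1) (a2 * b2) (v * w))" if "a1 \<in> H" "a2 \<in> H" for a1 a2 v
    by (rule trilinear_onI) (simp_all add: fD that Hopf.mult_closed distrib_left scale_mult)
  let ?g = "\<lambda>a1 a2 v. cosw (\<lambda>b w. cosw (\<lambda>c z. f (a1 * b) (a2 * c) (v * z)) w) y"
  have g: "trilinear_on s u H UNIV ?g"
    by (rule trilinear_onI)
      (simp_all add: fD Hopf.mult_closed distrib_right scale_mult cosw_add_fun cosw_scale_fun[OF u] cong: cosw_cong)
  have "cosw (\<lambda>a x. sw (\<lambda>a1 a2. f a1 a2 x) a) (x * y) =
      cosw (\<lambda>a v. cosw (\<lambda>b w. sw (\<lambda>c1 c2. f c1 c2 (v * w)) (a * b)) y) x"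
    by (rule cosw_mult[OF bilinear_sw_first[OF f]])
  also have "\<dots> = cosw (\<lambda>a v. cosw (\<lambda>b w. sw (\<lambda>a1 a2. sw (\<lambda>b1 b2. f (a1 * b1) (a2 * b2) (v * w)) b) a) y) x"
    by (intro cosw_cong) (simp add: sw_mult[OF f2])
  also have "\<dots> = cosw (\<lambda>a v. sw (\<lambda>a1 a2. cosw (\<lambda>b w. sw (\<lambda>b1 b2. f (a1 * b1) (a2 * b2) (v * w)) b) y) a) x"
    by (simp add: cosw_sw_swap)
  also have "\<dots> = cosw (\<lambda>a v. sw (\<lambda>a1 a2. ?g a1 a2 v) a) x"
  proof (rule cosw_cong, rule sw_cong[OF refl], assumption)
    fix a1 a2 v assume "a1 \<in> H" "a2 \<in> H"
    from y f3[OF this, of v] show "cosw (\<lambda>b w. sw (\<lambda>b1 b2. f (a1 * b1) (a2 * b2) (v * w)) b) y = ?g a1 a2 v"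
      unfolding coassoc_at_def by blast
  qed
  also have "\<dots> = cosw (\<lambda>a v. cosw (?g a) v) x"
    using x g unfolding coassoc_at_def by blast
  also have "\<dots> = cosw (\<lambda>a v. cosw (\<lambda>b w. cosw (\<lambda>a2 v'. cosw (\<lambda>c z. f (a * b) (a2 * c) (v' * z)) w) v) y) x"
    by (subst cosw_swap) simp
  also have "\<dots> = cosw (\<lambda>a v. cosw (\<lambda>b w. cosw (f (a * b)) (v * w)) y) x"
    by (intro cosw_cong) (simp add: cosw_mult[OF f1] Hopf.mult_closed)
  also have "\<dots> = cosw (\<lambda>a x. cosw (f a) x) (x * y)"
    by (rule cosw_mult[OF bilinear_cosw_second[OF f], symmetric])
  finally show "cosw (\<lambda>a x. sw (\<lambda>a1 a2. f a1 a2 x) a) (x * y) = cosw (\<lambda>a x. cosw (f a) x) (x * y)" .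
qed

lemma cosw_coassoc:
  assumes f: "trilinear_on s u H UNIV f"
  shows "cosw (\<lambda>a x. sw (\<lambda>a1 a2. f a1 a2 x) a) x = cosw (\<lambda>a x. cosw (f a) x) x"
proof (rule span_eqI[OF _ _ _ span_generators])
  show "Vector_Spaces.linear s u (cosw (\<lambda>a x. sw (\<lambda>a1 a2. f a1 a2 x) a))"
    "Vector_Spaces.linear s u (cosw (\<lambda>a x. cosw (f a) x))"
    by (intro linear_cosw[OF u] bilinear_sw_first bilinear_cosw_second f)+
  fix x assume "x \<in> {a * prod_list (map d as) |a as. a \<in> H \<and> set as \<subseteq> H}"
  then obtain a as where x: "x = a * prod_list (map d as)" "a \<in> H" "set as \<subseteq> H" by blast
  have "coassoc_at (prod_list (map d as))" if "set as \<subseteq> H" for as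
    using that by (induction as) (simp_all add: coassoc_at_H Hopf.one_closed coassoc_at_diff coassoc_at_mult)
  then have "coassoc_at x" using x by (simp add: coassoc_at_mult coassoc_at_H)
  then show "cosw (\<lambda>a x. sw (\<lambda>a1 a2. f a1 a2 x) a) x = cosw (\<lambda>a x. cosw (f a) x) x"
    using f unfolding coassoc_at_def by blast
qed

end

end

section \<open>The fundamental theorem of Hopf modules\<close>

context bicovariant_prolongation
begin

section \<open>The counit on forms\<close>

lemma counit_add: "h \<in> H \<Longrightarrow> g \<in> H \<Longrightarrow> \<epsilon> (h + g) = \<epsilon> h + \<epsilon> g"
  and counit_scale: "h \<in> H \<Longrightarrow> \<epsilon> (s c h) = c * \<epsilon> h"
  using Hopf.counit_linear by (auto simp: linear_on_def)

lemma counit_zero: "\<epsilon> 0 = 0"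
  using counit_scale[OF HH.zero_V, of 0] by simp

lemma hcomp_H: "hcomp \<Omega> 0 x \<in> H" using hcomp_in[of 0 x] by (simp add: degree_zero)

definition form_counit :: "'h \<Rightarrow> 'k" where "form_counit x = \<epsilon> (hcomp \<Omega> 0 x)"

lemma form_counit_add: "form_counit (x + y) = form_counit x + form_counit y"
  and form_counit_scale: "form_counit (s c x) = c * form_counit x"
  by (simp_all add: form_counit_def linear_add[OF linear_hcomp] linear_scale[OF linear_hcomp] hcomp_H
      counit_add counit_scale)

lemma form_counit_H: "h \<in> H \<Longrightarrow> form_counit h = \<epsilon> h"
  by (simp add: form_counit_def hcomp_homogeneous[of _ 0] degree_zero)

lemma form_counit_pos: "x \<in> \<Omega> (Suc n) \<Longrightarrow> form_counit x = 0"
  by (simp add: form_counit_def hcomp_homogeneous[of _ "Suc n"] counit_zero)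

definition counit_map :: "('k, 'h, 'h) tensor \<Rightarrow> 'h" where
  "counit_map = tlift s s s UNIV UNIV (\<lambda>x y. s (form_counit x) y)"

lemma counit_map_bilinear: "bilinear_on s s s UNIV UNIV (\<lambda>x y. s (form_counit x) y)"
  by (rule bilinear_onI)
    (simp_all add: form_counit_add form_counit_scale scale_left_distrib scale_right_distrib mult.commute)

lemma linear_counit_map: "Vector_Spaces.linear fscale s counit_map"
  unfolding counit_map_def by (rule TP.linear_tlift[OF vector_space_axioms counit_map_bilinear])

lemma counit_map_tensor: "counit_map (tensor s s x y) = s (form_counit x) y"
  unfolding counit_map_def by (rule TP.tlift_pure[OF vector_space_axioms counit_map_bilinear UNIV_I UNIV_I])

lemmas counit_map_linear =
  linear_add[OF linear_counit_map] linear_scale[OF linear_counit_map] linear_zero[OF linear_counit_map]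

text \<open>Both sides vanish on homogeneous tensors unless the two left factors have degree zero,
  and then the sign exponent j k is zero.\<close>

lemma counit_map_mult: "X \<in> TP.T \<Longrightarrow> Y \<in> TP.T \<Longrightarrow> counit_map (X \<star> Y) = counit_map X * counit_map Y"
proof (induction X rule: TP.T_induct)
  case (pure a b i j)
  from pure(3) show ?case
  proof (induction Y rule: TP.T_induct)
    case (pure a' b' k l)
    have "a * a' \<in> \<Omega> (i + k)" by (rule mult_degree) fact+
    moreover have "tensor s s a b \<star> tensor s s a' b' = fscale ((-1) ^ (j * k)) (tensor s s (a * a') (b * b'))"
      by (rule TP.mult_homogeneous) fact+
    ultimately show ?case using \<open>a \<in> \<Omega> i\<close> \<open>b \<in> \<Omega> j\<close> pure
      by (cases i; cases k)
        (simp_all add: counit_map_linear counit_map_tensor form_counit_pos form_counit_H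
          degree_zero Hopf.counit_mult scale_mult mult.commute)
  qed (simp_all add: TP.mult_linear counit_map_linear TP.mult_zero counit_map_tensor TP.tensor_in TP.tspace_scale
      distrib_left scale_mult)
qed (simp_all add: TP.mult_linear counit_map_linear TP.mult_zero TP.tspace_scale distrib_right scale_mult)

lemma counit_map_comult: "h \<in> H \<Longrightarrow> counit_map (\<Delta> h) = h"
proof -
  assume h: "h \<in> H"
  have "bilinear_on s s s H H (\<lambda>h1 h2. s (\<epsilon> h1) h2)"
    by (rule bilinear_onI)
      (simp_all add: counit_add counit_scale scale_left_distrib scale_right_distrib mult.commute)
  from sweedler_eq_tsum[OF vector_space_axioms this h]
  have "tsum s s H H (\<lambda>h1 h2. s (\<epsilon> h1) h2) (\<Delta> h) = h" by (simp add: Hopf.counit_left h)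
  moreover have "tsum s s H H (\<lambda>h1 h2. s (\<epsilon> h1) h2) (\<Delta> h) = counit_map (\<Delta> h)"
    by (rule HH.tsum_eq_linear[OF linear_counit_map Hopf.comult_closed[OF h]])
      (simp add: counit_map_tensor form_counit_H)
  ultimately show ?thesis by simp
qed

text \<open>The term dh_1 \<otimes> h_2 is killed by its degree; the other gives \<epsilon>(h_1)
  dh_2, the differential of \<epsilon>(h_1) h_2.\<close>

lemma counit_map_dcomult_diff: "h \<in> H \<Longrightarrow> counit_map (dcomult (d h)) = d h"
proof -
  assume h: "h \<in> H"
  have lin: "Vector_Spaces.linear fscale s (\<lambda>X. d (counit_map X))"
    using linear_counit_map diff_linear by (simp add: linear_iff)
  have "counit_map (dcomult (d h)) =
      tsum s s H H (\<lambda>h1 h2. counit_map (tensor s s (d h1) h2 + tensor s s h1 (d h2))) (\<Delta> h)"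
    by (simp add: dcomult_diff dcomult_H h D_comult tsum_linear_image[OF linear_counit_map])
  also have "\<dots> = d (counit_map (\<Delta> h))"
  proof (rule HH.tsum_eq_linear[OF lin Hopf.comult_closed[OF h]])
    fix h1 h2 assume "h1 \<in> H"
    then have "d h1 \<in> \<Omega> (Suc 0)" using diff_degree[of h1 0] by (simp add: degree_zero)
    then show "counit_map (tensor s s (d h1) h2 + tensor s s h1 (d h2)) = d (counit_map (tensor s s h1 h2))"
      by (simp add: counit_map_linear counit_map_tensor form_counit_pos diff_scale)
  qed
  finally show ?thesis by (simp add: counit_map_comult h)
qed

text \<open>The composite is multiplicative and fixes H and dH, hence every generator.\<close>

lemma counit_map_dcomult: "counit_map (dcomult x) = x"
proof (rule span_eqI[OF _ linear_ident _ span_generators])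
  show "Vector_Spaces.linear s s (\<lambda>x. counit_map (dcomult x))"
    using linear_counit_map linear_dcomult by (simp add: linear_iff)
  fix x assume "x \<in> {a * prod_list (map d as) |a as. a \<in> H \<and> set as \<subseteq> H}"
  then obtain a as where x: "x = a * prod_list (map d as)" "a \<in> H" "set as \<subseteq> H" by blast
  have "counit_map (dcomult (prod_list (map d as))) = prod_list (map d as)" if "set as \<subseteq> H" for as
    using that
    by (induction as) (simp_all add: dcomult_H Hopf.one_closed counit_map_comult dcomult_mult
        counit_map_mult dcomult_T counit_map_dcomult_diff)
  moreover have "counit_map (dcomult a) = a" using x by (simp add: dcomult_H counit_map_comult)
  ultimately show "counit_map (dcomult x) = x"
    using x by (simp add: dcomult_mult counit_map_mult dcomult_T)
qed

text \<open>Restricting the left factor to degree zero does not change the counit map, because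
  \<open>form_counit\<close> reads only that component.\<close>

lemma cosw_counit: "cosw (\<lambda>a x. s (\<epsilon> a) x) y = y"
proof -
  have "counit_map (proj X) = counit_map X" if "X \<in> TP.T" for X
    using that
    by (induction X rule: TP.T_induct)
      (simp_all add: proj_tensor counit_map_tensor counit_map_linear proj_linear form_counit_def
        hcomp_homogeneous[OF hcomp_in])
  then have "counit_map (coact y) = y"
    by (simp add: coact_def dcomult_T counit_map_dcomult)
  moreover have "cosw (\<lambda>a x. s (\<epsilon> a) x) y = counit_map (coact y)"
    unfolding cosw_def
    by (rule HO.tsum_eq_linear[OF linear_counit_map coact_in]) (simp add: counit_map_tensor form_counit_H)
  ultimately show ?thesis by simp
qed

lemma cosw_counit_linear:
  assumes "Vector_Spaces.linear s u F"
  shows "cosw (\<lambda>a x. u (\<epsilon> a) (F x)) y = F y"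
  using cosw_linear_image[OF assms, of "\<lambda>a x. s (\<epsilon> a) x" y] linear_scale[OF assms] by (simp add: cosw_counit)

lemma sw_counit_right: "h \<in> H \<Longrightarrow> sw (\<lambda>h1 h2. s (\<epsilon> h2) h1) h = h"
proof -
  assume h: "h \<in> H"
  have "bilinear_on s s s H H (\<lambda>h1 h2. s (\<epsilon> h2) h1)"
    by (rule bilinear_onI)
      (simp_all add: counit_add counit_scale scale_left_distrib scale_right_distrib mult.commute)
  from sweedler_eq_tsum[OF vector_space_axioms this h] Hopf.counit_right[OF h] show ?thesis by (simp add: sw_def)
qed

section \<open>The antipode and the projection onto left coinvariants\<close>

lemma antipode_closed: "h \<in> H \<Longrightarrow> S h \<in> H"
  using Hopf.antipode_bij by (auto simp: bij_betw_def)

lemma antipode_add: "h \<in> H \<Longrightarrow> g \<in> H \<Longrightarrow> S (h + g) = S h + S g"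
  and antipode_scale: "h \<in> H \<Longrightarrow> S (s c h) = s c (S h)"
  using Hopf.antipode_linear by (auto simp: linear_on_def)

lemma sw_antipode:
  assumes h: "h \<in> H"
  shows "sw (\<lambda>h1 h2. S h1 * h2) h = s (\<epsilon> h) 1" "sw (\<lambda>h1 h2. h1 * S h2) h = s (\<epsilon> h) 1"
proof -
  have "bilinear_on s s s H H (\<lambda>h1 h2. S h1 * h2)" "bilinear_on s s s H H (\<lambda>h1 h2. h1 * S h2)"
    by (rule bilinear_onI; simp add: antipode_add antipode_scale distrib_left distrib_right scale_mult)+
  from this[THEN sweedler_eq_tsum[OF vector_space_axioms _ h]] Hopf.antipode_left[OF h] Hopf.antipode_right[OF h]
  show "sw (\<lambda>h1 h2. S h1 * h2) h = s (\<epsilon> h) 1" "sw (\<lambda>h1 h2. h1 * S h2) h = s (\<epsilon> h) 1"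
    by (simp_all add: sw_def)
qed

lemma linear_times: "Vector_Spaces.linear s s (\<lambda>y. x * y)" "Vector_Spaces.linear s s (\<lambda>y. y * x)"
  by (simp_all add: linear_iff vector_space_axioms distrib_left distrib_right scale_mult)

abbreviation "\<Lambda> \<equiv> left_coinvariants s H \<Delta> d"

lemma coinvariant_iff: "x \<in> \<Lambda> \<longleftrightarrow> coact x = tensor s s 1 x"
  by (simp add: left_coinvariants_def left_coaction_eq)

lemma subspace_coinvariants: "subspace \<Lambda>"
  using linear_coact by (simp add: subspace_def coinvariant_iff linear_iff TP.tensor_linear linear_zero[OF linear_coact])

text \<open>The standard projection of a left Hopf module onto its coinvariants.\<close>

definition coinv :: "'h \<Rightarrow> 'h" where "coinv x = cosw (\<lambda>a y. S a * y) x"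

lemma coinv_bilinear: "bilinear_on s s s H UNIV (\<lambda>a y. S a * y)"
  by (rule bilinear_onI) (simp_all add: antipode_add antipode_scale distrib_left distrib_right scale_mult)

lemma linear_coinv: "Vector_Spaces.linear s s coinv"
  using linear_cosw[OF vector_space_axioms coinv_bilinear] by (simp add: coinv_def[abs_def])

lemmas coinv_linear = linear_add[OF linear_coinv] linear_scale[OF linear_coinv]

text \<open>Coassociativity regroups the sum as x_{-2} S(x_{-1}) x_0; the antipode and counit laws
  collapse it to x.\<close>

lemma cosw_mult_coinv: "cosw (\<lambda>a x. a * coinv x) y = y"
proof -
  have tri: "trilinear_on s s H UNIV (\<lambda>a b x. a * (S b * x))"
    by (rule trilinear_onI) (simp_all add: antipode_add antipode_scale distrib_left distrib_right scale_mult)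
  have "cosw (\<lambda>a x. a * coinv x) y = cosw (\<lambda>a x. cosw (\<lambda>b z. a * (S b * z)) x) y"
    by (simp add: coinv_def cosw_linear_image[OF linear_times(1)])
  also have "\<dots> = cosw (\<lambda>a x. sw (\<lambda>a1 a2. a1 * (S a2 * x)) a) y"
    by (rule cosw_coassoc[OF vector_space_axioms tri, symmetric])
  also have "\<dots> = cosw (\<lambda>a x. s (\<epsilon> a) x) y"
  proof (rule cosw_cong)
    fix a x assume a: "a \<in> H"
    have "sw (\<lambda>a1 a2. a1 * (S a2 * x)) a = sw (\<lambda>a1 a2. a1 * S a2) a * x"
      by (simp add: sw_linear_image[OF linear_times(2)] mult.assoc)
    then show "sw (\<lambda>a1 a2. a1 * (S a2 * x)) a = s (\<epsilon> a) x" by (simp add: sw_antipode a scale_mult)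
  qed
  finally show ?thesis by (simp add: cosw_counit)
qed

text \<open>
  The difference \<open>K x\<close> between the coaction of \<open>S(x\<^bsub>-1\<^esub>) x\<^bsub>0\<^esub>\<close> and its coinvariant value satisfies
  \<open>\<Delta>(x\<^bsub>-1\<^esub>) K(x\<^bsub>0\<^esub>) = 0\<close>, and multiplying by \<open>\<Delta>(S(x\<^bsub>-1\<^esub>))\<close> gives \<open>K x = 0\<close>; this avoids the
  anti-comultiplicativity of \<open>S\<close>.
\<close>

lemma coinv_coinvariant: "coinv y \<in> \<Lambda>"
proof -
  define K where "K x = coact (coinv x) - tensor s s 1 (coinv x)" for x
  have K_T: "K x \<in> TP.T" for x
    unfolding K_def by (rule fs.subspace_diff[OF TP.subspace_tspace coact_T TP.tensor_in]) auto
  have lin_K: "Vector_Spaces.linear s fscale K"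
    unfolding K_def[abs_def]
    using linear_coact by (simp add: linear_iff coinv_linear TP.tensor_linear fs.scale_right_diff_distrib)
  note cb = linear_add[OF linear_coact] linear_scale[OF linear_coact]
  \<comment> \<open>The coaction of y = y_{-1} \<open>coinv\<close>(y_0) is computed twice, once
    from its multiplicativity and once from coassociativity. The two answers differ by this
    sum.\<close>
  have N: "cosw (\<lambda>a x. coact a \<star> K x) y = 0" for y
  proof -
    have "coact y = coact (cosw (\<lambda>a x. a * coinv x) y)" by (simp add: cosw_mult_coinv)
    also have "\<dots> = cosw (\<lambda>a x. coact a \<star> coact (coinv x)) y"
      by (simp add: cosw_linear_image[OF linear_coact] coact_mult)
    finally have 1: "coact y = cosw (\<lambda>a x. coact a \<star> coact (coinv x)) y" .
    have tri: "trilinear_on s fscale H UNIV (\<lambda>a b x. tensor s s a (b * coinv x))"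
      by (rule trilinear_onI) (simp_all add: TP.tensor_linear coinv_linear distrib_left distrib_right scale_mult)
    have "coact y = cosw (\<lambda>a x. tensor s s a x) y" by (simp add: cosw_def HO.tsum_tensor coact_in)
    also have "\<dots> = cosw (\<lambda>a x. tensor s s a (cosw (\<lambda>b z. b * coinv z) x)) y"
      by (simp add: cosw_mult_coinv)
    also have "\<dots> = cosw (\<lambda>a x. cosw (\<lambda>b z. tensor s s a (b * coinv z)) x) y"
      by (simp add: cosw_linear_image[OF TP.linear_tensor_right])
    also have "\<dots> = cosw (\<lambda>a x. sw (\<lambda>a1 a2. tensor s s a1 (a2 * coinv x)) a) y"
      by (rule cosw_coassoc[OF vector_space_fscale tri, symmetric])
    also have "\<dots> = cosw (\<lambda>a x. coact a \<star> tensor s s 1 (coinv x)) y"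
    proof (rule cosw_cong)
      fix a x assume a: "a \<in> H"
      have "coact a \<star> tensor s s 1 (coinv x) = sw (\<lambda>a1 a2. tensor s s a1 a2 \<star> tensor s s 1 (coinv x)) a"
        unfolding coact_H[OF a] sw_def by (rule mult_comult[OF a]) (simp add: TP.tensor_in)
      also have "\<dots> = sw (\<lambda>a1 a2. tensor s s a1 (a2 * coinv x)) a"
        by (rule sw_cong[OF refl a]) (simp add: TP.mult_tensor_degree_zero_left H_degree)
      finally show "sw (\<lambda>a1 a2. tensor s s a1 (a2 * coinv x)) a = coact a \<star> tensor s s 1 (coinv x)" by simp
    qed
    finally have 2: "coact y = cosw (\<lambda>a x. coact a \<star> tensor s s 1 (coinv x)) y" .
    have "coact a \<star> K x = coact a \<star> coact (coinv x) - coact a \<star> tensor s s 1 (coinv x)" for a x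
      using TP.mult_linear(3)[OF coact_T K_T TP.tensor_in[OF UNIV_I UNIV_I], of a x 1 "coinv x"]
      by (simp add: K_def)
    then have "cosw (\<lambda>a x. coact a \<star> K x) y =
        cosw (\<lambda>a x. coact a \<star> coact (coinv x)) y - cosw (\<lambda>a x. coact a \<star> tensor s s 1 (coinv x)) y"
      by (simp add: cosw_def tsum_diff_fun)
    also have "\<dots> = 0" by (simp only: 1[symmetric] 2[symmetric] diff_self)
    finally show ?thesis .
  qed
  have tri: "trilinear_on s fscale H UNIV (\<lambda>a b x. coact (S a) \<star> (coact b \<star> K x))"
    by (rule trilinear_onI)
      (simp_all add: antipode_add antipode_scale cb linear_add[OF lin_K] linear_scale[OF lin_K]
        TP.mult_linear TP.mult_T TP.tspace_add TP.tspace_scale coact_T K_T)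
  have "K y = cosw (\<lambda>a x. fscale (\<epsilon> a) (K x)) y" by (rule cosw_counit_linear[OF lin_K, symmetric])
  also have "\<dots> = cosw (\<lambda>a x. sw (\<lambda>a1 a2. coact (S a1) \<star> (coact a2 \<star> K x)) a) y"
  proof (rule cosw_cong)
    fix a x assume a: "a \<in> H"
    have lin: "Vector_Spaces.linear s fscale (\<lambda>b. coact b \<star> K x)"
      by (simp add: linear_iff vector_space_axioms vector_space_fscale cb TP.mult_linear coact_T K_T)
    have "sw (\<lambda>a1 a2. coact (S a1) \<star> (coact a2 \<star> K x)) a = sw (\<lambda>a1 a2. coact (S a1 * a2) \<star> K x) a"
      by (simp add: coact_mult TP.mult_assoc coact_T K_T)
    also have "\<dots> = coact (s (\<epsilon> a) 1) \<star> K x"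
      by (simp add: sw_linear_image[OF lin, symmetric] sw_antipode a)
    also have "\<dots> = fscale (\<epsilon> a) (K x)"
      by (simp add: cb coact_H Hopf.one_closed Hopf.comult_one TP.mult_linear TP.tensor_in K_T TP.mult_one)
    finally show "fscale (\<epsilon> a) (K x) = sw (\<lambda>a1 a2. coact (S a1) \<star> (coact a2 \<star> K x)) a" by simp
  qed
  also have "\<dots> = cosw (\<lambda>a x. cosw (\<lambda>b z. coact (S a) \<star> (coact b \<star> K z)) x) y"
    by (rule cosw_coassoc[OF vector_space_fscale tri])
  also have "\<dots> = cosw (\<lambda>a x. coact (S a) \<star> cosw (\<lambda>b z. coact b \<star> K z) x) y"
    by (rule cosw_cong, unfold cosw_def,
        rule TP.mult_tsum_right[OF HO.tensor_pair_axioms coact_in coact_T, symmetric])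
      (simp add: TP.mult_T coact_T K_T)
  also have "\<dots> = 0"
    unfolding N by (simp add: cosw_def TP.mult_zero coact_T)
  finally show ?thesis by (simp add: coinvariant_iff K_def)
qed

text \<open>A coinvariant contributes 1 \<otimes> x to the coaction, which leaves h_1 \<otimes> h_2
  x.\<close>

lemma cosw_coinvariant:
  assumes u: "vector_space u" and f: "bilinear_on s s u H UNIV f" and h: "h \<in> H" and x: "x \<in> \<Lambda>"
  shows "cosw f (h * x) = sw (\<lambda>a b. f a (b * x)) h"
proof -
  have "cosw f (h * x) = cosw (\<lambda>a v. cosw (\<lambda>b w. f (a * b) (v * w)) x) h"
    by (rule cosw_mult[OF u f])
  also have "\<dots> = cosw (\<lambda>a v. f a (v * x)) h"
  proof (rule cosw_cong)
    fix a v assume a: "a \<in> H"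
    have "bilinear_on s s u H UNIV (\<lambda>b w. f (a * b) (v * w))"
      by (rule bilinear_onI) (simp_all add: bilinear_onD[OF f] a Hopf.mult_closed distrib_left scale_mult)
    from HO.tsum_pure[OF u this Hopf.one_closed UNIV_I]
    show "cosw (\<lambda>b w. f (a * b) (v * w)) x = f a (v * x)"
      using x by (simp add: cosw_def coinvariant_iff)
  qed
  also have "\<dots> = sw (\<lambda>a b. f a (b * x)) h"
    by (rule cosw_H[OF u _ h], rule bilinear_onI)
      (simp_all add: bilinear_onD[OF f] distrib_right scale_mult)
  finally show ?thesis .
qed

text \<open>The value is S(h_1) h_2 x, so the antipode law applies. For h = 1 this shows that
  \<open>coinv\<close> fixes the coinvariants.\<close>

lemma coinv_mult:
  assumes "h \<in> H" "x \<in> \<Lambda>"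
  shows "coinv (h * x) = s (\<epsilon> h) x"
proof -
  have "coinv (h * x) = sw (\<lambda>a b. S a * b * x) h"
    unfolding coinv_def cosw_coinvariant[OF vector_space_axioms coinv_bilinear assms] by (simp add: mult.assoc)
  also have "\<dots> = sw (\<lambda>a b. S a * b) h * x" by (simp add: sw_linear_image[OF linear_times(2)])
  finally show ?thesis by (simp add: sw_antipode assms scale_mult)
qed

lemma cosw_degree:
  assumes u: "vector_space u" and U: "module.subspace u U" and f: "bilinear_on s s u H UNIV f"
    and x: "coact x \<in> tspace s s H W" and W: "\<And>a y. a \<in> H \<Longrightarrow> y \<in> W \<Longrightarrow> f a y \<in> U"
  shows "cosw f x \<in> U"
  unfolding cosw_tlift[OF u f]
  by (rule span_closed[OF HO.linear_tlift[OF u f] U _ x[unfolded tspace_def]])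
    (use W HO.tlift_pure[OF u f] in auto)

lemma coinv_degree: "x \<in> \<Omega> n \<Longrightarrow> coinv x \<in> \<Omega> n"
  unfolding coinv_def
  by (rule cosw_degree[OF vector_space_axioms degree_subspace coinv_bilinear coact_degree])
    (use mult_degree[of _ 0 _ n] antipode_closed degree_zero in auto)

lemma mult_H_degree: "h \<in> H \<Longrightarrow> x \<in> \<Omega> n \<Longrightarrow> h * x \<in> \<Omega> n"
  using mult_degree[of h 0 x n] by (simp add: degree_zero)

lemma diff_one: "d 1 = 0"
  using diff_mult[OF one_degree, of 1] by simp

lemma Hopf_module_iso:
  "\<exists>\<Phi>. Vector_Spaces.linear fscale s \<Phi> \<and> (\<forall>h\<in>H. \<forall>\<theta>\<in>\<Lambda>. \<Phi> (tensor s s h \<theta>) = h * \<theta>) \<and>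
     bij_betw \<Phi> (tspace s s H \<Lambda>) UNIV"
proof -
  interpret HL: tensor_pair s s H \<Lambda>
    by standard (use Hopf.subspace subspace_coinvariants in blast)+
  have bil: "bilinear_on s s s H \<Lambda> (*)"
    by (rule bilinear_onI) (simp_all add: distrib_left distrib_right scale_mult)
  let ?\<Phi> = "tlift s s s H \<Lambda> (*)"
  note lin = HL.linear_tlift[OF vector_space_axioms bil]
    and ten = HL.tlift_pure[OF vector_space_axioms bil]
  have bil': "bilinear_on s s fscale H UNIV (\<lambda>a x. tensor s s a (coinv x))"
    by (rule bilinear_onI) (simp_all add: TP.tensor_linear coinv_linear)
  let ?G = "cosw (\<lambda>a x. tensor s s a (coinv x))"
  note linG = linear_cosw[OF vector_space_fscale bil']
  have G_in: "?G y \<in> tspace s s H \<Lambda>" for y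
    unfolding cosw_def
    by (rule HO.tsum_in[OF HL.subspace_tspace vector_space_fscale coact_in])
      (simp add: HL.tensor_in coinv_coinvariant)
  \<comment> \<open>The legs of h \<theta> are h_1 and h_2 \<theta>; \<open>coinv\<close> turns the
    latter into \<epsilon>(h_2) \<theta>, and the counit law restores h.\<close>
  have GP: "?G (h * \<theta>) = tensor s s h \<theta>" if "h \<in> H" "\<theta> \<in> \<Lambda>" for h \<theta>
  proof -
    have "?G (h * \<theta>) = sw (\<lambda>a b. tensor s s (s (\<epsilon> b) a) \<theta>) h"
      unfolding cosw_coinvariant[OF vector_space_fscale bil' that]
      by (rule sw_cong[OF refl that(1)]) (simp add: coinv_mult that TP.tensor_linear)
    then show ?thesis
      by (simp add: sw_linear_image[OF TP.linear_tensor_left, symmetric] sw_counit_right that)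
  qed
  have PG: "?\<Phi> (?G y) = y" for y
    by (simp add: cosw_linear_image[OF lin] ten coinv_coinvariant cosw_mult_coinv cong: cosw_cong)
  have "bij_betw ?\<Phi> (tspace s s H \<Lambda>) (span UNIV)"
    unfolding tspace_def
    by (rule bij_betw_span[OF lin linG]) (use G_in ten GP PG in \<open>auto simp: tspace_def[symmetric]\<close>)
  then show ?thesis using lin ten by auto
qed

end

section \<open>The crossed product calculus\<close>

text \<open>The choice predicate sees \<open>f\<close> only on \<open>V\<close> and
  \<open>W\<close>, so the two \<open>SOME\<close> terms coincide. This rewrites nested lifts from
  the inside without first proving them bilinear.\<close>

lemma tlift_cong:
  "(\<And>v w. v \<in> V \<Longrightarrow> w \<in> W \<Longrightarrow> f v w = g v w) \<Longrightarrow> tlift s t u V W f = tlift s t u V W g"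
  unfolding tlift_def by (simp cong: ball_cong)

locale crossed_calculus = bicovariant_prolongation s H \<Delta> \<epsilon> S \<Gamma> \<Omega> d +
  Crossed: crossed_product s H \<Delta> \<epsilon> S t B act \<sigma> \<sigma>' + Base: twisted_module_calculus s H \<Delta> t B \<Omega>B dB act \<sigma>
  for s :: "'k::field \<Rightarrow> 'h::{ring,monoid_mult} \<Rightarrow> 'h" and H \<Delta> \<epsilon> S \<Gamma> \<Omega> d
    and t :: "'k \<Rightarrow> 'b::{ring,monoid_mult} \<Rightarrow> 'b" and B act \<sigma> \<sigma>' \<Omega>B dB
begin

sublocale BO: dga_pair t \<Omega>B dB s \<Omega> d
  by (simp add: dga_pair_def dga_axioms Base.dga_axioms)

sublocale TO: tensor_pair fscale s UNIV UNIV
  by standard (rule fs.subspace_UNIV subspace_UNIV)+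

abbreviation "\<Delta>A \<equiv> crossed_coaction s H \<Delta> \<Omega> d t"

lemma vs_t: "vector_space t" by (rule BO.A.vector_space_axioms)

lemma coaction_kernel_bilinear:
  "bilinear_on s s fscale UNIV UNIV (\<lambda>x y. tensor fscale s (tensor t s w x) y)"
  by (rule bilinear_onI)
    (simp_all add: BO.tensor_linear TO.tensor_add_left TO.tensor_scale_left TO.tensor_add_right TO.tensor_scale_right)

definition split_form :: "'b \<Rightarrow> ('k, 'h, 'h) tensor \<Rightarrow> ('k, ('k, 'b, 'h) tensor, 'h) tensor" where
  "split_form w = tlift s s fscale UNIV UNIV (\<lambda>x y. tensor fscale s (tensor t s w x) y)"

lemma linear_split_form: "Vector_Spaces.linear fscale fscale (split_form w)"
  unfolding split_form_def by (rule TP.linear_tlift[OF vector_space_fscale coaction_kernel_bilinear])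

lemma split_form_tensor: "split_form w (tensor s s x y) = tensor fscale s (tensor t s w x) y"
  unfolding split_form_def
  by (rule TP.tlift_pure[OF vector_space_fscale coaction_kernel_bilinear UNIV_I UNIV_I])

lemma split_form_eq_tsum:
  "X \<in> TP.T \<Longrightarrow> split_form w X = tsum s s UNIV UNIV (\<lambda>x y. tensor fscale s (tensor t s w x) y) X"
  using TP.linear_eq_tsum[OF linear_split_form] by (simp add: split_form_tensor)

lemma coaction_bilinear: "bilinear_on t s fscale UNIV UNIV (\<lambda>w x. split_form w (dcomult x))"
  by (rule bilinear_onI)
    (simp_all add: linear_add[OF linear_dcomult] linear_scale[OF linear_dcomult] linear_add[OF linear_split_form]
      linear_scale[OF linear_split_form] split_form_eq_tsum[OF dcomult_T] BO.tensor_linear TO.tensor_add_left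
      TO.tensor_scale_left tsum_add_fun tsum_scale_fun[OF vector_space_fscale])

lemma crossed_coaction_eq: "\<Delta>A = tlift t s fscale UNIV UNIV (\<lambda>w x. split_form w (dcomult x))"
  unfolding crossed_coaction_def split_form_def ..

lemma linear_crossed_coaction: "Vector_Spaces.linear fscale fscale \<Delta>A"
  unfolding crossed_coaction_eq by (rule BO.linear_tlift[OF vector_space_fscale coaction_bilinear])

lemma crossed_coaction_tensor: "\<Delta>A (tensor t s w x) = split_form w (dcomult x)"
  unfolding crossed_coaction_eq by (rule BO.tlift_pure[OF vector_space_fscale coaction_bilinear UNIV_I UNIV_I])

section \<open>A left inverse of the crossed coaction\<close>

definition right_counit :: "('k, 'b, 'h) tensor \<Rightarrow> 'b" where
  "right_counit = tlift t s t UNIV UNIV (\<lambda>w x. t (form_counit x) w)"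

lemma right_counit_bilinear: "bilinear_on t s t UNIV UNIV (\<lambda>w x. t (form_counit x) w)"
  by (rule bilinear_onI)
    (simp_all add: form_counit_add form_counit_scale BO.A.scale_left_distrib BO.A.scale_right_distrib mult.commute)

lemma linear_right_counit: "Vector_Spaces.linear fscale t right_counit"
  unfolding right_counit_def by (rule BO.linear_tlift[OF vs_t right_counit_bilinear])

lemma right_counit_tensor: "right_counit (tensor t s w x) = t (form_counit x) w"
  unfolding right_counit_def by (rule BO.tlift_pure[OF vs_t right_counit_bilinear UNIV_I UNIV_I])

lemma right_counit_one: "right_counit (tensor t s w 1) = w"
  by (simp add: right_counit_tensor form_counit_H Hopf.one_closed Hopf.counit_one)

lemma right_counit_degree:
  assumes "X \<in> BO.T_degree n" shows "right_counit X \<in> \<Omega>B n"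
  using assms
proof (induction X rule: BO.T_degree_induct)
  case (pure w x i j)
  then show ?case using Base.degree_subspace
    by (cases j) (simp_all add: right_counit_tensor form_counit_pos BO.A.subspace_def)
qed (use Base.degree_subspace in \<open>simp_all add: linear_add[OF linear_right_counit]
      linear_scale[OF linear_right_counit] linear_zero[OF linear_right_counit] BO.A.subspace_def\<close>)

definition middle_counit :: "('k, ('k, 'b, 'h) tensor, 'h) tensor \<Rightarrow> ('k, 'b, 'h) tensor" where
  "middle_counit = tlift fscale s fscale UNIV UNIV (\<lambda>X y. tensor t s (right_counit X) y)"

lemma middle_counit_bilinear: "bilinear_on fscale s fscale UNIV UNIV (\<lambda>X y. tensor t s (right_counit X) y)"
  by (rule bilinear_onI)
    (simp_all add: linear_add[OF linear_right_counit] linear_scale[OF linear_right_counit] BO.tensor_linear)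

lemma linear_middle_counit: "Vector_Spaces.linear fscale fscale middle_counit"
  unfolding middle_counit_def by (rule TO.linear_tlift[OF vector_space_fscale middle_counit_bilinear])

lemma middle_counit_tensor: "middle_counit (tensor fscale s X y) = tensor t s (right_counit X) y"
  unfolding middle_counit_def
  by (rule TO.tlift_pure[OF vector_space_fscale middle_counit_bilinear UNIV_I UNIV_I])

lemma middle_counit_coaction:
  assumes "X \<in> BO.T" shows "middle_counit (\<Delta>A X) = X"
proof (rule span_eqI[OF _ fs.linear_ident _ assms[unfolded tspace_def]])
  show "Vector_Spaces.linear fscale fscale (\<lambda>X. middle_counit (\<Delta>A X))"
    using linear_middle_counit linear_crossed_coaction by (simp add: linear_iff)
  fix X assume "X \<in> {tensor t s v w |v w. v \<in> UNIV \<and> w \<in> UNIV}"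
  then obtain w x where X: "X = tensor t s w x" by blast
  have lin: "Vector_Spaces.linear fscale fscale (\<lambda>Z. tensor t s w (counit_map Z))"
    using linear_counit_map BO.linear_tensor_right[of w] by (simp add: linear_iff)
  have "middle_counit (\<Delta>A X) =
      tsum s s UNIV UNIV (\<lambda>x y. middle_counit (tensor fscale s (tensor t s w x) y)) (dcomult x)"
    by (simp add: X crossed_coaction_tensor split_form_eq_tsum dcomult_T tsum_linear_image[OF linear_middle_counit])
  also have "\<dots> = tensor t s w (counit_map (dcomult x))"
    by (rule TP.tsum_eq_linear[OF lin dcomult_T])
      (simp add: middle_counit_tensor right_counit_tensor counit_map_tensor BO.tensor_linear)
  finally show "middle_counit (\<Delta>A X) = X" by (simp add: X counit_map_dcomult)
qed

section \<open>Base forms\<close>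

abbreviation "bforms \<equiv> base_forms s H \<Delta> \<Omega> d t"

lemma coaction_tensor_one: "\<Delta>A (tensor t s w 1) = tensor fscale s (tensor t s w 1) 1"
  by (simp add: crossed_coaction_tensor dcomult_H Hopf.one_closed Hopf.comult_one split_form_tensor)

lemma tensor_one_base: "tensor t s w 1 \<in> bforms"
  by (simp add: base_forms_def coaction_tensor_one BO.tensor_in)

text \<open>On a base form the coaction is X \<otimes> 1, and \<open>middle_counit\<close> sends
  this both to X and to the displayed tensor.\<close>

lemma base_form_eq: "X \<in> bforms \<Longrightarrow> X = tensor t s (right_counit X) 1"
  using middle_counit_coaction[of X] by (simp add: base_forms_def middle_counit_tensor)

lemma base_forms_eq_image: "bforms = (\<lambda>w. tensor t s w 1) ` UNIV"
  using base_form_eq tensor_one_base by blast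

text \<open>The range is the line spanned by 1. A scalar on the right factor moves to the left one,
  so the generators have the form w \<otimes> 1; the base forms are a subspace because their
  defining equation is linear.\<close>

lemma base_forms_eq: "bforms = tspace t s UNIV (range (\<lambda>c. s c 1))"
proof
  interpret R: tensor_pair t s UNIV "range (\<lambda>c. s c 1)"
    by standard (auto simp: subspace_def image_iff simp flip: scale_left_distrib intro: exI[of _ 0])
  have "1 \<in> range (\<lambda>c. s c 1)" by (rule range_eqI[of _ _ 1]) simp
  then show "bforms \<subseteq> tspace t s UNIV (range (\<lambda>c. s c 1))"
    unfolding base_forms_eq_image by (auto intro: R.tensor_in)
  have "fs.subspace bforms"
    using linear_crossed_coaction BO.subspace_tspace
    by (simp add: base_forms_def fs.subspace_def linear_iff linear_zero[OF linear_crossed_coaction]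
        TO.tensor_add_left TO.tensor_scale_left)
  moreover have "tensor t s w (s c 1) \<in> bforms" for w c
    using tensor_one_base[of "t c w"] by (simp add: BO.tensor_linear)
  ultimately show "tspace t s UNIV (range (\<lambda>c. s c 1)) \<subseteq> bforms"
    unfolding tspace_def by (intro fs.span_minimal) auto
qed

lemma base_forms_bij: "bij_betw (\<lambda>w. tensor t s w 1) UNIV bforms"
  unfolding base_forms_eq_image by (intro inj_on_imp_bij_betw inj_on_inverseI[of _ right_counit]) (rule right_counit_one)

lemma base_forms_degree: "(\<lambda>w. tensor t s w 1) ` \<Omega>B n = bforms \<inter> BO.T_degree n"
proof
  show "(\<lambda>w. tensor t s w 1) ` \<Omega>B n \<subseteq> bforms \<inter> BO.T_degree n"
    using tensor_one_base BO.tensor_in_degree[of _ n 1 0] one_degree by auto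
  show "bforms \<inter> BO.T_degree n \<subseteq> (\<lambda>w. tensor t s w 1) ` \<Omega>B n"
    using base_form_eq right_counit_degree by blast
qed

section \<open>Horizontal forms\<close>

abbreviation "hforms \<equiv> horizontal_forms s H \<Delta> \<Omega> d t"

text \<open>\<open>middle_counit\<close> leaves the last factor alone, so a coaction ending in H
  comes from a form ending in H. Conversely the comultiplication maps H into H \<otimes> H.\<close>

lemma horizontal_forms_eq: "hforms = tspace t s UNIV H"
proof
  interpret BH: tensor_pair t s UNIV H
    by standard (use Hopf.subspace BO.A.subspace_UNIV in blast)+
  interpret TH: tensor_pair fscale s BO.T H
    by standard (use Hopf.subspace BO.subspace_tspace in blast)+
  show "hforms \<subseteq> tspace t s UNIV H"
  proof
    fix X assume "X \<in> hforms"
    then have X: "X \<in> BO.T" "\<Delta>A X \<in> tspace fscale s BO.T H" by (auto simp: horizontal_forms_def)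
    have "middle_counit (\<Delta>A X) \<in> tspace t s UNIV H"
      by (rule span_closed[OF linear_middle_counit BH.subspace_tspace _ X(2)[unfolded tspace_def[of fscale]]])
        (auto simp: middle_counit_tensor BH.tensor_in)
    then show "X \<in> tspace t s UNIV H" by (simp add: middle_counit_coaction X(1))
  qed
  have split_H: "split_form w X \<in> tspace fscale s BO.T H" if "X \<in> tspace s s H H" for w X
    by (rule span_closed[OF linear_split_form TH.subspace_tspace _ that[unfolded tspace_def]])
      (auto simp: split_form_tensor intro!: TH.tensor_in BO.tensor_in)
  show "tspace t s UNIV H \<subseteq> hforms"
  proof
    fix X assume X: "X \<in> tspace t s UNIV H"
    have "\<Delta>A X \<in> tspace fscale s BO.T H"
      by (rule span_closed[OF linear_crossed_coaction TH.subspace_tspace _ X[unfolded tspace_def]])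
        (auto simp: crossed_coaction_tensor dcomult_H split_H Hopf.comult_closed)
    then show "X \<in> hforms"
      using X tspace_mono[of UNIV UNIV H UNIV t s] by (auto simp: horizontal_forms_def)
  qed
qed

text \<open>The map \<open>?p\<close> projects the H-factor to degree zero. It fixes horizontal
  forms, and from total degree n it keeps only the part whose left factor has degree n.\<close>

lemma horizontal_forms_degree: "hforms \<inter> BO.T_degree n = tspace t s (\<Omega>B n) H"
proof
  interpret Bn: tensor_pair t s "\<Omega>B n" H
    by standard (use Hopf.subspace Base.degree_subspace in blast)+
  let ?p = "tlift t s fscale UNIV UNIV (\<lambda>w x. tensor t s w (hcomp \<Omega> 0 x))"
  have bil: "bilinear_on t s fscale UNIV UNIV (\<lambda>w x. tensor t s w (hcomp \<Omega> 0 x))"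
    by (rule bilinear_onI)
      (simp_all add: BO.tensor_linear linear_add[OF linear_hcomp] linear_scale[OF linear_hcomp])
  note lin = BO.linear_tlift[OF vector_space_fscale bil]
    and p = BO.tlift_pure[OF vector_space_fscale bil UNIV_I UNIV_I]
  show "hforms \<inter> BO.T_degree n \<subseteq> tspace t s (\<Omega>B n) H"
  proof
    fix X assume "X \<in> hforms \<inter> BO.T_degree n"
    then have X: "X \<in> tspace t s UNIV H" "X \<in> BO.T_degree n" by (auto simp: horizontal_forms_eq)
    have "?p X = X"
      by (rule span_eqI[OF lin fs.linear_ident _ X(1)[unfolded tspace_def]])
        (auto simp: p hcomp_homogeneous[OF H_degree])
    moreover have "?p X \<in> tspace t s (\<Omega>B n) H"
      using X(2)
    proof (induction X rule: BO.T_degree_induct)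
      case (pure w x i j)
      then have "w \<in> \<Omega>B n" "x \<in> H" if "j = 0" using that degree_zero by simp_all
      then show ?case
        by (cases "j = 0") (simp_all add: p hcomp_homogeneous[OF pure(3)] Bn.tensor_in Bn.tspace_zero)
    qed (simp_all add: linear_add[OF lin] linear_scale[OF lin] linear_zero[OF lin] Bn.tspace_add Bn.tspace_scale
        Bn.tspace_zero)
    ultimately show "X \<in> tspace t s (\<Omega>B n) H" by simp
  qed
  show "tspace t s (\<Omega>B n) H \<subseteq> hforms \<inter> BO.T_degree n"
  proof (intro Int_greatest)
    show "tspace t s (\<Omega>B n) H \<subseteq> hforms" unfolding horizontal_forms_eq by (rule tspace_mono) auto
    show "tspace t s (\<Omega>B n) H \<subseteq> BO.T_degree n"
      unfolding tspace_def using BO.tensor_in_degree[of _ n _ 0] H_degree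
      by (intro fs.span_minimal[OF _ BO.T_degree_subspace]) auto
  qed
qed

section \<open>Vertical forms\<close>

lemma tspace_nested:
  "tspace fscale s (tspace t s B H) W =
    fs.span {tensor fscale s (tensor t s b h) x |b h x. b \<in> B \<and> h \<in> H \<and> x \<in> W}" (is "_ = fs.span ?G")
proof
  have "tensor fscale s X x \<in> fs.span ?G" if "X \<in> tspace t s B H" "x \<in> W" for X x
    by (rule span_closed[OF TO.linear_tensor_left fs.subspace_span _ that(1)[unfolded tspace_def]])
      (use that(2) in \<open>auto intro!: fs.span_base\<close>)
  then show "tspace fscale s (tspace t s B H) W \<subseteq> fs.span ?G"
    unfolding tspace_def[of fscale] by (intro fs.span_minimal fs.subspace_span) auto
  show "fs.span ?G \<subseteq> tspace fscale s (tspace t s B H) W"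
    unfolding tspace_def[of fscale]
  proof (rule fs.span_mono, clarify)
    fix b h x assume "b \<in> B" "h \<in> H" "x \<in> W"
    moreover from this have "tensor t s b h \<in> tspace t s B H"
      unfolding tspace_def by (auto intro: fs.span_base)
    ultimately show "\<exists>v w. tensor fscale s (tensor t s b h) x = tensor fscale s v w \<and> v \<in> tspace t s B H \<and> w \<in> W"
      by blast
  qed
qed

text \<open>This is the Hopf module isomorphism tensored with B and reassociated. For fixed
  \<open>\<theta>\<close> the map \<open>?R \<theta>\<close> multiplies the H-factor by
  \<open>\<theta>\<close>; it is also linear in \<open>\<theta>\<close>, so \<open>?\<Psi>\<close>
  can be lifted in a second stage.\<close>

lemma vertical_iso:
  "\<exists>\<Psi>. Vector_Spaces.linear fscale fscale \<Psi> \<and>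
     (\<forall>b\<in>B. \<forall>h\<in>H. \<forall>\<theta>\<in>\<Lambda>. \<Psi> (tensor fscale s (tensor t s b h) \<theta>) = tensor t s b (h * \<theta>)) \<and>
     bij_betw \<Psi> (tspace fscale s (tspace t s B H) \<Lambda>) (tspace t s B UNIV) \<and>
     (\<forall>n. \<Psi> ` tspace fscale s (tspace t s B H) (\<Lambda> \<inter> \<Omega> n) = tspace t s B (\<Omega> n))"
proof -
  interpret BH: tensor_pair t s B H
    by standard (use Hopf.subspace Crossed.B.subspace in blast)+
  interpret V: tensor_pair fscale s "tspace t s B H" \<Lambda>
    by standard (use BH.subspace_tspace subspace_coinvariants in blast)+
  have bil: "bilinear_on t s fscale UNIV UNIV (\<lambda>b h. tensor t s b (h * \<theta>))" for \<theta>
    by (rule bilinear_onI) (simp_all add: BO.tensor_linear distrib_right scale_mult)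
  let ?R = "\<lambda>\<theta>. tlift t s fscale UNIV UNIV (\<lambda>b h. tensor t s b (h * \<theta>))"
  note R_lin = BO.linear_tlift[OF vector_space_fscale bil]
    and R = BO.tlift_pure[OF vector_space_fscale bil UNIV_I UNIV_I]
  have sub: "X \<in> BO.T" if "X \<in> tspace t s B H" for X
    using that tspace_mono[of B UNIV H UNIV t s] by blast
  have R_right: "?R (\<theta> + \<theta>') X = ?R \<theta> X + ?R \<theta>' X" "?R (s c \<theta>) X = fscale c (?R \<theta> X)"
    if "X \<in> BO.T" for X \<theta> \<theta>' c
    unfolding BO.tlift_eq_tsum[OF vector_space_fscale bil that]
    by (simp_all add: distrib_left scale_mult BO.tensor_linear tsum_add_fun tsum_scale_fun[OF vector_space_fscale])
  have bil': "bilinear_on fscale s fscale (tspace t s B H) \<Lambda> (\<lambda>X \<theta>. ?R \<theta> X)"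
    by (rule bilinear_onI)
      (simp_all only: linear_add[OF R_lin] linear_scale[OF R_lin] R_right[OF sub])
  let ?\<Psi> = "tlift fscale s fscale (tspace t s B H) \<Lambda> (\<lambda>X \<theta>. ?R \<theta> X)"
  note lin = V.linear_tlift[OF vector_space_fscale bil']
  have \<Psi>: "?\<Psi> (tensor fscale s (tensor t s b h) \<theta>) = tensor t s b (h * \<theta>)" if "b \<in> B" "h \<in> H" "\<theta> \<in> \<Lambda>" for b h \<theta>
    using V.tlift_pure[OF vector_space_fscale bil' BH.tensor_in[OF that(1,2)] that(3)] by (simp add: R)
  \<comment> \<open>The candidate inverse is the Hopf module inverse with b carried along: b
    \<otimes> x goes to (b \<otimes> x_{-1}) \<otimes> \<open>coinv\<close>(x_0).\<close>
  let ?f = "\<lambda>b a x. tensor fscale s (tensor t s b a) (coinv x)"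
  have f_bil: "bilinear_on s s fscale H UNIV (?f b)" for b
    by (rule bilinear_onI)
      (simp_all add: BO.tensor_linear coinv_linear TO.tensor_add_left TO.tensor_scale_left TO.tensor_add_right
        TO.tensor_scale_right)
  note f_lin = linear_cosw[OF vector_space_fscale f_bil]
  have bil'': "bilinear_on t s fscale UNIV UNIV (\<lambda>b x. cosw (?f b) x)"
    by (rule bilinear_onI)
      (simp_all add: linear_add[OF f_lin] linear_scale[OF f_lin] BO.tensor_linear TO.tensor_add_left
        TO.tensor_scale_left cosw_add_fun cosw_scale_fun[OF vector_space_fscale])
  let ?G = "tlift t s fscale UNIV UNIV (\<lambda>b x. cosw (?f b) x)"
  note linG = BO.linear_tlift[OF vector_space_fscale bil'']
    and G = BO.tlift_pure[OF vector_space_fscale bil'' UNIV_I UNIV_I]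
  have G\<Psi>: "?G (tensor t s b (h * \<theta>)) = tensor fscale s (tensor t s b h) \<theta>" if "h \<in> H" "\<theta> \<in> \<Lambda>" for b h \<theta>
  proof -
    have lin: "Vector_Spaces.linear s fscale (\<lambda>a. tensor fscale s (tensor t s b a) \<theta>)"
      by (simp add: linear_iff vector_space_axioms vector_space_fscale BO.tensor_linear TO.tensor_add_left
          TO.tensor_scale_left)
    have "cosw (?f b) (h * \<theta>) = sw (\<lambda>a c. tensor fscale s (tensor t s b (s (\<epsilon> c) a)) \<theta>) h"
      unfolding cosw_coinvariant[OF vector_space_fscale f_bil that]
      by (rule sw_cong[OF refl that(1)])
        (simp add: coinv_mult that BO.tensor_linear TO.tensor_scale_left TO.tensor_scale_right)
    then show ?thesis
      by (simp add: G sw_linear_image[OF lin, symmetric] sw_counit_right that)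
  qed
  have \<Psi>G: "?\<Psi> (?G (tensor t s b x)) = tensor t s b x" if "b \<in> B" for b x
  proof -
    have "?\<Psi> (cosw (?f b) x) = cosw (\<lambda>a x. tensor t s b (a * coinv x)) x"
      unfolding cosw_linear_image[OF lin] by (rule cosw_cong) (simp add: \<Psi> that coinv_coinvariant)
    then show ?thesis
      by (simp add: G cosw_linear_image[OF BO.linear_tensor_right, symmetric] cosw_mult_coinv)
  qed
  \<comment> \<open>Any \<open>W\<close> stable under left multiplication, coaction and
    \<open>coinv\<close> will do; taking \<open>UNIV\<close> and each \<open>\<Omega> n\<close>
    gives the full and the degreewise statement at once.\<close>
  have bij: "bij_betw ?\<Psi> (tspace fscale s (tspace t s B H) (\<Lambda> \<inter> W)) (tspace t s B W)"
    if W: "\<And>h x. h \<in> H \<Longrightarrow> x \<in> W \<Longrightarrow> h * x \<in> W" "\<And>x. x \<in> W \<Longrightarrow> coact x \<in> tspace s s H W"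
      "\<And>x. x \<in> W \<Longrightarrow> coinv x \<in> W" for W
    \<comment> \<open>Flattening the nested span leaves the generators (b \<otimes> h) \<otimes> x,
      on which both maps are known explicitly.\<close>
    unfolding tspace_nested tspace_def[of t s B W]
  proof (rule bij_betw_span[OF lin linG], goal_cases)
    case (1 X)
    then obtain b h x where X: "X = tensor fscale s (tensor t s b h) x" "b \<in> B" "h \<in> H" "x \<in> \<Lambda>" "x \<in> W"
      by blast
    have "tensor t s b (h * x) \<in> {tensor t s v w |v w. v \<in> B \<and> w \<in> W}" using X W(1) by blast
    then show ?case unfolding X(1) \<Psi>[OF X(2-4)] by (rule fs.span_base)
  next
    case (2 Y)
    then obtain b x where Y: "Y = tensor t s b x" "b \<in> B" "x \<in> W" by blast
    show ?case unfolding Y(1) G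
      by (rule cosw_degree[OF vector_space_fscale fs.subspace_span f_bil W(2)[OF Y(3)]])
        (use Y(2) W(3) coinv_coinvariant in \<open>blast intro: fs.span_base\<close>)
  qed (auto simp: \<Psi> G\<Psi> \<Psi>G)
  have "bij_betw ?\<Psi> (tspace fscale s (tspace t s B H) (\<Lambda> \<inter> UNIV)) (tspace t s B UNIV)"
    by (rule bij) (simp_all add: coact_in)
  moreover have "bij_betw ?\<Psi> (tspace fscale s (tspace t s B H) (\<Lambda> \<inter> \<Omega> n)) (tspace t s B (\<Omega> n))" for n
    by (rule bij) (simp_all add: mult_H_degree coact_degree coinv_degree)
  ultimately show ?thesis using lin \<Psi> by (intro exI[of _ ?\<Psi>]) (auto simp: bij_betw_def)
qed

section \<open>The crossed product of base forms\<close>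

text \<open>The innermost sum of the crossed product, with \<open>h2\<close>, \<open>h1\<close>,
  \<open>x\<close> in the places of \<eta>_{-2}, \<eta>_{-1}, \<eta>_0 and the coaction of the
  second form \<open>y\<close> summed out.\<close>

definition kernel_form where
  "kernel_form w w' y h2 h1 x = cosw (\<lambda>g x'. tensor t s (w * act h2 w' * \<sigma> h1 g) (x * x')) y"

lemma act_linear:
  "h \<in> H \<Longrightarrow> g \<in> H \<Longrightarrow> act (h + g) w = act h w + act g w" "h \<in> H \<Longrightarrow> act (s c h) w = t c (act h w)"
  "h \<in> H \<Longrightarrow> act h (w + w') = act h w + act h w'" "h \<in> H \<Longrightarrow> act h (t c w) = t c (act h w)"
  using bilinear_onD[OF Base.forms_act_bilinear _ UNIV_I] by simp_all

lemmas cocycle_linear = bilinear_onD[OF Crossed.cocycle_bilinear]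

lemmas ring_linear = distrib_left distrib_right scale_mult BO.scale_mult

lemma innermost_bilinear:
  assumes "h2 \<in> H" "h1 \<in> H"
  shows "bilinear_on s s fscale H UNIV (\<lambda>g x'. tensor t s (w * act h2 w' * \<sigma> h1 g) (x * x'))"
  by (rule bilinear_onI) (simp_all add: assms cocycle_linear ring_linear BO.tensor_linear)

lemma kernel_form_linear:
  assumes "h2 \<in> H" "h1 \<in> H"
  shows "kernel_form (w + v) w' y h2 h1 x = kernel_form w w' y h2 h1 x + kernel_form v w' y h2 h1 x"
    "kernel_form (t c w) w' y h2 h1 x = fscale c (kernel_form w w' y h2 h1 x)"
    "kernel_form w (w' + v') y h2 h1 x = kernel_form w w' y h2 h1 x + kernel_form w v' y h2 h1 x"
    "kernel_form w (t c w') y h2 h1 x = fscale c (kernel_form w w' y h2 h1 x)"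
    "kernel_form w w' (y + y') h2 h1 x = kernel_form w w' y h2 h1 x + kernel_form w w' y' h2 h1 x"
    "kernel_form w w' (s c y) h2 h1 x = fscale c (kernel_form w w' y h2 h1 x)"
  using linear_cosw[OF vector_space_fscale innermost_bilinear[OF assms]]
  by (simp_all add: kernel_form_def ring_linear BO.tensor_linear act_linear assms cosw_add_fun
      cosw_scale_fun[OF vector_space_fscale] linear_iff)

lemma kernel_form_trilinear: "trilinear_on s fscale H UNIV (kernel_form w w' y)"
  unfolding kernel_form_def
  by (rule trilinear_onI)
    (simp_all add: act_linear cocycle_linear ring_linear BO.tensor_linear cosw_add_fun
      cosw_scale_fun[OF vector_space_fscale] cong: cosw_cong)

text \<open>The crossed product before the Koszul sign is inserted.\<close>

definition mult_form where
  "mult_form w w' x y = cosw (\<lambda>h x. sw (\<lambda>h2 h1. kernel_form w w' y h2 h1 x) h) x"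

lemma mult_form_outer_bilinear:
  "bilinear_on s s fscale H UNIV (\<lambda>h x. sw (\<lambda>h2 h1. kernel_form w w' y h2 h1 x) h)"
  by (rule bilinear_sw_first[OF vector_space_fscale kernel_form_trilinear])

lemma mult_form_linear:
  "mult_form (w + v) w' x y = mult_form w w' x y + mult_form v w' x y"
  "mult_form (t c w) w' x y = fscale c (mult_form w w' x y)"
  "mult_form w (w' + v') x y = mult_form w w' x y + mult_form w v' x y"
  "mult_form w (t c w') x y = fscale c (mult_form w w' x y)"
  "mult_form w w' (x + x') y = mult_form w w' x y + mult_form w w' x' y"
  "mult_form w w' (s c x) y = fscale c (mult_form w w' x y)"
  "mult_form w w' x (y + y') = mult_form w w' x y + mult_form w w' x y'"
  "mult_form w w' x (s c y) = fscale c (mult_form w w' x y)"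
  using linear_cosw[OF vector_space_fscale mult_form_outer_bilinear[of w w' y]]
  by (simp_all add: mult_form_def kernel_form_linear sw_add_fun sw_scale_fun[OF vector_space_fscale] cosw_add_fun
      cosw_scale_fun[OF vector_space_fscale] linear_iff cong: sw_cong cosw_cong)

lemma cosweedler_eq_cosw:
  "vector_space u \<Longrightarrow> bilinear_on s s u H UNIV f \<Longrightarrow> cosweedler s H \<Delta> d u f x = cosw f x"
  unfolding cosweedler_def left_coaction_eq by (rule cosw_tlift[symmetric])

text \<open>The lifts in the definition constrain their functions only when the legs lie in H, and
  there each inner lift equals a sum. The replacement therefore proceeds from the innermost lift
  outwards by \<open>tlift_cong\<close>.\<close>

lemma mult_form_eq:
  "cosweedler3 s H \<Delta> d fscale (\<lambda>h2 h1 x0. cosweedler s H \<Delta> d fscale (\<lambda>g y0.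
     tensor t s (w * act h2 w' * \<sigma> h1 g) (x0 * y0)) y) x = mult_form w w' x y"
proof -
  have 1: "cosweedler s H \<Delta> d fscale (\<lambda>g y0. tensor t s (w * act h2 w' * \<sigma> h1 g) (x0 * y0)) y =
      kernel_form w w' y h2 h1 x0" if "h2 \<in> H" "h1 \<in> H" for h2 h1 x0
    unfolding kernel_form_def by (rule cosweedler_eq_cosw[OF vector_space_fscale innermost_bilinear[OF that]])
  have "sweedler s H \<Delta> fscale (\<lambda>h2 h1. cosweedler s H \<Delta> d fscale
      (\<lambda>g y0. tensor t s (w * act h2 w' * \<sigma> h1 g) (x0 * y0)) y) h = sw (\<lambda>h2 h1. kernel_form w w' y h2 h1 x0) h"
    if "h \<in> H" for h x0
  proof -
    have "bilinear_on s s fscale H H (\<lambda>h2 h1. kernel_form w w' y h2 h1 x0)"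
      by (rule bilinear_onI) (simp_all add: trilinear_onD[OF kernel_form_trilinear])
    from sweedler_eq_tsum[OF vector_space_fscale this that]
    have "sweedler s H \<Delta> fscale (\<lambda>h2 h1. kernel_form w w' y h2 h1 x0) h = sw (\<lambda>h2 h1. kernel_form w w' y h2 h1 x0) h"
      by (simp add: sw_def)
    moreover have "tlift s s fscale H H (\<lambda>h2 h1. cosweedler s H \<Delta> d fscale
        (\<lambda>g y0. tensor t s (w * act h2 w' * \<sigma> h1 g) (x0 * y0)) y) =
        tlift s s fscale H H (\<lambda>h2 h1. kernel_form w w' y h2 h1 x0)"
      by (rule tlift_cong) (rule 1)
    ultimately show ?thesis by (simp add: sweedler_def)
  qed
  then have "tlift s s fscale H UNIV (\<lambda>h x0. sweedler s H \<Delta> fscale (\<lambda>h2 h1. cosweedler s H \<Delta> d fscale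
      (\<lambda>g y0. tensor t s (w * act h2 w' * \<sigma> h1 g) (x0 * y0)) y) h) =
      tlift s s fscale H UNIV (\<lambda>h x. sw (\<lambda>h2 h1. kernel_form w w' y h2 h1 x) h)"
    by (rule tlift_cong)
  then show ?thesis
    \<comment> \<open>The instantiated pattern unfolds only the outer \<open>cosweedler\<close>; the
      inner one must stay folded for the equation just proved to match.\<close>
    unfolding cosweedler3_def mult_form_def cosweedler_def[of _ _ _ _ _ "\<lambda>h x0. sweedler s H \<Delta> fscale (G h x0) h" for G]
      left_coaction_eq cosw_tlift[OF vector_space_fscale mult_form_outer_bilinear]
    by simp
qed

definition signed_mult where
  "signed_mult w x w' y = koszul \<Omega> \<Omega>B fscale (\<lambda>x w'. mult_form w w' x y) x w'"

lemma mult_form_bilinear: "bilinear_on s t fscale UNIV UNIV (\<lambda>x w'. mult_form w w' x y)"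
  by (rule bilinear_onI) (simp_all add: mult_form_linear)

lemma signed_mult_linear:
  "signed_mult (w + v) x w' y = signed_mult w x w' y + signed_mult v x w' y"
  "signed_mult (t c w) x w' y = fscale c (signed_mult w x w' y)"
  "signed_mult w (x + x') w' y = signed_mult w x w' y + signed_mult w x' w' y"
  "signed_mult w (s c x) w' y = fscale c (signed_mult w x w' y)"
  "signed_mult w x (w' + v') y = signed_mult w x w' y + signed_mult w x v' y"
  "signed_mult w x (t c w') y = fscale c (signed_mult w x w' y)"
  "signed_mult w x w' (y + y') = signed_mult w x w' y + signed_mult w x w' y'"
  "signed_mult w x w' (s c y) = fscale c (signed_mult w x w' y)"
  using bilinear_onD[OF BO.swap.koszul_bilinear[OF vector_space_fscale mult_form_bilinear]]
  by (simp_all add: signed_mult_def mult_form_linear BO.swap.koszul_add_fun[OF vector_space_fscale]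
      BO.swap.koszul_scale_fun[OF vector_space_fscale])

lemma crossed_mult_tensor:
  "crossed_mult s H \<Delta> \<Omega> d t \<Omega>B act \<sigma> (tensor t s w x) (tensor t s w' y) = signed_mult w x w' y"
proof -
  have 1: "bilinear_on t s fscale UNIV UNIV (signed_mult w x)" for w x
    by (rule bilinear_onI) (simp_all add: signed_mult_linear)
  have 2: "tlift t s fscale UNIV UNIV (signed_mult w x) (tensor t s w' y) = signed_mult w x w' y" for w x
    by (rule BO.tlift_pure[OF vector_space_fscale 1 UNIV_I UNIV_I])
  have 3: "bilinear_on t s fscale UNIV UNIV (\<lambda>w x. signed_mult w x w' y)"
    by (rule bilinear_onI) (simp_all add: signed_mult_linear)
  have "crossed_mult s H \<Delta> \<Omega> d t \<Omega>B act \<sigma> (tensor t s w x) (tensor t s w' y) =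
      tlift t s fscale UNIV UNIV (\<lambda>w x. tlift t s fscale UNIV UNIV (signed_mult w x) (tensor t s w' y)) (tensor t s w x)"
    unfolding crossed_mult_def mult_form_eq signed_mult_def[abs_def] ..
  then show ?thesis
    using BO.tlift_pure[OF vector_space_fscale 3 UNIV_I UNIV_I] by (simp add: 2)
qed

lemma sw_one:
  assumes "vector_space u" "bilinear_on s s u H H f"
  shows "sw f 1 = f 1 1"
  unfolding sw_def Hopf.comult_one by (rule HH.tsum_pure[OF assms Hopf.one_closed Hopf.one_closed])

text \<open>Evaluating the recursion at 1 requires its Sweedler sum to be over a bilinear function,
  hence linearity of the shorter iterated action in h; for this reason both claims share one
  induction.\<close>

lemma iterated_act_linear: "linear_on s t H (iterated_act s H \<Delta> t act ys x)"
  and iterated_act_one: "(\<And>y. y \<in> insert x (set ys) \<Longrightarrow> act 1 y = y) \<Longrightarrow>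
    iterated_act s H \<Delta> t act ys x 1 = x * prod_list ys"
proof (induction ys arbitrary: x)
  case Nil
  case 1
  show ?case by (simp add: linear_on_def act_linear)
  case 2
  then show ?case by simp
next
  case (Cons y ys)
  have bil: "bilinear_on s s t H H (\<lambda>h1 h2. act h1 x * iterated_act s H \<Delta> t act ys y h2)" for x
    by (rule bilinear_onI) (use Cons.IH(1)[of y] in \<open>simp_all add: linear_on_def act_linear ring_linear\<close>)
  have eq: "iterated_act s H \<Delta> t act (y # ys) x h = sw (\<lambda>h1 h2. act h1 x * iterated_act s H \<Delta> t act ys y h2) h"
    if "h \<in> H" for h x
    unfolding sw_def using sweedler_eq_tsum[OF vs_t bil that] by simp
  case 1
  show ?case
    unfolding linear_on_def
    by (intro conjI ballI allI) (simp_all only: eq HH.add_V HH.scale_V sw_add[OF vs_t bil] sw_scale[OF vs_t bil])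
  case 2
  then show ?case using Cons.IH(2)[of y] by (simp only: eq Hopf.one_closed sw_one[OF vs_t bil]) simp
qed

text \<open>The unit acts trivially on B, hence on dB because the action commutes with the
  differential, and hence on generators because 1 is grouplike.\<close>

lemma act_one_form: "act 1 w = w"
proof (rule span_eqI[OF _ BO.A.linear_ident _ Base.span_generators])
  show "Vector_Spaces.linear t t (act 1)" by (simp add: linear_iff vs_t act_linear Hopf.one_closed)
  fix w assume "w \<in> {b * prod_list (map dB bs) |b bs. b \<in> B \<and> set bs \<subseteq> B}"
  then obtain b bs where w: "w = b * prod_list (map dB bs)" "b \<in> B" "set bs \<subseteq> B" by blast
  have "act 1 y = y" if "y \<in> insert b (set (map dB bs))" for y
    using that w Hopf.one_closed by (auto simp: Crossed.act_one Base.forms_act_diff)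
  from iterated_act_one[of b "map dB bs", OF this] show "act 1 w = w"
    using w by (simp add: Base.forms_act_mult Hopf.one_closed)
qed

text \<open>Every leg of 1 is 1, and the normalised cocycle gives \<sigma>(1, 1) = 1.\<close>

lemma mult_form_one: "mult_form w w' 1 1 = tensor t s (w * w') 1"
proof -
  have bil: "bilinear_on s s fscale H H (\<lambda>h2 h1. kernel_form w w' 1 h2 h1 1)"
    by (rule bilinear_onI) (simp_all add: trilinear_onD[OF kernel_form_trilinear])
  have bil': "bilinear_on s s fscale H H (\<lambda>g x'. tensor t s (w * act 1 w' * \<sigma> 1 g) (1 * x'))"
    using innermost_bilinear[OF Hopf.one_closed Hopf.one_closed, of w w' 1]
    by (auto simp: bilinear_on_def linear_on_def)
  have bil'': "bilinear_on s s fscale H H (\<lambda>h x. sw (\<lambda>h2 h1. kernel_form w w' 1 h2 h1 x) h)"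
    using mult_form_outer_bilinear[of w w' 1] by (auto simp: bilinear_on_def linear_on_def)
  have "mult_form w w' 1 1 = kernel_form w w' 1 1 1 1"
    by (simp add: mult_form_def cosw_H[OF vector_space_fscale mult_form_outer_bilinear] Hopf.one_closed
        sw_one[OF vector_space_fscale bil''] sw_one[OF vector_space_fscale bil])
  also have "\<dots> = tensor t s (w * act 1 w' * \<sigma> 1 1) (1 * 1)"
    unfolding kernel_form_def cosw_H[OF vector_space_fscale innermost_bilinear[OF Hopf.one_closed Hopf.one_closed] Hopf.one_closed]
    by (rule sw_one[OF vector_space_fscale bil'])
  finally show ?thesis
    by (simp add: act_one_form Crossed.cocycle_unit_left Hopf.one_closed Hopf.counit_one)
qed

text \<open>The unit of \<Omega>(H) has degree zero, so it passes homogeneous w' without a sign;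
  linearity in w' covers the rest.\<close>

lemma crossed_mult_base:
  "tensor t s (w * w') 1 = crossed_mult s H \<Delta> \<Omega> d t \<Omega>B act \<sigma> (tensor t s w 1) (tensor t s w' 1)"
proof -
  have "Vector_Spaces.linear t fscale (\<lambda>w'. signed_mult w 1 w' 1)" "Vector_Spaces.linear t fscale (\<lambda>w'. tensor t s (w * w') 1)"
    by (simp_all add: linear_iff vs_t vector_space_fscale signed_mult_linear ring_linear BO.tensor_linear)
  then have "signed_mult w 1 w' 1 = tensor t s (w * w') 1"
  proof (rule BO.A.linear_eq_homogeneous)
    fix k w' assume "w' \<in> \<Omega>B k"
    then show "signed_mult w 1 w' 1 = tensor t s (w * w') 1"
      unfolding signed_mult_def
      by (simp add: BO.swap.koszul_homogeneous[OF vector_space_fscale mult_form_bilinear one_degree] mult_form_one)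
  qed
  then show ?thesis by (simp add: crossed_mult_tensor)
qed

lemma crossed_diff_base: "tensor t s (dB w) 1 = tensor_diff t \<Omega>B dB s d (tensor t s w 1)"
  by (simp add: BO.D_tensor diff_one)

end

text \<open>Coinciding as calculi means more than having equal underlying spaces, so degrees,
  products and differentials are compared as well. \<open>\<Phi>\<close> and \<open>\<Psi>\<close>
  make the identification of vertical forms explicit: \<open>\<Psi>\<close> acts as
  \<open>\<Phi>\<close> on the last two factors.\<close>

theorem proposition6p8:
  fixes sH :: "'k::field \<Rightarrow> 'h::{ring,monoid_mult} \<Rightarrow> 'h" and H \<Gamma> :: "'h set"
    and \<Delta> :: "'h \<Rightarrow> ('k, 'h, 'h) tensor" and \<epsilon> :: "'h \<Rightarrow> 'k" and S :: "'h \<Rightarrow> 'h"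
    and \<Omega>H :: "nat \<Rightarrow> 'h set" and dH :: "'h \<Rightarrow> 'h"
    and sB :: "'k \<Rightarrow> 'b::{ring,monoid_mult} \<Rightarrow> 'b" and B :: "'b set"
    and \<Omega>B :: "nat \<Rightarrow> 'b set" and dB :: "'b \<Rightarrow> 'b"
    and act :: "'h \<Rightarrow> 'b \<Rightarrow> 'b" and \<sigma> \<sigma>' :: "'h \<Rightarrow> 'h \<Rightarrow> 'b"
  assumes "crossed_product sH H \<Delta> \<epsilon> S sB B act \<sigma> \<sigma>'"
    and "bicovariant_calculus sH H \<Delta> \<Gamma> dH"
    and "maximal_prolongation sH H \<Gamma> \<Omega>H dH"
    and "twisted_module_calculus sH H \<Delta> sB B \<Omega>B dB act \<sigma>"
  shows
    \<comment> \<open>base forms: \<open>\<omega> \<mapsto> \<omega> \<otimes> 1\<close> identifies the calculus on \<open>B\<close> with the base forms\<close>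
    "(base_forms sH H \<Delta> \<Omega>H dH sB = tspace sB sH UNIV (range (\<lambda>c. sH c 1)) \<and>
      Vector_Spaces.linear sB fscale (\<lambda>\<omega>. tensor sB sH \<omega> 1) \<and>
      bij_betw (\<lambda>\<omega>. tensor sB sH \<omega> 1) UNIV (base_forms sH H \<Delta> \<Omega>H dH sB) \<and>
      (\<forall>n. (\<lambda>\<omega>. tensor sB sH \<omega> 1) ` \<Omega>B n =
        base_forms sH H \<Delta> \<Omega>H dH sB \<inter> tensor_degree sB \<Omega>B sH \<Omega>H n) \<and>
      (\<forall>\<omega> \<omega>'. tensor sB sH (\<omega> * \<omega>') 1 =
        crossed_mult sH H \<Delta> \<Omega>H dH sB \<Omega>B act \<sigma> (tensor sB sH \<omega> 1) (tensor sB sH \<omega>' 1)) \<and>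
      (\<forall>\<omega>. tensor sB sH (dB \<omega>) 1 = tensor_diff sB \<Omega>B dB sH dH (tensor sB sH \<omega> 1)))
     \<and>
     (\<exists>\<Phi>. Vector_Spaces.linear fscale sH \<Phi> \<and>
        (\<forall>h\<in>H. \<forall>\<theta>\<in>left_coinvariants sH H \<Delta> dH. \<Phi> (tensor sH sH h \<theta>) = h * \<theta>) \<and>
        bij_betw \<Phi> (tspace sH sH H (left_coinvariants sH H \<Delta> dH)) UNIV)
     \<and>
     (\<exists>\<Psi>. Vector_Spaces.linear fscale fscale \<Psi> \<and>
        (\<forall>b\<in>B. \<forall>h\<in>H. \<forall>\<theta>\<in>left_coinvariants sH H \<Delta> dH.
          \<Psi> (tensor fscale sH (tensor sB sH b h) \<theta>) = tensor sB sH b (h * \<theta>)) \<and>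
        bij_betw \<Psi> (vertical_forms sH H \<Delta> dH sB B) (tspace sB sH B UNIV) \<and>
        (\<forall>n. \<Psi> ` tspace fscale sH (tspace sB sH B H) (left_coinvariants sH H \<Delta> dH \<inter> \<Omega>H n) =
          tspace sB sH B (\<Omega>H n)))
     \<and>
     (horizontal_forms sH H \<Delta> \<Omega>H dH sB = tspace sB sH UNIV H \<and>
      (\<forall>n. horizontal_forms sH H \<Delta> \<Omega>H dH sB \<inter> tensor_degree sB \<Omega>B sH \<Omega>H n =
        tspace sB sH (\<Omega>B n) H))"
proof -
  interpret Crossed: crossed_product sH H \<Delta> \<epsilon> S sB B act \<sigma> \<sigma>' by fact
  have "bicovariant_prolongation sH H \<Delta> \<epsilon> S \<Gamma> \<Omega>H dH"
    by (intro bicovariant_prolongation.intro Crossed.hopf_algebra_axioms assms)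
  then interpret crossed_calculus sH H \<Delta> \<epsilon> S \<Gamma> \<Omega>H dH sB B act \<sigma> \<sigma>' \<Omega>B dB
    by (intro crossed_calculus.intro assms)
  show ?thesis
    unfolding vertical_forms_def
    by (intro conjI allI) (rule base_forms_eq BO.linear_tensor_left base_forms_bij base_forms_degree
      crossed_mult_base crossed_diff_base Hopf_module_iso vertical_iso horizontal_forms_eq horizontal_forms_degree)+
qed

end
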